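(* Let $\bar A=(A_0,A_1)$ be a compatible couple of (quasi-)Banach spaces with $A_0\cap A_1\neq\{0\}$. Let $0<q_1,r_1\le\infty$ and $a_1,b_1\in SV$ be such that $\|s^{-1/r_1}b_1(s)\|_{r_1,(1,\infty)}<\infty$ and $\left\|s^{-1/r_1}b_1(s)\|u^{-1/q_1}a_1(u)\|_{q_1,(0,s)}\right\|_{r_1,(0,1)}<\infty$, and put $$\chi_1(t)=\left\|s^{-1/r_1}b_1(s)\|u^{-1/q_1}a_1(u)\|_{q_1,(0,s)}\right\|_{r_1,(0,t)}+\|s^{-1/r_1}b_1(s)\|_{r_1,(t,\infty)}\|u^{-1/q_1}a_1(u)\|_{q_1,(0,t)}.$$ Let $0<\theta_0<1$, $0<r,r_0,q_0\le\infty$, $a,a_0,b_0\in SV$, and $\|s^{-1/r_0}b_0(s)\|_{r_0,(1,\infty)}<\infty$. Put $\chi_0(t)=a_0(t)\|s^{-1/r_0}b_0(s)\|_{r_0,(t,\infty)}$ and $\rho(t)=t^{1-\theta_0}\frac{\chi_0(t)}{\chi_1(t)}$. For given $0\le\theta\le1$ denote $a^{\#}=\chi_0^{1-\theta}\chi_1^{\theta}\,(a\circ\rho)$ and $\eta=(1-\theta)\theta_0+\theta$. (i) If $0<\theta<1$, then $\left(\bar A^{\mathcal L}_{\theta_0,r_0,b_0,q_0,a_0},\bar A^{\mathcal L}_{1,r_1,b_1,q_1,a_1}\right)_{\theta,r,a}=\bar A_{\eta,r,a^{\#}}$. (ii) If $\|s^{-1/r}a(s)\|_{r,(1,\infty)}<\infty$,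 then $$\left(\bar A^{\mathcal L}_{\theta_0,r_0,b_0,q_0,a_0},\bar A^{\mathcal L}_{1,r_1,b_1,q_1,a_1}\right)_{0,r,a}=\bar A^{\mathcal L}_{\theta_0,r,B_0,q_0,a_0}\cap\bar A^{\mathcal L,\mathcal L}_{\theta_0,r,a\circ\rho,r_0,b_0,q_0,a_0},$$ where $B_0(t)=\|s^{-1/r_0}b_0(s)\|_{r_0,(t,\infty)}\,a(\rho(t))$. (iii) If $\|s^{-1/r}a(s)\|_{r,(0,1)}<\infty$, then, with $\theta=1$ (i.e. $a^{\#}=\chi_1\,(a\circ\rho)$), $\left(\bar A^{\mathcal L}_{\theta_0,r_0,b_0,q_0,a_0},\bar A^{\mathcal L}_{1,r_1,b_1,q_1,a_1}\right)_{1,r,a}=\bar A_{1,r,a^{\#}}\cap\bar A^{\mathcal L,\mathcal R}_{1,r,a\circ\rho,r_1,b_1,q_1,a_1}$.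
   Context: Conventions: $1/\infty=0$; $\|\cdot\|_{q,(a,b)}$ is the usual (quasi-)norm of $L_q$ on the interval $(a,b)$, $0<q\le\infty$. Two positive functions satisfy $f\approx g$ (are equivalent) if $C^{-1}g\le f\le Cg$ for some constant $C>0$ independent of all significant quantities. $b\in SV$ (slowly varying) means that $b$ is a positive Lebesgue measurable function on $(0,\infty)$ such that for each $\varepsilon>0$ the function $t^{\varepsilon}b(t)$ is equivalent to an increasing function and $t^{-\varepsilon}b(t)$ is equivalent to a decreasing function. For a compatible couple $(X_0,X_1)$ of (quasi-)normed spaces, $K(t,f;X_0,X_1)=\inf\{\|f_0\|_{X_0}+t\|f_1\|_{X_1}: f=f_0+f_1,\ f_i\in X_i\}$ for $f\in X_0+X_1$, $t>0$; $K(t,f):=K(t,f;A_0,A_1)$. For $0\le\theta\le1$, $0<q\le\infty$, $b\in SV$, $(X_0,X_1)_{\theta,q,b}$ is the space of all $f\in X_0+X_1$ with finite (quasi-)norm $\|u^{-\theta-1/q}b(u)K(u,f;X_0,X_1)\|_{q,(0,\infty)}$, and $\bar A_{\theta,q,b}:=(A_0,A_1)_{\theta,q,b}$. For $0<p,r,q\le\infty$ and $a,b,c\in SV$, the following are the spaces of all $f\in A_0+A_1$ with finite (quasi-)norm: - $\bar A^{\mathcal L}_{\theta,r,b,q,a}$: $\left\|t^{-1/r}b(t)\|u^{-\theta-1/q}a(u)K(u,f)\|_{q,(0,t)}\right\|_{r,(0,\infty)}$; - $\bar A^{\mathcal L,\mathcal L}_{\theta,p,c,r,b,q,a}$: $\left\|t^{-1/p}c(t)\left\|u^{-1/r}b(u)\|v^{-\theta-1/q}a(v)K(v,f)\|_{q,(0,u)}\right\|_{r,(0,t)}\right\|_{p,(0,\infty)}$;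 - $\bar A^{\mathcal L,\mathcal R}_{\theta,p,c,r,b,q,a}$: $\left\|t^{-1/p}c(t)\left\|u^{-1/r}b(u)\|v^{-\theta-1/q}a(v)K(v,f)\|_{q,(t,u)}\right\|_{r,(t,\infty)}\right\|_{p,(0,\infty)}$. Equality of (quasi-)normed spaces means that each is continuously embedded in the other; intersections carry the maximum (equivalently, the sum) of the (quasi-)norms. Standing assumption: none of the spaces under consideration is $\{0\}$. *)

theory Defs
  imports "HOL-Analysis.Analysis"
begin

section \<open>Quasi-Banach spaces and compatible couples\<close>

text \<open>
  The scalar field is the real field. Complex spaces are covered by restriction of scalars, since
  none of the spaces built below depends on the scalar multiplication.
\<close>

class hausdorff_tvs = real_vector + topological_ab_group_add + t2_space +
  assumes tendsto_scaleR_Pair: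
    "LIM p (nhds c \<times>\<^sub>F nhds x). fst p *\<^sub>R snd p :> nhds (c *\<^sub>R x)"

instance real_normed_vector \<subseteq> hausdorff_tvs
proof
  fix c :: real and x :: 'a
  show "LIM p (nhds c \<times>\<^sub>F nhds x). fst p *\<^sub>R snd p :> nhds (c *\<^sub>R x)"
    unfolding nhds_prod[symmetric]
    using tendsto_scaleR[OF tendsto_fst[OF filterlim_ident] tendsto_snd[OF filterlim_ident],
        of "(c, x)"] by simp
qed

text \<open>
  The (quasi-)norm only matters on the carrier, where it is finite; it is \<open>ennreal\<close>-valued
  because the spaces considered later are defined by finiteness of an integral expression.
\<close>

record 'a qspace =
  carr :: "'a set"
  qnorm :: "'a \<Rightarrow> ennreal"

definition quasi_normed :: "'a::real_vector qspace \<Rightarrow> bool" where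
  "quasi_normed X \<longleftrightarrow>
     subspace (carr X) \<and>
     (\<forall>x\<in>carr X. qnorm X x < top) \<and>
     (\<forall>x\<in>carr X. qnorm X x = 0 \<longleftrightarrow> x = 0) \<and>
     (\<forall>c. \<forall>x\<in>carr X. qnorm X (c *\<^sub>R x) = ennreal \<bar>c\<bar> * qnorm X x) \<and>
     (\<exists>C::real. \<forall>x\<in>carr X. \<forall>y\<in>carr X. qnorm X (x + y) \<le> ennreal C * (qnorm X x + qnorm X y))"

definition quasi_banach :: "'a::real_vector qspace \<Rightarrow> bool" where
  "quasi_banach X \<longleftrightarrow>
     quasi_normed X \<and>
     (\<forall>s :: nat \<Rightarrow> 'a.
        range s \<subseteq> carr X \<and> (\<forall>e>0. \<exists>N. \<forall>m\<ge>N. \<forall>n\<ge>N. qnorm X (s m - s n) < e) \<longrightarrow>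
        (\<exists>x\<in>carr X. (\<lambda>n. qnorm X (s n - x)) \<longlonglongrightarrow> 0))"

text \<open>Continuity of the inclusion into the ambient space; by linearity, continuity at 0 suffices.\<close>

definition embedded_in_ambient :: "'a::hausdorff_tvs qspace \<Rightarrow> bool" where
  "embedded_in_ambient X \<longleftrightarrow>
     (\<forall>U. open U \<and> 0 \<in> U \<longrightarrow> (\<exists>e>0. \<forall>x\<in>carr X. qnorm X x < e \<longrightarrow> x \<in> U))"

definition compatible_couple :: "'a::hausdorff_tvs qspace \<Rightarrow> 'a qspace \<Rightarrow> bool" where
  "compatible_couple X Y \<longleftrightarrow>
     quasi_banach X \<and> quasi_banach Y \<and> embedded_in_ambient X \<and> embedded_in_ambient Y"

definition cont_embedded :: "'a qspace \<Rightarrow> 'a qspace \<Rightarrow> bool" where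
  "cont_embedded X Y \<longleftrightarrow>
     carr X \<subseteq> carr Y \<and> (\<exists>C::real. \<forall>x\<in>carr X. qnorm Y x \<le> ennreal C * qnorm X x)"

definition space_eq :: "'a qspace \<Rightarrow> 'a qspace \<Rightarrow> bool" (infix \<open>\<cong>\<^sub>q\<close> 50) where
  "X \<cong>\<^sub>q Y \<longleftrightarrow> cont_embedded X Y \<and> cont_embedded Y X"

definition space_inter :: "'a qspace \<Rightarrow> 'a qspace \<Rightarrow> 'a qspace" (infixl \<open>\<inter>\<^sub>q\<close> 70) where
  "X \<inter>\<^sub>q Y = \<lparr> carr = carr X \<inter> carr Y, qnorm = (\<lambda>x. max (qnorm X x) (qnorm Y x)) \<rparr>"

definition sum_carr :: "'a::plus qspace \<Rightarrow> 'a qspace \<Rightarrow> 'a set" where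
  "sum_carr X Y = {x + y | x y. x \<in> carr X \<and> y \<in> carr Y}"

definition Kfun :: "real \<Rightarrow> 'a::plus \<Rightarrow> 'a qspace \<Rightarrow> 'a qspace \<Rightarrow> ennreal" where
  "Kfun t f X Y =
     Inf {qnorm X x + ennreal t * qnorm Y y | x y. x \<in> carr X \<and> y \<in> carr Y \<and> f = x + y}"


section \<open>The quasi-norm of \<open>L\<^sub>q\<close> and slowly varying functions\<close>

text \<open>The exponents range over \<open>0 < q \<le> \<infinity>\<close>; note that \<open>inverse \<infinity> = 0\<close> in \<open>ennreal\<close>.\<close>

definition recip :: "ennreal \<Rightarrow> real" where
  "recip q = enn2real (inverse q)"

definition epowr :: "ennreal \<Rightarrow> real \<Rightarrow> ennreal" where
  "epowr x p = (if x = top then top else ennreal (enn2real x powr p))"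

text \<open>
  For \<open>q = \<infinity>\<close> this is the essential supremum, written so that it stays monotone in \<open>g\<close> for all
  functions: a composition of two Lebesgue measurable functions need not be measurable, but the
  compositions used as weights here are equivalent to measurable functions. For the same reason it
  matters that the integral below is monotone without any measurability condition.
\<close>

definition Lnorm :: "ennreal \<Rightarrow> real set \<Rightarrow> (real \<Rightarrow> ennreal) \<Rightarrow> ennreal" where
  "Lnorm q S g =
     (if q = top then Inf {z. AE x in lebesgue_on S. g x \<le> z}
      else epowr (\<integral>\<^sup>+ x. epowr (g x) (enn2real q) \<partial>lebesgue_on S) (recip q))"

definition equivalent :: "(real \<Rightarrow> real) \<Rightarrow> (real \<Rightarrow> real) \<Rightarrow> bool" where
  "equivalent f g \<longleftrightarrow> (\<exists>C>0. \<forall>t>0. g t / C \<le> f t \<and> f t \<le> C * g t)"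

definition SV :: "(real \<Rightarrow> real) set" where
  "SV = {b. (\<forall>t>0. 0 < b t) \<and> b \<in> borel_measurable (lebesgue_on {0<..}) \<and>
     (\<forall>\<epsilon>>0.
        (\<exists>g. (\<forall>t>0. 0 < g t) \<and> mono_on {0<..} g \<and> equivalent (\<lambda>t. t powr \<epsilon> * b t) g) \<and>
        (\<exists>g. (\<forall>t>0. 0 < g t) \<and> antimono_on {0<..} g \<and> equivalent (\<lambda>t. t powr (- \<epsilon>) * b t) g))}"


section \<open>Interpolation spaces\<close>

text \<open>The weight \<open>u\<^bsup>-\<theta>-1/q\<^esup> b(u)\<close>; in particular \<open>weight 0 q b u\<close> is \<open>u\<^bsup>-1/q\<^esup> b(u)\<close>.\<close>

definition weight :: "real \<Rightarrow> ennreal \<Rightarrow> (real \<Rightarrow> real) \<Rightarrow> real \<Rightarrow> ennreal" where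
  "weight \<theta> q b u = ennreal (u powr (- \<theta> - recip q) * b u)"

definition finite_space ::
    "'a::plus qspace \<Rightarrow> 'a qspace \<Rightarrow> ('a \<Rightarrow> ennreal) \<Rightarrow> 'a qspace" where
  "finite_space X Y N = \<lparr> carr = {f \<in> sum_carr X Y. N f < top}, qnorm = N \<rparr>"

definition interp ::
    "'a::plus qspace \<Rightarrow> 'a qspace \<Rightarrow> real \<Rightarrow> ennreal \<Rightarrow> (real \<Rightarrow> real) \<Rightarrow> 'a qspace" where
  "interp X Y \<theta> q b = finite_space X Y
     (\<lambda>f. Lnorm q {0<..} (\<lambda>u. weight \<theta> q b u * Kfun u f X Y))"

definition interp_L ::
    "'a::plus qspace \<Rightarrow> 'a qspace \<Rightarrow> real \<Rightarrow> ennreal \<Rightarrow> (real \<Rightarrow> real) \<Rightarrow>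
     ennreal \<Rightarrow> (real \<Rightarrow> real) \<Rightarrow> 'a qspace" where
  "interp_L X Y \<theta> r b q a = finite_space X Y
     (\<lambda>f. Lnorm r {0<..} (\<lambda>t. weight 0 r b t *
            Lnorm q {0<..<t} (\<lambda>u. weight \<theta> q a u * Kfun u f X Y)))"

definition interp_LL ::
    "'a::plus qspace \<Rightarrow> 'a qspace \<Rightarrow> real \<Rightarrow> ennreal \<Rightarrow> (real \<Rightarrow> real) \<Rightarrow>
     ennreal \<Rightarrow> (real \<Rightarrow> real) \<Rightarrow> ennreal \<Rightarrow> (real \<Rightarrow> real) \<Rightarrow> 'a qspace" where
  "interp_LL X Y \<theta> p c r b q a = finite_space X Y
     (\<lambda>f. Lnorm p {0<..} (\<lambda>t. weight 0 p c t *
            Lnorm r {0<..<t} (\<lambda>u. weight 0 r b u *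
              Lnorm q {0<..<u} (\<lambda>v. weight \<theta> q a v * Kfun v f X Y))))"

definition interp_LR ::
    "'a::plus qspace \<Rightarrow> 'a qspace \<Rightarrow> real \<Rightarrow> ennreal \<Rightarrow> (real \<Rightarrow> real) \<Rightarrow>
     ennreal \<Rightarrow> (real \<Rightarrow> real) \<Rightarrow> ennreal \<Rightarrow> (real \<Rightarrow> real) \<Rightarrow> 'a qspace" where
  "interp_LR X Y \<theta> p c r b q a = finite_space X Y
     (\<lambda>f. Lnorm p {0<..} (\<lambda>t. weight 0 p c t *
            Lnorm r {t<..} (\<lambda>u. weight 0 r b u *
              Lnorm q {t<..<u} (\<lambda>v. weight \<theta> q a v * Kfun v f X Y))))"

end

theory Submission
  imports Defs
begin

text \<open>
  The theorem follows from a Holmstedt type formula. Write \<open>k = K(\<cdot>, f)\<close>,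
  \<open>P(s) = \<parallel>u\<^bsup>-\<theta>\<^sub>0-1/q\<^sub>0\<^esup> a\<^sub>0(u) k(u)\<parallel>\<close> over \<open>(0, s)\<close> and
  \<open>Q(t, s) = \<parallel>u\<^bsup>-1-1/q\<^sub>1\<^esup> a\<^sub>1(u) k(u)\<parallel>\<close> over \<open>(t, s)\<close>. Then
  \<open>K(\<rho>(t), f; X\<^sub>0, X\<^sub>1) \<approx> I(t) + II(t) + \<rho>(t) III(t)\<close>, where \<open>I\<close> is the \<open>X\<^sub>0\<close>-norm cut off at \<open>t\<close>,
  \<open>II(t)\<close> is \<open>P(t)\<close> times the tail of \<open>b\<^sub>0\<close>, and \<open>III(t) = \<parallel>s\<^bsup>-1/r\<^sub>1\<^esup> b\<^sub>1(s) Q(t, s)\<parallel>\<close> over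
  \<open>(t, \<infinity>)\<close>. For the upper bound split \<open>f\<close> nearly optimally for \<open>K(t, f)\<close>. For the lower bound every
  term is subadditive up to a constant, and an element \<open>g\<close> of \<open>X\<^sub>0\<close> or \<open>X\<^sub>1\<close> satisfies
  \<open>K(u, g) \<le> C u\<^bsup>\<theta>\<^sub>0\<^esup> / \<chi>\<^sub>0(u) \<parallel>g\<parallel>\<close> or \<open>K(u, g) \<le> C u / \<chi>\<^sub>1(u) \<parallel>g\<parallel>\<close>, which controls the mixed terms.

  It remains to take the outer norm after the substitution \<open>u = \<rho>(t)\<close>. All functions involved change at
  most by a constant factor on dyadic intervals, so their norms are equivalent to \<open>\<ell>\<^sub>r\<close>-norms of their
  values at the powers of 2. This gives the substitution although \<open>\<rho>\<close> is not differentiable, and it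
  reduces the Hardy inequalities, for all exponents at once, to the boundedness on \<open>\<ell>\<^sub>r\<close> of
  \<open>x \<mapsto> (sup\<^sub>j 2\<^bsup>-\<delta>|i-j|\<^esup> x\<^sub>j)\<^sub>i\<close>: the terms \<open>I + II\<close> and \<open>\<rho> III\<close> are suprema of this type of
  \<open>t\<^bsup>-\<theta>\<^sub>0\<^esup> \<chi>\<^sub>0(t) k(t)\<close>, and only at an endpoint \<open>\<theta> = 0\<close> or \<open>\<theta> = 1\<close> does one of them survive
  as a separate norm.
\<close>

section \<open>The \<open>L\<^sub>q\<close> quasi-norm\<close>

text \<open>The form of \<open>\<rho>\<close> is forced. It is the quotient of the two pointwise
  bounds for elements of X1 and X0, so the normalised functions \<open>khat\<close> and
  \<open>ktil\<close> differ exactly by the factor \<open>\<rho>\<close>, and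
  \<open>\<rho> t\<close> is the argument at which a decomposition tuned to t balances both norms.
  Since \<theta>0 < 1, \<open>\<rho>\<close> grows like a power up to slow variation; this growth
  pays for the small power (t/u)^\<delta> lost in each Hardy estimate. The core estimates see f only
  through k, so they are proved for arbitrary quasiconcave k, and independence of the constants from
  f is automatic. Two obstacles shape the details. Norms may be infinite, so a factor leaves a norm
  only in the direction that is always valid, or after its finiteness is known. And the integral of
  a nonmeasurable function is a lower integral, monotone but not subadditive, while weights such as
  \<open>a \<circ> \<rho>\<close> may be nonmeasurable; before a sum is split the weight is
  exchanged for an equivalent Borel function.\<close>

lemma epowr_0 [simp]: "epowr 0 p = 0"
  by (simp add: epowr_def)

lemma epowr_top [simp]: "epowr top p = top"
  by (simp add: epowr_def)

lemma epowr_ennreal: "0 \<le> x \<Longrightarrow> epowr (ennreal x) p = ennreal (x powr p)"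
  by (simp add: epowr_def)

lemma epowr_mono: "0 \<le> p \<Longrightarrow> x \<le> y \<Longrightarrow> epowr x p \<le> epowr y p"
  by (cases x; cases y) (auto simp: epowr_ennreal powr_mono2 ennreal_leI top_unique)

lemma epowr_mult: "0 < p \<Longrightarrow> epowr (x * y) p = epowr x p * epowr y p"
proof (cases x; cases y)
  fix a b :: real assume "0 < p" "0 \<le> a" "x = ennreal a" "0 \<le> b" "y = ennreal b"
  then show ?thesis by (simp add: epowr_ennreal ennreal_mult[symmetric] powr_mult)
next
  fix a :: real assume "0 < p" "0 \<le> a" "x = ennreal a" "y = top"
  then show ?thesis
    by (cases "a = 0") (auto simp: epowr_ennreal ennreal_mult_top)
next
  fix a :: real assume "0 < p" "0 \<le> a" "y = ennreal a" "x = top"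
  then show ?thesis
    by (cases "a = 0") (auto simp: epowr_ennreal ennreal_top_mult)
qed auto

lemma epowr_epowr: "epowr (epowr x p) s = epowr x (p * s)"
  by (cases x) (auto simp: epowr_ennreal powr_powr)

lemma epowr_1 [simp]: "epowr x 1 = x"
  by (cases x) (auto simp: epowr_ennreal)

lemma epowr_inverse: "0 < p \<Longrightarrow> epowr (epowr x p) (1 / p) = x"
  "0 < p \<Longrightarrow> epowr (epowr x (1 / p)) p = x"
  by (simp_all add: epowr_epowr)

lemma epowr_le_iff: "0 < p \<Longrightarrow> epowr x p \<le> y \<longleftrightarrow> x \<le> epowr y (1 / p)"
  using epowr_mono[of "1/p" "epowr x p" y] epowr_mono[of p x "epowr y (1/p)"]
  by (auto simp: epowr_inverse)

lemma epowr_measurable [measurable]: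
  "f \<in> borel_measurable M \<Longrightarrow> (\<lambda>x. epowr (f x) p) \<in> borel_measurable M"
proof -
  assume [measurable]: "f \<in> borel_measurable M"
  have "(\<lambda>x. if f x = top then top else ennreal (exp (p * ln (enn2real (f x)))))
      \<in> borel_measurable M" by measurable
  moreover have "epowr (f x) p = (if f x = top then top else if f x = 0 then 0
      else ennreal (exp (p * ln (enn2real (f x)))))" for x
    by (auto simp: epowr_def powr_def enn2real_eq_0_iff)
  ultimately show ?thesis by simp
qed

text \<open>Comparing both summands with the larger one treats p < 1 and p \<ge> 1 alike, at the
  price of the constant 2^p.\<close>

lemma epowr_add_le:
  assumes "0 < p"
  shows "epowr (x + y) p \<le> ennreal (2 powr p) * (epowr x p + epowr y p)"
proof -
  have "x + y \<le> ennreal 2 * max x y"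
    by (cases "x \<le> y") (auto simp: max_def mult_2 intro: add_mono)
  then have "epowr (x + y) p \<le> epowr (ennreal 2 * max x y) p"
    using assms by (intro epowr_mono) auto
  also have "\<dots> = ennreal (2 powr p) * epowr (max x y) p"
    using assms by (simp add: epowr_mult epowr_ennreal del: ennreal_numeral)
  also have "\<dots> \<le> ennreal (2 powr p) * (epowr x p + epowr y p)"
    by (intro mult_left_mono) (auto simp: max_def)
  finally show ?thesis .
qed

lemma recip_top [simp]: "recip top = 0"
  by (simp add: recip_def)

lemma recip_finite:
  assumes "0 < q" "q \<noteq> top"
  shows "recip q = 1 / enn2real q" "0 < enn2real q"
  using assms by (cases q; simp add: recip_def inverse_ennreal divide_inverse)+

lemma recip_nonneg [simp]: "0 \<le> recip q"
  by (simp add: recip_def)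

text \<open>Measurability of \<open>f\<close> is not assumed, so only one inequality holds when \<open>c = \<infinity>\<close>.\<close>

lemma nn_integral_cmult_ge: "c * (\<integral>\<^sup>+x. f x \<partial>M) \<le> (\<integral>\<^sup>+x. c * f x \<partial>M)"
proof -
  have "c * (\<integral>\<^sup>+x. f x \<partial>M) = (SUP g \<in> {g. simple_function M g \<and> g \<le> f}. c * integral\<^sup>S M g)"
    unfolding nn_integral_def by (subst SUP_mult_left_ennreal) auto
  also have "\<dots> \<le> (\<integral>\<^sup>+x. c * f x \<partial>M)"
  proof (rule SUP_least)
    fix g assume "g \<in> {g. simple_function M g \<and> g \<le> f}"
    then have g: "simple_function M g" "\<And>x. g x \<le> f x" by (auto simp: le_fun_def)
    then have "c * integral\<^sup>S M g = (\<integral>\<^sup>+x. c * g x \<partial>M)"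
      by (subst nn_integral_cmult) (auto simp: nn_integral_eq_simple_integral borel_measurable_simple_function)
    also have "\<dots> \<le> (\<integral>\<^sup>+x. c * f x \<partial>M)"
      using g by (intro nn_integral_mono mult_left_mono) auto
    finally show "c * integral\<^sup>S M g \<le> (\<integral>\<^sup>+x. c * f x \<partial>M)" .
  qed
  finally show ?thesis .
qed

lemma Lnorm_top: "Lnorm top S g = Inf {z. AE x in lebesgue_on S. g x \<le> z}"
  by (simp add: Lnorm_def)

lemma Lnorm_finite:
  assumes "0 < q" "q \<noteq> top"
  shows "Lnorm q S g =
    epowr (\<integral>\<^sup>+ x. epowr (g x) (enn2real q) \<partial>lebesgue_on S) (1 / enn2real q)"
  using assms by (simp add: Lnorm_def recip_finite)

lemma Lnorm_mono:
  assumes "\<And>x. x \<in> S \<Longrightarrow> f x \<le> g x"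
  shows "Lnorm q S f \<le> Lnorm q S g"
proof (cases "q = top")
  case True
  have "AE x in lebesgue_on S. f x \<le> z" if "AE x in lebesgue_on S. g x \<le> z" for z
    using that AE_space by eventually_elim (auto intro: order_trans[OF assms])
  then show ?thesis unfolding True Lnorm_top by (intro Inf_superset_mono Collect_mono impI)
next
  case False
  then show ?thesis unfolding Lnorm_def
    using assms by (auto intro!: epowr_mono nn_integral_mono)
qed

text \<open>The factor may be \<infinity>: later it is a value of a tame function or of
  \<open>P k\<close>, neither of which is known to be finite. For the essential supremum the
  ordinary case is division by c, the others are degenerate.\<close>

lemma Lnorm_cmult_ge:
  assumes "0 < q"
  shows "c * Lnorm q S g \<le> Lnorm q S (\<lambda>x. c * g x)"
proof (cases "q = top")
  case True
  show ?thesis unfolding True Lnorm_top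
  proof (rule Inf_greatest)
    fix z assume z: "z \<in> {z. AE x in lebesgue_on S. c * g x \<le> z}"
    consider "c = 0" | "z = top" | "c = top" "z \<noteq> top" | "c \<noteq> 0" "c \<noteq> top" by blast
    then show "c * Inf {z. AE x in lebesgue_on S. g x \<le> z} \<le> z"
    proof cases
      case 3
      \<comment> \<open>A finite bound on an infinite multiple forces \<open>g\<close> to vanish
        almost everywhere.\<close>
      have "AE x in lebesgue_on S. g x \<le> 0"
        using z 3 by (auto elim!: AE_mp intro!: AE_I2 simp: ennreal_top_mult top_unique split: if_splits)
      then have "Inf {z. AE x in lebesgue_on S. g x \<le> z} \<le> 0" by (intro Inf_lower) auto
      then show ?thesis by simp
    next
      case 4
      have "AE x in lebesgue_on S. g x \<le> z / c"
      proof -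
        have "g x \<le> z / c" if "c * g x \<le> z" for x
        proof -
          have "g x = c * g x / c"
            using 4 ennreal_mult_divide_eq[of c "g x"] by (simp add: mult.commute)
          also have "\<dots> \<le> z / c" using that by (rule divide_right_mono_ennreal)
          finally show ?thesis .
        qed
        then show ?thesis using z by (auto elim: eventually_mono)
      qed
      then have "Inf {z. AE x in lebesgue_on S. g x \<le> z} \<le> z / c" by (intro Inf_lower) auto
      then have "c * Inf {z. AE x in lebesgue_on S. g x \<le> z} \<le> c * (z / c)"
        by (rule mult_left_mono) auto
      also have "c * (z / c) = z"
        using 4 ennreal_mult_divide_eq[of c z] by (simp add: ennreal_times_divide mult.commute[of c])
      finally show ?thesis .
    qed simp_all
  qed
next
  case False
  define p where "p = enn2real q"
  have p: "0 < p" using recip_finite[OF assms False] by (simp add: p_def)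
  have "c * epowr X (1/p) = epowr (epowr c p * X) (1 / p)" for X
    using p by (simp add: epowr_mult epowr_inverse)
  then have "c * Lnorm q S g = epowr (epowr c p * (\<integral>\<^sup>+ x. epowr (g x) p \<partial>lebesgue_on S)) (1 / p)"
    by (simp add: Lnorm_finite[OF assms False] p_def)
  also have "\<dots> \<le> epowr (\<integral>\<^sup>+ x. epowr c p * epowr (g x) p \<partial>lebesgue_on S) (1 / p)"
    using p by (intro epowr_mono nn_integral_cmult_ge) auto
  also have "\<dots> = Lnorm q S (\<lambda>x. c * g x)"
    using p by (simp add: Lnorm_finite[OF assms False] epowr_mult p_def)
  finally show ?thesis .
qed

text \<open>For finite nonzero c the missing inequality is \<open>Lnorm_cmult_ge\<close> with the
  factor \<open>inverse c\<close>, so measurability of \<open>g\<close> never enters.\<close>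

lemma Lnorm_cmult:
  assumes "0 < q" "c < top"
  shows "Lnorm q S (\<lambda>x. c * g x) = c * Lnorm q S g"
proof (cases "c = 0")
  case True
  have "Lnorm q S (\<lambda>x. 0) = 0"
  proof (cases "q = top")
    case True
    have "Inf {z. AE x in lebesgue_on S. (0::ennreal) \<le> z} \<le> 0" by (intro Inf_lower) auto
    then show ?thesis unfolding True Lnorm_top by simp
  qed (simp add: Lnorm_def)
  then show ?thesis using True by simp
next
  case False
  then have c: "c * inverse c = 1" "inverse c * c = 1"
    using assms ennreal_divide_self[of c] by (simp_all add: divide_ennreal_def mult.commute)
  have "inverse c * Lnorm q S (\<lambda>x. c * g x) \<le> Lnorm q S (\<lambda>x. inverse c * (c * g x))"
    by (rule Lnorm_cmult_ge[OF assms(1)])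
  also have "(\<lambda>x. inverse c * (c * g x)) = g" using c by (simp add: mult.assoc[symmetric])
  finally have "c * (inverse c * Lnorm q S (\<lambda>x. c * g x)) \<le> c * Lnorm q S g"
    by (rule mult_left_mono) auto
  then have "Lnorm q S (\<lambda>x. c * g x) \<le> c * Lnorm q S g"
    using c by (simp add: mult.assoc[symmetric])
  then show ?thesis using Lnorm_cmult_ge[OF assms(1)] by (intro antisym) auto
qed

lemma Lnorm_subset:
  assumes "0 < q" "S \<subseteq> T" "S \<in> sets borel" "T \<in> sets borel"
  shows "Lnorm q S g \<le> Lnorm q T g"
proof (cases "q = top")
  case True
  have "AE x in lebesgue_on S. g x \<le> z" if "AE x in lebesgue_on T. g x \<le> z" for z
    using that assms(2-) by (auto simp: AE_restrict_space_iff elim!: eventually_mono)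
  then show ?thesis unfolding True Lnorm_top by (intro Inf_superset_mono) auto
next
  case False
  show ?thesis unfolding Lnorm_finite[OF assms(1) False]
    using assms recip_finite[OF assms(1) False]
    by (intro epowr_mono) (auto simp: nn_integral_restrict_space indicator_def intro!: nn_integral_mono)
qed

text \<open>One infimum is taken at a time by moving the other summand to the left. Truncated
  subtraction undoes addition only away from \<infinity>, hence the case distinctions. The lemma
  serves the essential supremum and the K-functional alike.\<close>

lemma ennreal_le_Inf_add:
  fixes x :: ennreal
  assumes "\<And>a b. a \<in> A \<Longrightarrow> b \<in> B \<Longrightarrow> x \<le> a + b"
  shows "x \<le> Inf A + Inf B"
proof (cases "A = {} \<or> B = {}")
  case False
  have "x - a \<le> Inf B" if "a \<in> A" "a \<noteq> top" for a
    using assms that by (intro Inf_greatest) (auto simp: ennreal_minus_le_iff)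
  then have 1: "x \<le> a + Inf B" if "a \<in> A" for a
    using that by (cases "a = top") (auto simp: ennreal_minus_le_iff)
  show ?thesis
  proof (cases "Inf B = top")
    case False
    then have "x - Inf B \<le> Inf A"
      using 1 by (intro Inf_greatest) (auto simp: ennreal_minus_le_iff add.commute)
    then have "x \<le> Inf B + Inf A" by (simp only: ennreal_minus_le_iff)
    then show ?thesis by (subst add.commute)
  next
    case True
    show ?thesis unfolding True by simp
  qed
next
  case True
  then show ?thesis by (elim disjE) simp_all
qed

text \<open>For finite q with exponent p, the factor 2 is the p-th root of the 2^p in
  \<open>epowr_add_le\<close>, and 2^(1/p) comes from taking the root of a sum by the same lemma.
  For q = \<infinity>, where the essential supremum is subadditive, any constant at least 1 would
  do.\<close>

definition qconst :: "ennreal \<Rightarrow> real" where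
  "qconst q = 2 * 2 powr recip q"

lemma qconst_ge_1: "1 \<le> qconst q"
  using ge_one_powr_ge_zero[of 2 "recip q"] by (simp add: qconst_def)

lemma le_qconst_mult: "x \<le> ennreal (qconst q) * x"
  using mult_right_mono[of 1 "ennreal (qconst q)" x] qconst_ge_1[of q] by simp

text \<open>The common last step of \<open>Lnorm_add\<close> and \<open>Lnorm_Un\<close>: an
  inequality between integrals of p-th powers becomes one between norms.\<close>

lemma epowr_quasi_triangle:
  assumes "0 < q" "q \<noteq> top" "Z \<le> ennreal (2 powr enn2real q) * (X + Y)"
  shows "epowr Z (1 / enn2real q) \<le>
    ennreal (qconst q) * (epowr X (1 / enn2real q) + epowr Y (1 / enn2real q))"
proof -
  define p where "p = enn2real q"
  have p: "0 < p" "recip q = 1 / p" using recip_finite[OF assms(1,2)] by (auto simp: p_def)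
  have "epowr Z (1/p) \<le> epowr (ennreal (2 powr p) * (X + Y)) (1/p)"
    using assms p by (intro epowr_mono) (auto simp: p_def)
  also have "\<dots> = ennreal 2 * epowr (X + Y) (1/p)"
    using p by (simp add: epowr_mult epowr_ennreal powr_powr del: ennreal_numeral)
  also have "\<dots> \<le> ennreal 2 * (ennreal (2 powr (1/p)) * (epowr X (1/p) + epowr Y (1/p)))"
    using p by (intro mult_left_mono epowr_add_le) auto
  also have "\<dots> = ennreal (qconst q) * (epowr X (1/p) + epowr Y (1/p))"
    using p by (simp add: qconst_def ennreal_mult mult.assoc)
  finally show ?thesis by (simp add: p_def)
qed

text \<open>Measurability enters through additivity of the integral; lower integrals of
  nonmeasurable functions are only superadditive.\<close>

lemma Lnorm_add:
  assumes "0 < q" "f \<in> borel_measurable (lebesgue_on S)" "g \<in> borel_measurable (lebesgue_on S)"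
  shows "Lnorm q S (\<lambda>x. f x + g x) \<le> ennreal (qconst q) * (Lnorm q S f + Lnorm q S g)"
proof (cases "q = top")
  case True
  have "Lnorm q S (\<lambda>x. f x + g x) \<le> Lnorm q S f + Lnorm q S g"
    unfolding True Lnorm_top
  proof (rule ennreal_le_Inf_add)
    fix a b assume "a \<in> {z. AE x in lebesgue_on S. f x \<le> z}" "b \<in> {z. AE x in lebesgue_on S. g x \<le> z}"
    then have "AE x in lebesgue_on S. f x \<le> a" "AE x in lebesgue_on S. g x \<le> b" by auto
    then have "AE x in lebesgue_on S. f x + g x \<le> a + b"
      by eventually_elim (rule add_mono)
    then show "Inf {z. AE x in lebesgue_on S. f x + g x \<le> z} \<le> a + b" by (intro Inf_lower) auto
  qed
  then show ?thesis using le_qconst_mult order_trans by blast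
next
  case False
  define p where "p = enn2real q"
  have p: "0 < p" using recip_finite[OF assms(1) False] by (auto simp: p_def)
  note [measurable] = assms(2,3)
  have "(\<integral>\<^sup>+ x. epowr (f x + g x) p \<partial>lebesgue_on S)
     \<le> (\<integral>\<^sup>+ x. ennreal (2 powr p) * (epowr (f x) p + epowr (g x) p) \<partial>lebesgue_on S)"
    by (intro nn_integral_mono epowr_add_le p)
  also have "\<dots> = ennreal (2 powr p) * ((\<integral>\<^sup>+ x. epowr (f x) p \<partial>lebesgue_on S)
      + (\<integral>\<^sup>+ x. epowr (g x) p \<partial>lebesgue_on S))"
    by (simp add: nn_integral_cmult nn_integral_add)
  finally show ?thesis
    unfolding Lnorm_finite[OF assms(1) False]
    by (intro epowr_quasi_triangle assms(1) False) (simp add: p_def)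
qed

text \<open>The point \<open>x\<close> allows two open intervals to cover a third one up to their
  common endpoint, which is a null set.\<close>

lemma Lnorm_Un:
  assumes "0 < q" "f \<in> borel_measurable borel" "S \<subseteq> T \<union> U \<union> {x}"
    "S \<in> sets borel" "T \<in> sets borel" "U \<in> sets borel"
  shows "Lnorm q S f \<le> ennreal (qconst q) * (Lnorm q T f + Lnorm q U f)"
proof -
  have N: "AE y in lebesgue. y \<noteq> x"
    using AE_completion[OF AE_lborel_singleton[of x]] by simp
  show ?thesis
  proof (cases "q = top")
    case True
    have "Lnorm q S f \<le> Lnorm q T f + Lnorm q U f"
      unfolding True Lnorm_top
    proof (rule ennreal_le_Inf_add)
      fix a b assume "a \<in> {z. AE x in lebesgue_on T. f x \<le> z}" "b \<in> {z. AE x in lebesgue_on U. f x \<le> z}"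
      then have "AE x in lebesgue. x \<in> T \<longrightarrow> f x \<le> a" "AE x in lebesgue. x \<in> U \<longrightarrow> f x \<le> b"
        using assms by (auto simp: AE_restrict_space_iff)
      then have "AE x in lebesgue. x \<in> S \<longrightarrow> f x \<le> a + b" using N
      proof eventually_elim
        case (elim y)
        then show ?case using assms(3) add_increasing2[of b "f y" a] add_increasing[of a "f y" b] by auto
      qed
      then show "Inf {z. AE x in lebesgue_on S. f x \<le> z} \<le> a + b"
        using assms by (intro Inf_lower) (auto simp: AE_restrict_space_iff)
    qed
    then show ?thesis using le_qconst_mult order_trans by blast
  next
    case False
    define p where "p = enn2real q"
    have p: "0 < p" using recip_finite[OF assms(1) False] by (auto simp: p_def)
    have [measurable]: "f \<in> borel_measurable lebesgue"
      using assms(2) by (intro measurable_completion) simp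
    have [measurable]: "S \<in> sets lebesgue" "T \<in> sets lebesgue" "U \<in> sets lebesgue"
      using assms(4-6) by simp_all
    have "(\<integral>\<^sup>+ y. epowr (f y) p \<partial>lebesgue_on S) = (\<integral>\<^sup>+ y. epowr (f y) p * indicator S y \<partial>lebesgue)"
      using assms by (simp add: nn_integral_restrict_space)
    also have "\<dots> \<le> (\<integral>\<^sup>+ y. epowr (f y) p * indicator T y + epowr (f y) p * indicator U y \<partial>lebesgue)"
      using N by (intro nn_integral_mono_AE, eventually_elim) (use assms(3) in \<open>auto simp: indicator_def\<close>)
    also have "\<dots> = (\<integral>\<^sup>+ y. epowr (f y) p * indicator T y \<partial>lebesgue)
        + (\<integral>\<^sup>+ y. epowr (f y) p * indicator U y \<partial>lebesgue)"
      by (rule nn_integral_add) measurable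
    also have "\<dots> = (\<integral>\<^sup>+ y. epowr (f y) p \<partial>lebesgue_on T) + (\<integral>\<^sup>+ y. epowr (f y) p \<partial>lebesgue_on U)"
      using assms by (simp add: nn_integral_restrict_space)
    finally have *: "(\<integral>\<^sup>+ y. epowr (f y) p \<partial>lebesgue_on S) \<le> 1 * \<dots>" by simp
    also have "1 * ((\<integral>\<^sup>+ y. epowr (f y) p \<partial>lebesgue_on T) + (\<integral>\<^sup>+ y. epowr (f y) p \<partial>lebesgue_on U)) 
       \<le> ennreal (2 powr p) * ((\<integral>\<^sup>+ y. epowr (f y) p \<partial>lebesgue_on T) + (\<integral>\<^sup>+ y. epowr (f y) p \<partial>lebesgue_on U))"
      using p ge_one_powr_ge_zero[of 2 p] by (intro mult_right_mono) simp_all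
    finally show ?thesis
      unfolding Lnorm_finite[OF assms(1) False] p_def
      by (rule epowr_quasi_triangle[OF assms(1) False])
  qed
qed

section \<open>Slowly varying functions\<close>

text \<open>For positive arguments \<open>dil e s t\<close> is \<open>max (s/t) (t/s) powr e\<close>.\<close>

definition dil :: "real \<Rightarrow> real \<Rightarrow> real \<Rightarrow> real" where
  "dil e s t = exp (e * \<bar>ln s - ln t\<bar>)"

lemma dil_pos [simp]: "0 < dil e s t" "0 \<le> dil e s t" "dil e s t \<noteq> 0"
  by (simp_all add: dil_def)

lemma dil_commute: "dil e s t = dil e t s"
  by (simp add: dil_def abs_minus_commute)

lemma dil_self [simp]: "dil e s s = 1"
  by (simp add: dil_def)

lemma dil_mult: "dil e s t * dil e' s t = dil (e + e') s t"
  by (simp add: dil_def exp_add[symmetric] algebra_simps)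

lemma dil_ge_1: "0 \<le> e \<Longrightarrow> 1 \<le> dil e s t"
  by (simp add: dil_def)

lemma dil_triangle: "0 \<le> e \<Longrightarrow> dil e s t \<le> dil e s u * dil e u t"
  using mult_left_mono[of "\<bar>ln s - ln t\<bar>" "\<bar>ln s - ln u\<bar> + \<bar>ln u - ln t\<bar>" e]
  by (simp add: dil_def exp_add[symmetric] distrib_left[symmetric] del: exp_add)

lemma dil_uminus: "dil (- e) s t = 1 / dil e s t"
  by (simp add: dil_def exp_minus field_simps)

lemma dil_le: "0 < s \<Longrightarrow> s \<le> t \<Longrightarrow> dil e s t = (t / s) powr e"
  by (simp add: dil_def powr_def ln_div algebra_simps)

lemma powr_le_dil: "0 < s \<Longrightarrow> 0 < t \<Longrightarrow> s powr \<alpha> \<le> dil \<bar>\<alpha>\<bar> s t * t powr \<alpha>"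
proof -
  have "\<alpha> * (ln s - ln t) \<le> \<bar>\<alpha>\<bar> * \<bar>ln s - ln t\<bar>"
    by (metis abs_ge_self abs_mult)
  then show "0 < s \<Longrightarrow> 0 < t \<Longrightarrow> s powr \<alpha> \<le> dil \<bar>\<alpha>\<bar> s t * t powr \<alpha>"
    by (simp add: dil_def powr_def exp_add[symmetric] algebra_simps)
qed

text \<open>Slow variation as a large-scale modulus of continuity of ln b in the variable ln t:
  products turn into sums, and exchanging s and t makes the bound two-sided. Measurability is left
  out on purpose, so that \<open>a \<circ> \<rho>\<close> qualifies.\<close>

definition sv :: "(real \<Rightarrow> real) \<Rightarrow> bool" where
  "sv b \<longleftrightarrow> (\<forall>t>0. 0 < b t) \<and>
     (\<forall>e>0. \<exists>L. \<forall>s>0. \<forall>t>0. ln (b s) - ln (b t) \<le> L + e * \<bar>ln s - ln t\<bar>)"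

lemma sv_pos: "sv b \<Longrightarrow> 0 < t \<Longrightarrow> 0 < b t"
  by (simp add: sv_def)

lemma sv_ln:
  assumes "sv b" "0 < e"
  obtains L where "0 \<le> L" "\<And>s t. 0 < s \<Longrightarrow> 0 < t \<Longrightarrow> \<bar>ln (b s) - ln (b t)\<bar> \<le> L + e * \<bar>ln s - ln t\<bar>"
proof -
  have "\<exists>L. \<forall>s>0. \<forall>t>0. ln (b s) - ln (b t) \<le> L + e * \<bar>ln s - ln t\<bar>"
    using assms by (simp add: sv_def)
  then obtain L where L: "\<And>s t. 0 < s \<Longrightarrow> 0 < t \<Longrightarrow> ln (b s) - ln (b t) \<le> L + e * \<bar>ln s - ln t\<bar>"
    by blast
  show ?thesis
  proof (rule that[of "max L 0"])
    fix s t :: real assume "0 < s" "0 < t"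
    then have "ln (b s) - ln (b t) \<le> L + e * \<bar>ln s - ln t\<bar>"
        "ln (b t) - ln (b s) \<le> L + e * \<bar>ln s - ln t\<bar>"
      using L[of s t] L[of t s] abs_minus_commute[of "ln t" "ln s"] by simp_all
    then show "\<bar>ln (b s) - ln (b t)\<bar> \<le> max L 0 + e * \<bar>ln s - ln t\<bar>"
      by linarith
  qed simp
qed

lemma sv_bound:
  assumes "sv b" "0 < e"
  obtains C where "0 < C" "\<And>s t. 0 < s \<Longrightarrow> 0 < t \<Longrightarrow> b s \<le> C * dil e s t * b t"
proof -
  obtain L where L: "\<And>s t. 0 < s \<Longrightarrow> 0 < t \<Longrightarrow> \<bar>ln (b s) - ln (b t)\<bar> \<le> L + e * \<bar>ln s - ln t\<bar>"
    using sv_ln[OF assms] by metis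
  show ?thesis
  proof (rule that[of "exp L"])
    fix s t :: real assume st: "0 < s" "0 < t"
    then have "ln (b s) \<le> L + e * \<bar>ln s - ln t\<bar> + ln (b t)"
      using L[of s t] by linarith
    then have "exp (ln (b s)) \<le> exp (L + e * \<bar>ln s - ln t\<bar> + ln (b t))" by simp
    then show "b s \<le> exp L * dil e s t * b t"
      using st sv_pos[OF assms(1)] by (simp add: exp_add dil_def)
  qed simp
qed

lemma svI:
  assumes "\<And>t. 0 < t \<Longrightarrow> 0 < b t"
    "\<And>e. 0 < e \<Longrightarrow> \<exists>C>0. \<forall>s t. 0 < s \<longrightarrow> s \<le> t \<longrightarrow>
       b s \<le> C * (t / s) powr e * b t \<and> b t \<le> C * (t / s) powr e * b s"
  shows "sv b"
  unfolding sv_def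
proof (intro conjI allI impI)
  fix e :: real assume "0 < e"
  then obtain C where C: "0 < C" "\<And>s t. 0 < s \<Longrightarrow> s \<le> t \<Longrightarrow>
       b s \<le> C * (t / s) powr e * b t \<and> b t \<le> C * (t / s) powr e * b s"
    using assms(2) by blast
  have "ln (b s) - ln (b t) \<le> ln C + e * \<bar>ln s - ln t\<bar>" if "0 < s" "0 < t" for s t
  proof -
    have "b s \<le> C * dil e s t * b t"
      using C(2)[of s t] C(2)[of t s] that dil_le[of s t e] dil_le[of t s e]
      by (cases "s \<le> t") (auto simp: dil_commute[of e s t])
    then have "ln (b s) \<le> ln (C * dil e s t * b t)"
      using assms(1) that C(1) by simp
    also have "\<dots> = ln C + e * \<bar>ln s - ln t\<bar> + ln (b t)"
      using assms(1)[OF that(2)] C(1) by (simp add: ln_mult dil_def)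
    finally show ?thesis by simp
  qed
  then show "\<exists>L. \<forall>s>0. \<forall>t>0. ln (b s) - ln (b t) \<le> L + e * \<bar>ln s - ln t\<bar>" by blast
qed (rule assms(1))

text \<open>For s \<le> t the increasing equivalent of t^e b(t) bounds b(s) by b(t), and the
  decreasing equivalent of t^(-e) b(t) bounds b(t) by b(s). Each constant is squared because the
  equivalence is used at both points.\<close>

lemma SV_imp_sv:
  assumes "b \<in> SV"
  shows "sv b"
proof (rule svI)
  show pos: "0 < b t" if "0 < t" for t using assms that by (simp add: SV_def)
  fix e :: real assume "0 < e"
  with assms obtain g h where g: "\<And>t. 0 < t \<Longrightarrow> 0 < g t" "mono_on {0<..} g"
      "equivalent (\<lambda>t. t powr e * b t) g"
    and h: "\<And>t. 0 < t \<Longrightarrow> 0 < h t" "antimono_on {0<..} h"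
      "equivalent (\<lambda>t. t powr (- e) * b t) h"
    unfolding SV_def by blast
  obtain C where C: "0 < C" "\<And>t. 0 < t \<Longrightarrow> g t / C \<le> t powr e * b t \<and> t powr e * b t \<le> C * g t"
    using g(3) unfolding equivalent_def by blast
  obtain D where D: "0 < D" "\<And>t. 0 < t \<Longrightarrow> h t / D \<le> t powr (-e) * b t \<and> t powr (-e) * b t \<le> D * h t"
    using h(3) unfolding equivalent_def by blast
  have "b s \<le> C\<^sup>2 * (t / s) powr e * b t \<and> b t \<le> D\<^sup>2 * (t / s) powr e * b s"
    if "0 < s" "s \<le> t" for s t
  proof
    have "s powr e * b s \<le> C * g s" using C that by auto
    also have "\<dots> \<le> C * g t" using g(2) C(1) that by (auto simp: mono_on_def)
    also have "\<dots> \<le> C * (C * (t powr e * b t))"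
      using C(1) C(2)[of t] that by (intro mult_left_mono) (auto simp: field_simps)
    finally show "b s \<le> C\<^sup>2 * (t / s) powr e * b t"
      using that by (simp add: powr_divide field_simps power2_eq_square)
    have "t powr (-e) * b t \<le> D * h t" using D that by auto
    also have "\<dots> \<le> D * h s" using h(2) D(1) that by (auto simp: monotone_on_def)
    also have "\<dots> \<le> D * (D * (s powr (-e) * b s))"
      using D(1) D(2)[of s] that by (intro mult_left_mono) (auto simp: field_simps)
    finally show "b t \<le> D\<^sup>2 * (t / s) powr e * b s"
      using that by (simp add: powr_divide powr_minus field_simps power2_eq_square)
  qed
  moreover have "x * y * z \<le> (C\<^sup>2 + D\<^sup>2) * y * z" if "x = C\<^sup>2 \<or> x = D\<^sup>2" "0 \<le> y" "0 \<le> z" for x y z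
    using that by (intro mult_right_mono) auto
  ultimately have "\<forall>s t. 0 < s \<longrightarrow> s \<le> t \<longrightarrow>
       b s \<le> (C\<^sup>2 + D\<^sup>2) * (t / s) powr e * b t \<and> b t \<le> (C\<^sup>2 + D\<^sup>2) * (t / s) powr e * b s"
    using pos by (smt (verit) powr_ge_zero)
  then show "\<exists>C>0. \<forall>s t. 0 < s \<longrightarrow> s \<le> t \<longrightarrow>
       b s \<le> C * (t / s) powr e * b t \<and> b t \<le> C * (t / s) powr e * b s"
    using C(1) by (intro exI[of _ "C\<^sup>2 + D\<^sup>2"]) (auto simp: add_pos_nonneg)
qed

lemma sv_mult:
  assumes "sv a" "sv b"
  shows "sv (\<lambda>t. a t * b t)"
  unfolding sv_def
proof (intro conjI allI impI)
  fix e :: real assume e: "0 < e"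
  obtain L where L: "\<And>s t. 0 < s \<Longrightarrow> 0 < t \<Longrightarrow> \<bar>ln (a s) - ln (a t)\<bar> \<le> L + e / 2 * \<bar>ln s - ln t\<bar>"
    using sv_ln[OF assms(1), of "e/2"] e by (metis half_gt_zero)
  obtain M where M: "\<And>s t. 0 < s \<Longrightarrow> 0 < t \<Longrightarrow> \<bar>ln (b s) - ln (b t)\<bar> \<le> M + e / 2 * \<bar>ln s - ln t\<bar>"
    using sv_ln[OF assms(2), of "e/2"] e by (metis half_gt_zero)
  have "ln (a s * b s) - ln (a t * b t) \<le> (L + M) + e * \<bar>ln s - ln t\<bar>" if "0 < s" "0 < t" for s t
    using L[OF that] M[OF that] sv_pos[OF assms(1)] sv_pos[OF assms(2)] that by (simp add: ln_mult_pos)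
  then show "\<exists>L. \<forall>s>0. \<forall>t>0. ln (a s * b s) - ln (a t * b t) \<le> L + e * \<bar>ln s - ln t\<bar>"
    by blast
qed (simp add: sv_pos assms)

lemma sv_powr:
  assumes "sv b"
  shows "sv (\<lambda>t. b t powr c)"
  unfolding sv_def
proof (intro conjI allI impI)
  fix e :: real assume e: "0 < e"
  \<comment> \<open>Dividing \<open>e\<close> by 1 + |c| instead of |c| covers the exponent
    0.\<close>
  obtain L where L: "0 \<le> L" "\<And>s t. 0 < s \<Longrightarrow> 0 < t \<Longrightarrow>
      \<bar>ln (b s) - ln (b t)\<bar> \<le> L + e / (1 + \<bar>c\<bar>) * \<bar>ln s - ln t\<bar>"
    using sv_ln[OF assms(1), of "e / (1 + \<bar>c\<bar>)"] e by (metis abs_ge_zero add_pos_nonneg divide_pos_pos zero_less_one)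
  have "ln (b s powr c) - ln (b t powr c) \<le> \<bar>c\<bar> * L + e * \<bar>ln s - ln t\<bar>" if "0 < s" "0 < t" for s t
  proof -
    have "ln (b s powr c) - ln (b t powr c) = c * (ln (b s) - ln (b t))"
      using sv_pos[OF assms] that by (simp add: ln_powr algebra_simps)
    also have "\<dots> \<le> \<bar>c\<bar> * \<bar>ln (b s) - ln (b t)\<bar>" by (metis abs_ge_self abs_mult)
    also have "\<dots> \<le> \<bar>c\<bar> * (L + e / (1 + \<bar>c\<bar>) * \<bar>ln s - ln t\<bar>)"
      using L(2)[OF that] by (intro mult_left_mono) auto
    also have "\<dots> = \<bar>c\<bar> * L + (\<bar>c\<bar> / (1 + \<bar>c\<bar>)) * (e * \<bar>ln s - ln t\<bar>)"
      by (simp add: algebra_simps)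
    also have "\<dots> \<le> \<bar>c\<bar> * L + 1 * (e * \<bar>ln s - ln t\<bar>)"
      using e by (intro add_left_mono mult_right_mono) (auto simp: field_simps)
    finally show ?thesis by simp
  qed
  then show "\<exists>L. \<forall>s>0. \<forall>t>0. ln (b s powr c) - ln (b t powr c) \<le> L + e * \<bar>ln s - ln t\<bar>"
    by blast
next
  show "0 < b t powr c" if "0 < t" for t using sv_pos[OF assms that] by simp
qed

lemma sv_cong:
  assumes "\<And>t. 0 < t \<Longrightarrow> a t = b t" "sv b"
  shows "sv a"
  using assms(2) unfolding sv_def by (simp add: assms(1))

lemma sv_divide:
  assumes "sv a" "sv b"
  shows "sv (\<lambda>t. a t / b t)"
proof -
  have "sv (\<lambda>t. a t * b t powr -1)" by (intro sv_mult sv_powr assms)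
  then show ?thesis
    by (rule sv_cong[rotated]) (simp add: powr_minus_divide sv_pos[OF assms(2)] less_imp_le)
qed

text \<open>In logarithmic variables \<open>\<rho>\<close> is Lipschitz at large scale with constant
  1 + |\<kappa>|, so slow variation of \<open>a\<close> with the exponent e / (1 + |\<kappa>|) gives
  the exponent e for the composition.\<close>

lemma sv_comp:
  assumes "sv a" "sv \<phi>" "\<And>t. 0 < t \<Longrightarrow> \<rho> t = t powr \<kappa> * \<phi> t"
  shows "sv (\<lambda>t. a (\<rho> t))"
  unfolding sv_def
proof (intro conjI allI impI)
  have pos: "0 < \<rho> t" if "0 < t" for t using assms(2,3) that by (simp add: sv_pos)
  then show "0 < a (\<rho> t)" if "0 < t" for t using assms(1) that by (simp add: sv_pos)
  fix e :: real assume e: "0 < e"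
  obtain M where M: "0 \<le> M" "\<And>s t. 0 < s \<Longrightarrow> 0 < t \<Longrightarrow> \<bar>ln (\<phi> s) - ln (\<phi> t)\<bar> \<le> M + 1 * \<bar>ln s - ln t\<bar>"
    using sv_ln[OF assms(2), of 1] by auto
  define d where "d = e / (1 + \<bar>\<kappa>\<bar>)"
  have d: "0 < d" "d * (1 + \<bar>\<kappa>\<bar>) = e" using e by (auto simp: d_def)
  obtain L where L: "\<And>s t. 0 < s \<Longrightarrow> 0 < t \<Longrightarrow> \<bar>ln (a s) - ln (a t)\<bar> \<le> L + d * \<bar>ln s - ln t\<bar>"
    using sv_ln[OF assms(1) d(1)] by metis
  have "ln (a (\<rho> s)) - ln (a (\<rho> t)) \<le> L + d * M + e * \<bar>ln s - ln t\<bar>" if st: "0 < s" "0 < t" for s t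
  proof -
    have "ln (\<rho> s) - ln (\<rho> t) = \<kappa> * (ln s - ln t) + (ln (\<phi> s) - ln (\<phi> t))"
      using st assms(3) sv_pos[OF assms(2)] by (simp add: ln_mult_pos ln_powr right_diff_distrib)
    then have "\<bar>ln (\<rho> s) - ln (\<rho> t)\<bar> \<le> \<bar>\<kappa>\<bar> * \<bar>ln s - ln t\<bar> + \<bar>ln (\<phi> s) - ln (\<phi> t)\<bar>"
      by (metis abs_mult abs_triangle_ineq)
    also have "\<dots> \<le> M + (1 + \<bar>\<kappa>\<bar>) * \<bar>ln s - ln t\<bar>"
      using M(2)[OF st] by (simp add: algebra_simps)
    finally have "d * \<bar>ln (\<rho> s) - ln (\<rho> t)\<bar> \<le> d * (M + (1 + \<bar>\<kappa>\<bar>) * \<bar>ln s - ln t\<bar>)"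
      using d(1) by (intro mult_left_mono) auto
    also have "\<dots> = d * M + e * \<bar>ln s - ln t\<bar>" by (simp add: d(2)[symmetric] algebra_simps)
    finally show ?thesis using L[OF pos[OF st(1)] pos[OF st(2)]] by linarith
  qed
  then show "\<exists>L. \<forall>s>0. \<forall>t>0. ln (a (\<rho> s)) - ln (a (\<rho> t)) \<le> L + e * \<bar>ln s - ln t\<bar>" by blast
qed

text \<open>The function \<open>a \<circ> \<rho>\<close> need not be measurable; this is how it enters measurable estimates.\<close>

lemma sv_equiv_borel:
  assumes "sv b"
  obtains g C where "g \<in> borel_measurable borel" "0 < C"
    "\<And>t. 0 < t \<Longrightarrow> b t \<le> g t" "\<And>t. 0 < t \<Longrightarrow> g t \<le> C * b t"
proof -
  obtain C where C: "0 < C" "\<And>s t. 0 < s \<Longrightarrow> 0 < t \<Longrightarrow> b s \<le> C * dil 1 s t * b t"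
    using sv_bound[OF assms, of 1] by auto
  have *: "s * b s \<le> C * (t * b t)" if "0 < s" "s \<le> t" for s t
    using C(2)[of s t] that dil_le[of s t 1] by (simp add: field_simps)
  \<comment> \<open>The running supremum of s b(s) is monotone, hence Borel, and it stays comparable
    with t b(t) because that function is increasing up to the factor C.\<close>
  define h where "h t = (if t \<le> 0 then 0 else Sup ((\<lambda>s. s * b s) ` {0<..t}))" for t
  have bdd: "bdd_above ((\<lambda>s. s * b s) ` {0<..t})" for t
    by (rule bdd_aboveI[of _ "C * (t * b t)"]) (use * in auto)
  have h: "t * b t \<le> h t" "h t \<le> C * (t * b t)" if "0 < t" for t
    using that * unfolding h_def by (auto intro!: cSup_upper[OF _ bdd] cSup_least)
  have "mono h"
  proof (rule monoI)
    fix s t :: real assume st: "s \<le> t"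
    show "h s \<le> h t"
    proof (cases "s \<le> 0")
      case True
      have "0 \<le> h t" using h(1)[of t] sv_pos[OF assms, of t]
        by (cases "0 < t") (auto simp: h_def intro: order_trans[of 0 "t * b t"])
      then show ?thesis using True by (simp add: h_def)
    next
      case False
      then show ?thesis using st unfolding h_def by (auto intro!: cSup_subset_mono bdd)
    qed
  qed
  then have [measurable]: "h \<in> borel_measurable borel" by (rule borel_measurable_mono)
  show ?thesis
  proof (rule that[of "\<lambda>t. h t / t" C])
    show "(\<lambda>t. h t / t) \<in> borel_measurable borel" by measurable
    show "0 < C" by (rule C(1))
    show "b t \<le> h t / t" if "0 < t" for t
      using h(1)[OF that] that by (simp add: pos_le_divide_eq mult.commute)
    show "h t / t \<le> C * b t" if "0 < t" for t
      using h(2)[OF that] that by (simp add: pos_divide_le_eq mult_ac)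
  qed
qed

text \<open>\<open>C\<close> and \<open>n\<close> are explicit because the estimates below must be uniform in \<open>G\<close>.\<close>

definition tame :: "real \<Rightarrow> real \<Rightarrow> (real \<Rightarrow> ennreal) \<Rightarrow> bool" where
  "tame C n G \<longleftrightarrow> (\<forall>s>0. \<forall>t>0. G s \<le> ennreal (C * dil n s t) * G t)"

lemma tameD: "tame C n G \<Longrightarrow> 0 < s \<Longrightarrow> 0 < t \<Longrightarrow> G s \<le> ennreal (C * dil n s t) * G t"
  by (simp add: tame_def)

lemma tame_mult:
  assumes "tame C n F" "tame D m G" "0 \<le> C" "0 \<le> D"
  shows "tame (C * D) (n + m) (\<lambda>t. F t * G t)"
  unfolding tame_def
proof (intro allI impI)
  fix s t :: real assume st: "0 < s" "0 < t"
  have "F s * G s \<le> (ennreal (C * dil n s t) * F t) * (ennreal (D * dil m s t) * G t)"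
    using assms(1,2) st by (intro mult_mono) (auto dest: tameD)
  also have "\<dots> = ennreal (C * dil n s t * (D * dil m s t)) * (F t * G t)"
    using assms(3,4) by (simp add: ennreal_mult mult_ac)
  also have "C * dil n s t * (D * dil m s t) = C * D * dil (n + m) s t"
    by (simp add: dil_mult[symmetric] mult_ac)
  finally show "F s * G s \<le> ennreal (C * D * dil (n + m) s t) * (F t * G t)" .
qed

lemma tame_powr: "tame 1 \<bar>\<alpha>\<bar> (\<lambda>t. ennreal (t powr \<alpha>))"
  using powr_le_dil by (simp add: tame_def ennreal_mult[symmetric] ennreal_leI)

lemma sv_tame:
  assumes "sv b"
  obtains C where "0 < C" "tame C 1 (\<lambda>t. ennreal (b t))"
proof -
  obtain C where C: "0 < C" "\<And>s t. 0 < s \<Longrightarrow> 0 < t \<Longrightarrow> b s \<le> C * dil 1 s t * b t"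
    using sv_bound[OF assms, of 1] by auto
  have "ennreal (b s) \<le> ennreal (C * dil 1 s t) * ennreal (b t)" if "0 < s" "0 < t" for s t
    using C(1) C(2)[OF that] sv_pos[OF assms that(2)]
    by (simp add: ennreal_mult[symmetric] ennreal_leI)
  then show ?thesis using C(1) by (intro that[of C]) (simp_all add: tame_def)
qed

section \<open>Scale invariant norms and their discretisation\<close>

text \<open>The \<open>L\<^sub>q\<close>-norm with respect to \<open>du/u\<close>: all weights are of the form \<open>u\<^bsup>-1/q\<^esup> g(u)\<close>.\<close>

definition hnorm :: "ennreal \<Rightarrow> real set \<Rightarrow> (real \<Rightarrow> ennreal) \<Rightarrow> ennreal" where
  "hnorm q S g = Lnorm q S (\<lambda>u. ennreal (u powr (- recip q)) * g u)"

lemma hnorm_mono: "(\<And>x. x \<in> S \<Longrightarrow> f x \<le> g x) \<Longrightarrow> hnorm q S f \<le> hnorm q S g"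
  unfolding hnorm_def by (intro Lnorm_mono mult_left_mono) auto

lemma hnorm_cong: "(\<And>x. x \<in> S \<Longrightarrow> f x = g x) \<Longrightarrow> hnorm q S f = hnorm q S g"
  by (intro antisym hnorm_mono) auto

lemma hnorm_cmult: "0 < q \<Longrightarrow> c < top \<Longrightarrow> hnorm q S (\<lambda>x. c * g x) = c * hnorm q S g"
  unfolding hnorm_def by (simp add: Lnorm_cmult[symmetric] mult_ac)

lemma hnorm_cmult_ge: "0 < q \<Longrightarrow> c * hnorm q S g \<le> hnorm q S (\<lambda>x. c * g x)"
  unfolding hnorm_def using Lnorm_cmult_ge[of q c S "\<lambda>u. ennreal (u powr (- recip q)) * g u"]
  by (simp add: mult_ac)

lemma hnorm_subset:
  "0 < q \<Longrightarrow> S \<subseteq> T \<Longrightarrow> S \<in> sets borel \<Longrightarrow> T \<in> sets borel \<Longrightarrow> hnorm q S g \<le> hnorm q T g"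
  unfolding hnorm_def by (rule Lnorm_subset)

lemma hnorm_le_cmult:
  assumes "0 < q" "c < top" "\<And>x. x \<in> S \<Longrightarrow> f x \<le> c * g x"
  shows "hnorm q S f \<le> c * hnorm q S g"
  using hnorm_mono[of S f "\<lambda>x. c * g x" q] assms by (simp add: hnorm_cmult)

text \<open>The weight \<open>v\<close> is kept apart from \<open>f\<close> and \<open>g\<close>: it
  may be nonmeasurable, and only the other factors have to be Borel. Fixing \<open>C\<close> before
  the set and the functions makes the constant uniform in all of them. The same applies to
  \<open>splits\<close>.\<close>

definition adds :: "ennreal \<Rightarrow> (real \<Rightarrow> real) \<Rightarrow> real \<Rightarrow> bool" where
  "adds q v C \<longleftrightarrow> (\<forall>S\<in>sets borel. \<forall>f\<in>borel_measurable borel. \<forall>g\<in>borel_measurable borel. S \<subseteq> {0<..} \<longrightarrow>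
    hnorm q S (\<lambda>u. ennreal (v u) * (f u + g u)) \<le>
      ennreal C * (hnorm q S (\<lambda>u. ennreal (v u) * f u) + hnorm q S (\<lambda>u. ennreal (v u) * g u)))"

definition splits :: "ennreal \<Rightarrow> (real \<Rightarrow> real) \<Rightarrow> real \<Rightarrow> bool" where
  "splits q v C \<longleftrightarrow> (\<forall>S\<in>sets borel. \<forall>T\<in>sets borel. \<forall>U\<in>sets borel. \<forall>x. \<forall>f\<in>borel_measurable borel.
    S \<subseteq> {0<..} \<longrightarrow> T \<subseteq> {0<..} \<longrightarrow> U \<subseteq> {0<..} \<longrightarrow> S \<subseteq> T \<union> U \<union> {x} \<longrightarrow>
    hnorm q S (\<lambda>u. ennreal (v u) * f u) \<le>
      ennreal C * (hnorm q T (\<lambda>u. ennreal (v u) * f u) + hnorm q U (\<lambda>u. ennreal (v u) * f u)))"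

lemma addsD:
  assumes "adds q v C" "S \<in> sets borel" "S \<subseteq> {0<..}" "f \<in> borel_measurable borel" "g \<in> borel_measurable borel"
  shows "hnorm q S (\<lambda>u. ennreal (v u) * (f u + g u)) \<le>
      ennreal C * (hnorm q S (\<lambda>u. ennreal (v u) * f u) + hnorm q S (\<lambda>u. ennreal (v u) * g u))"
  using assms unfolding adds_def by simp

lemma splitsD:
  assumes "splits q v C" "S \<in> sets borel" "T \<in> sets borel" "U \<in> sets borel"
    "S \<subseteq> {0<..}" "T \<subseteq> {0<..}" "U \<subseteq> {0<..}" "S \<subseteq> T \<union> U \<union> {x}" "f \<in> borel_measurable borel"
  shows "hnorm q S (\<lambda>u. ennreal (v u) * f u) \<le>
      ennreal C * (hnorm q T (\<lambda>u. ennreal (v u) * f u) + hnorm q U (\<lambda>u. ennreal (v u) * f u))"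
  using assms unfolding splits_def by blast

lemma hnorm_add_sv:
  assumes "0 < q" "sv w"
  obtains C where "adds q w C"
proof -
  obtain v D where v [measurable]: "v \<in> borel_measurable borel" and "0 < D"
    and wv: "\<And>t. 0 < t \<Longrightarrow> w t \<le> v t" "\<And>t. 0 < t \<Longrightarrow> v t \<le> D * w t"
    using sv_equiv_borel[OF assms(2)] by blast
  have vw: "ennreal (v t) \<le> ennreal D * ennreal (w t)" if "0 < t" for t
    using wv(2)[OF that] \<open>0 < D\<close> sv_pos[OF assms(2) that]
    by (simp add: ennreal_mult[symmetric] ennreal_leI)
  show ?thesis
  proof (rule that[of "qconst q * D"], unfold adds_def, intro ballI impI)
    fix S :: "real set" and f g :: "real \<Rightarrow> ennreal"
    assume S: "S \<in> sets borel" "S \<subseteq> {0<..}"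
      and [measurable]: "f \<in> borel_measurable borel" "g \<in> borel_measurable borel"
    have 1: "hnorm q S (\<lambda>u. ennreal (v u) * h u) \<le> ennreal D * hnorm q S (\<lambda>u. ennreal (w u) * h u)" for h
      using S assms(1) vw by (intro hnorm_le_cmult) (auto simp: mult.assoc[symmetric] intro!: mult_right_mono)
    have "hnorm q S (\<lambda>u. ennreal (w u) * (f u + g u)) \<le> hnorm q S (\<lambda>u. ennreal (v u) * f u + ennreal (v u) * g u)"
      using S wv by (intro hnorm_mono) (auto simp: distrib_left[symmetric] intro!: mult_right_mono ennreal_leI)
    also have "\<dots> \<le> ennreal (qconst q) *
        (hnorm q S (\<lambda>u. ennreal (v u) * f u) + hnorm q S (\<lambda>u. ennreal (v u) * g u))"
      unfolding hnorm_def distrib_left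
    proof (rule Lnorm_add[OF assms(1), unfolded distrib_left])
      have *: "h \<in> borel_measurable (lebesgue_on S)" if "h \<in> borel_measurable borel" for h :: "real \<Rightarrow> ennreal"
        by (intro measurable_restrict_space1 measurable_completion) (use that in simp)
      show "(\<lambda>u. ennreal (u powr - recip q) * (ennreal (v u) * f u)) \<in> borel_measurable (lebesgue_on S)"
        "(\<lambda>u. ennreal (u powr - recip q) * (ennreal (v u) * g u)) \<in> borel_measurable (lebesgue_on S)"
        by (rule *; measurable)+
    qed
    also have "\<dots> \<le> ennreal (qconst q) * (ennreal D * hnorm q S (\<lambda>u. ennreal (w u) * f u)
        + ennreal D * hnorm q S (\<lambda>u. ennreal (w u) * g u))"
      by (intro mult_left_mono add_mono 1) auto
    also have "\<dots> = ennreal (qconst q * D) * (hnorm q S (\<lambda>u. ennreal (w u) * f u) + hnorm q S (\<lambda>u. ennreal (w u) * g u))"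
      using \<open>0 < D\<close> qconst_ge_1[of q] by (simp add: ennreal_mult distrib_left mult.assoc)
    finally show "hnorm q S (\<lambda>u. ennreal (w u) * (f u + g u)) \<le> \<dots>" .
  qed
qed

lemma hnorm_Un_sv:
  assumes "0 < q" "sv w"
  obtains C where "splits q w C"
proof -
  obtain v D where v [measurable]: "v \<in> borel_measurable borel" and "0 < D"
    and wv: "\<And>t. 0 < t \<Longrightarrow> w t \<le> v t" "\<And>t. 0 < t \<Longrightarrow> v t \<le> D * w t"
    using sv_equiv_borel[OF assms(2)] by blast
  have vw: "ennreal (v t) \<le> ennreal D * ennreal (w t)" if "0 < t" for t
    using wv(2)[OF that] \<open>0 < D\<close> sv_pos[OF assms(2) that]
    by (simp add: ennreal_mult[symmetric] ennreal_leI)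
  show ?thesis
  proof (rule that[of "qconst q * D"], unfold splits_def, intro ballI allI impI)
    fix S T U :: "real set" and f :: "real \<Rightarrow> ennreal" and x :: real
    assume S: "S \<in> sets borel" "T \<in> sets borel" "U \<in> sets borel"
      "S \<subseteq> {0<..}" "T \<subseteq> {0<..}" "U \<subseteq> {0<..}" "S \<subseteq> T \<union> U \<union> {x}"
      and [measurable]: "f \<in> borel_measurable borel"
    have 1: "hnorm q A (\<lambda>u. ennreal (v u) * f u) \<le> ennreal D * hnorm q A (\<lambda>u. ennreal (w u) * f u)"
      if "A \<subseteq> {0<..}" for A
      using that assms(1) vw by (intro hnorm_le_cmult) (auto simp: mult.assoc[symmetric] intro!: mult_right_mono)
    have "hnorm q S (\<lambda>u. ennreal (w u) * f u) \<le> hnorm q S (\<lambda>u. ennreal (v u) * f u)"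
      using S wv by (intro hnorm_mono) (auto intro!: mult_right_mono ennreal_leI)
    also have "\<dots> \<le> ennreal (qconst q) *
        (hnorm q T (\<lambda>u. ennreal (v u) * f u) + hnorm q U (\<lambda>u. ennreal (v u) * f u))"
      unfolding hnorm_def by (rule Lnorm_Un[OF assms(1) _ S(7,1,2,3)]) measurable
    also have "\<dots> \<le> ennreal (qconst q) * (ennreal D * hnorm q T (\<lambda>u. ennreal (w u) * f u)
        + ennreal D * hnorm q U (\<lambda>u. ennreal (w u) * f u))"
      by (intro mult_left_mono add_mono 1 S) auto
    also have "\<dots> = ennreal (qconst q * D) * (hnorm q T (\<lambda>u. ennreal (w u) * f u) + hnorm q U (\<lambda>u. ennreal (w u) * f u))"
      using \<open>0 < D\<close> qconst_ge_1[of q] by (simp add: ennreal_mult distrib_left mult.assoc)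
    finally show "hnorm q S (\<lambda>u. ennreal (w u) * f u) \<le> \<dots>" .
  qed
qed

section \<open>Sequence norms over the integers and geometric kernels\<close>

definition dnorm :: "ennreal \<Rightarrow> (int \<Rightarrow> ennreal) \<Rightarrow> ennreal" where
  "dnorm r a = (if r = top then SUP i. a i
     else epowr (\<integral>\<^sup>+i. epowr (a i) (enn2real r) \<partial>count_space UNIV) (1 / enn2real r))"

lemma dnorm_mono: "(\<And>i. a i \<le> b i) \<Longrightarrow> dnorm r a \<le> dnorm r b"
  unfolding dnorm_def by (auto intro!: SUP_mono epowr_mono nn_integral_mono)

lemma dnorm_cmult:
  assumes "0 < r"
  shows "dnorm r (\<lambda>i. c * a i) = c * dnorm r a"
proof (cases "r = top")
  case True
  then show ?thesis by (simp add: dnorm_def SUP_mult_left_ennreal)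
next
  case False
  then show ?thesis using recip_finite[OF assms]
    by (simp add: dnorm_def epowr_mult nn_integral_cmult epowr_inverse)
qed

lemma dnorm_le_cmult: "0 < r \<Longrightarrow> (\<And>i. a i \<le> c * b i) \<Longrightarrow> dnorm r a \<le> c * dnorm r b"
  using dnorm_mono[of a "\<lambda>i. c * b i" r] by (simp add: dnorm_cmult)

lemma nn_integral_count_space_swap:
  "(\<integral>\<^sup>+x. \<integral>\<^sup>+y. f x y \<partial>count_space UNIV \<partial>count_space UNIV) =
   (\<integral>\<^sup>+y. \<integral>\<^sup>+x. f x y \<partial>count_space UNIV \<partial>count_space UNIV)"
  using nn_integral_fst_count_space[of "\<lambda>(x, y). f x y"] nn_integral_snd_count_space[of "\<lambda>(x, y). f x y"]
  by simp

text \<open>Double counting: each value \<open>g j\<close> is summed over its own fibre, and the two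
  sums are exchanged.\<close>

lemma nn_integral_count_space_fibres:
  fixes \<phi> :: "'a \<Rightarrow> 'b"
  assumes "\<And>j. finite {i. \<phi> i = j}" "\<And>j. card {i. \<phi> i = j} \<le> N"
  shows "(\<integral>\<^sup>+i. g (\<phi> i) \<partial>count_space UNIV) \<le> of_nat N * (\<integral>\<^sup>+j. g j \<partial>count_space UNIV)"
proof -
  have "g (\<phi> i) = (\<integral>\<^sup>+j. g j * indicator {i. \<phi> i = j} i \<partial>count_space UNIV)" for i
    by (subst nn_integral_count_space'[of "{\<phi> i}"]) auto
  then have "(\<integral>\<^sup>+i. g (\<phi> i) \<partial>count_space UNIV) =
      (\<integral>\<^sup>+i. \<integral>\<^sup>+j. g j * indicator {i. \<phi> i = j} i \<partial>count_space UNIV \<partial>count_space UNIV)"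
    by simp
  also have "\<dots> = (\<integral>\<^sup>+j. \<integral>\<^sup>+i. g j * indicator {i. \<phi> i = j} i \<partial>count_space UNIV \<partial>count_space UNIV)"
    by (rule nn_integral_count_space_swap)
  also have "\<dots> = (\<integral>\<^sup>+j. g j * of_nat (card {i. \<phi> i = j}) \<partial>count_space UNIV)"
    using assms(1) by (intro nn_integral_cong) (simp add: nn_integral_cmult)
  also have "\<dots> \<le> (\<integral>\<^sup>+j. of_nat N * g j \<partial>count_space UNIV)"
    using assms(2) by (intro nn_integral_mono) (subst mult.commute, intro mult_right_mono, simp_all)
  also have "\<dots> = of_nat N * (\<integral>\<^sup>+j. g j \<partial>count_space UNIV)"
    by (rule nn_integral_cmult) simp
  finally show ?thesis .
qed

lemma dnorm_fibres:
  assumes "0 < r" "\<And>j. finite {i. \<phi> i = j}" "\<And>j. card {i. \<phi> i = j} \<le> N" "0 < N"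
  shows "dnorm r (\<lambda>i. a (\<phi> i)) \<le> ennreal (real N powr recip r) * dnorm r a"
proof (cases "r = top")
  case True
  then show ?thesis using assms(4) by (auto simp: dnorm_def intro!: SUP_least SUP_upper)
next
  case False
  define p where "p = enn2real r"
  have p: "0 < p" "recip r = 1 / p" using recip_finite[OF assms(1) False] by (auto simp: p_def)
  have "dnorm r (\<lambda>i. a (\<phi> i)) = epowr (\<integral>\<^sup>+i. epowr (a (\<phi> i)) p \<partial>count_space UNIV) (1 / p)"
    using False by (simp add: dnorm_def p_def)
  also have "\<dots> \<le> epowr (of_nat N * (\<integral>\<^sup>+j. epowr (a j) p \<partial>count_space UNIV)) (1 / p)"
    using p assms by (intro epowr_mono nn_integral_count_space_fibres) auto
  also have "\<dots> = ennreal (real N powr recip r) * dnorm r a"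
    using p False by (simp add: dnorm_def p_def epowr_mult epowr_ennreal ennreal_of_nat_eq_real_of_nat)
  finally show ?thesis .
qed

text \<open>Each distance from \<open>j\<close> is attained by at most two integers, hence twice the
  one-sided geometric series.\<close>

lemma geometric_int_sum:
  assumes "0 \<le> x" "x < 1"
  shows "(\<integral>\<^sup>+i. ennreal (x ^ nat \<bar>i - j\<bar>) \<partial>count_space (UNIV :: int set)) \<le> ennreal (2 / (1 - x))"
proof -
  have sub: "{i. nat \<bar>i - j\<bar> = n} \<subseteq> {j - int n, j + int n}" for n by auto
  then have "card {i. nat \<bar>i - j\<bar> = n} \<le> card {j - int n, j + int n}" for n
    by (intro card_mono) auto
  also have "card {j - int n, j + int n} \<le> 2" for n by (simp add: card_insert_if)
  finally have card: "card {i. nat \<bar>i - j\<bar> = n} \<le> 2" for n .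
  have "finite {i. nat \<bar>i - j\<bar> = n}" for n
    using finite_subset[OF sub[of n]] by simp
  then have "(\<integral>\<^sup>+i. ennreal (x ^ nat \<bar>i - j\<bar>) \<partial>count_space (UNIV :: int set))
      \<le> of_nat 2 * (\<integral>\<^sup>+n. ennreal (x ^ n) \<partial>count_space UNIV)"
    using card by (rule nn_integral_count_space_fibres)
  also have "(\<integral>\<^sup>+n. ennreal (x ^ n) \<partial>count_space UNIV) = ennreal (1 / (1 - x))"
    unfolding nn_integral_count_space_nat
    using assms geometric_sums[of x] by (intro suminf_ennreal_eq) auto
  also have "of_nat 2 * ennreal (1 / (1 - x)) = ennreal (2 / (1 - x))"
    using assms by (simp add: ennreal_mult[symmetric] del: ennreal_numeral flip: ennreal_numeral)
  finally show ?thesis .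
qed

text \<open>The kernel \<open>dil (- d)\<close> at powers of 2, see
  \<open>dil_dyadic\<close>.\<close>

definition expdec :: "real \<Rightarrow> int \<Rightarrow> int \<Rightarrow> ennreal" where
  "expdec d i j = ennreal (2 powr (- (d * real_of_int \<bar>i - j\<bar>)))"

lemma expdec_le_1: "0 \<le> d \<Longrightarrow> expdec d i j \<le> 1"
  using powr_mono[of "- (d * \<bar>real_of_int i - real_of_int j\<bar>)" 0 2] by (simp add: expdec_def ennreal_le_1)

lemma expdec_sum:
  assumes "0 < d" "0 < p"
  obtains K :: real where "0 < K" "\<And>j. (\<integral>\<^sup>+i. epowr (expdec d i j) p \<partial>count_space UNIV) \<le> ennreal K"
proof -
  define x where "x = 2 powr (- (d * p))"
  have x: "0 \<le> x" "x < 1" using assms powr_less_mono[of "- (d * p)" 0 2] by (auto simp: x_def)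
  have "epowr (expdec d i j) p = ennreal (x ^ nat \<bar>i - j\<bar>)" for i j
    by (simp add: expdec_def epowr_ennreal powr_powr x_def powr_power mult_ac)
  then show ?thesis
    using geometric_int_sum[OF x] x by (intro that[of "2 / (1 - x)"]) auto
qed

lemma dnorm_expdec:
  assumes "0 < d" "0 < r"
  obtains K :: real where "0 < K" "\<And>j. dnorm r (\<lambda>i. expdec d i j) \<le> ennreal K"
proof (cases "r = top")
  case True
  then show ?thesis using assms(1)
    by (intro that[of 1]) (auto simp: dnorm_def intro!: SUP_least expdec_le_1)
next
  case False
  define p where "p = enn2real r"
  have p: "0 < p" using recip_finite[OF assms(2) False] by (auto simp: p_def)
  obtain K where K: "0 < K" "\<And>j. (\<integral>\<^sup>+i. epowr (expdec d i j) p \<partial>count_space UNIV) \<le> ennreal K"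
    using expdec_sum[OF assms(1) p] by blast
  show ?thesis
  proof (rule that[of "K powr (1 / p)"])
    fix j
    have "dnorm r (\<lambda>i. expdec d i j) \<le> epowr (ennreal K) (1 / p)"
      using False p K(2) by (auto simp: dnorm_def p_def[symmetric] intro!: epowr_mono)
    then show "dnorm r (\<lambda>i. expdec d i j) \<le> ennreal (K powr (1 / p))"
      using K(1) by (simp add: epowr_ennreal)
  qed (use K in simp)
qed

text \<open>The p-th power of a supremum is at most the sum of the p-th powers. After exchanging the
  sums a geometric series in i remains. Convexity is not involved, so p < 1 is covered too.\<close>

lemma dnorm_supconv:
  assumes "0 < d" "0 < r"
  obtains K :: real where "0 < K"
    "\<And>a. dnorm r (\<lambda>i. SUP j. expdec d i j * a j) \<le> ennreal K * dnorm r a"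
proof (cases "r = top")
  case True
  have "expdec d i j * a j \<le> (SUP j. a j)" for i j a
    using mult_right_mono[OF expdec_le_1[of d i j], of "a j"] assms(1) SUP_upper[of j UNIV a] by simp
  then show ?thesis using True
    by (intro that[of 1]) (auto simp: dnorm_def intro!: SUP_least)
next
  case False
  define p where "p = enn2real r"
  have p: "0 < p" using recip_finite[OF assms(2) False] by (auto simp: p_def)
  obtain K where K: "0 < K" "\<And>j. (\<integral>\<^sup>+i. epowr (expdec d i j) p \<partial>count_space UNIV) \<le> ennreal K"
    using expdec_sum[OF assms(1) p] by blast
  show ?thesis
  proof (rule that[of "K powr (1 / p)"])
    fix a :: "int \<Rightarrow> ennreal"
    let ?E = "\<lambda>i j. epowr (expdec d i j) p * epowr (a j) p"
    have 1: "epowr (SUP j. expdec d i j * a j) p \<le> (\<integral>\<^sup>+j. ?E i j \<partial>count_space UNIV)" for i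
      unfolding epowr_le_iff[OF p]
    proof (rule SUP_least)
      fix j
      have "?E i j = (\<integral>\<^sup>+k. ?E i k * indicator {j} k \<partial>count_space UNIV)"
        by (subst nn_integral_count_space'[of "{j}"]) auto
      also have "\<dots> \<le> (\<integral>\<^sup>+k. ?E i k \<partial>count_space UNIV)"
        by (intro nn_integral_mono) (auto simp: indicator_def)
      finally show "expdec d i j * a j \<le> epowr (\<integral>\<^sup>+k. ?E i k \<partial>count_space UNIV) (1 / p)"
        using p by (simp add: epowr_le_iff[symmetric] epowr_mult)
    qed
    have "(\<integral>\<^sup>+i. epowr (SUP j. expdec d i j * a j) p \<partial>count_space UNIV)
        \<le> (\<integral>\<^sup>+i. \<integral>\<^sup>+j. ?E i j \<partial>count_space UNIV \<partial>count_space UNIV)"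
      by (intro nn_integral_mono 1)
    also have "\<dots> = (\<integral>\<^sup>+j. \<integral>\<^sup>+i. ?E i j \<partial>count_space UNIV \<partial>count_space UNIV)"
      by (rule nn_integral_count_space_swap)
    also have "\<dots> \<le> (\<integral>\<^sup>+j. ennreal K * epowr (a j) p \<partial>count_space UNIV)"
      by (intro nn_integral_mono) (simp add: nn_integral_multc mult_right_mono K(2))
    also have "\<dots> = ennreal K * (\<integral>\<^sup>+j. epowr (a j) p \<partial>count_space UNIV)"
      by (rule nn_integral_cmult) simp
    finally have "dnorm r (\<lambda>i. SUP j. expdec d i j * a j) \<le>
        epowr (ennreal K * (\<integral>\<^sup>+j. epowr (a j) p \<partial>count_space UNIV)) (1 / p)"
      using False p by (auto simp: dnorm_def p_def[symmetric] intro!: epowr_mono)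
    also have "\<dots> = ennreal (K powr (1 / p)) * dnorm r a"
      using False p K(1) by (simp add: dnorm_def p_def[symmetric] epowr_mult epowr_ennreal)
    finally show "dnorm r (\<lambda>i. SUP j. expdec d i j * a j) \<le> ennreal (K powr (1 / p)) * dnorm r a" .
  qed (use K in simp)
qed

section \<open>Dyadic intervals and the passage from functions to sequences\<close>

abbreviation dyadic :: "int \<Rightarrow> real" where
  "dyadic i \<equiv> 2 powr real_of_int i"

abbreviation flr :: "real \<Rightarrow> int" where
  "flr u \<equiv> \<lfloor>log 2 u\<rfloor>"

lemma flr_eq_iff: "0 < u \<Longrightarrow> flr u = i \<longleftrightarrow> dyadic i \<le> u \<and> u < 2 * dyadic i"
  by (subst floor_log_eq_powr_iff) (auto simp: powr_add)

lemma flr_bounds: "0 < u \<Longrightarrow> dyadic (flr u) \<le> u" "0 < u \<Longrightarrow> u < 2 * dyadic (flr u)"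
  using flr_eq_iff[of u "flr u"] by auto

lemma ln_flr: "0 < u \<Longrightarrow> \<bar>ln u - ln (dyadic (flr u))\<bar> \<le> ln 2"
proof -
  assume u: "0 < u"
  have "ln (dyadic (flr u)) \<le> ln u"
    using flr_bounds[OF u] u by (subst ln_le_cancel_iff) auto
  moreover have "ln u \<le> ln (2 * dyadic (flr u))"
    using flr_bounds[OF u] u by (subst ln_le_cancel_iff) auto
  then have "ln u \<le> ln 2 + ln (dyadic (flr u))" by (simp add: ln_mult_pos)
  ultimately show ?thesis by simp
qed

lemma dil_flr: "0 < u \<Longrightarrow> 0 \<le> n \<Longrightarrow> dil n u (dyadic (flr u)) \<le> 2 powr n"
  using mult_left_mono[OF ln_flr, of u n] by (simp add: dil_def powr_def)

text \<open>The dyadic interval with left endpoint 2^i has length 2^i, which cancels the weight; the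
  half line is their disjoint union.\<close>

lemma nn_integral_dyadic_step:
  "(\<integral>\<^sup>+u. ennreal (1 / dyadic (flr u)) * F (flr u) \<partial>lebesgue_on {0<..}) =
   (\<integral>\<^sup>+i. F i \<partial>count_space UNIV)"
proof -
  let ?I = "\<lambda>i. {dyadic i..<2 * dyadic i}"
  let ?F = "\<lambda>i. ennreal (1 / dyadic i) * F i"
  have eq: "?F (flr u) * indicator {0<..} u = (\<integral>\<^sup>+i. ?F i * indicator (?I i) u \<partial>count_space UNIV)" for u
  proof (cases "0 < u")
    case True
    then have "?F i * indicator (?I i) u = ?F i * indicator {flr u} i" for i
      using flr_eq_iff[OF True, of i] by (auto simp: indicator_def)
    then have "(\<integral>\<^sup>+i. ?F i * indicator (?I i) u \<partial>count_space UNIV) = (\<integral>\<^sup>+i. ?F i * indicator {flr u} i \<partial>count_space UNIV)"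
      by simp
    also have "\<dots> = ?F (flr u)"
      by (subst nn_integral_count_space'[of "{flr u}"]) auto
    finally show ?thesis using True by simp
  next
    case False
    have "?F i * indicator (?I i) u = 0" for i
      using False powr_gt_zero[of 2 "real_of_int i"] by (auto simp: indicator_def simp del: powr_gt_zero)
    then show ?thesis using False by simp
  qed
  have "(\<integral>\<^sup>+u. ?F (flr u) \<partial>lebesgue_on {0<..}) = (\<integral>\<^sup>+u. ?F (flr u) * indicator {0<..} u \<partial>lebesgue)"
    by (simp add: nn_integral_restrict_space)
  also have "\<dots> = (\<integral>\<^sup>+u. \<integral>\<^sup>+i. ?F i * indicator (?I i) u \<partial>count_space UNIV \<partial>lebesgue)"
    by (simp only: eq)
  also have "\<dots> = (\<integral>\<^sup>+i. \<integral>\<^sup>+u. ?F i * indicator (?I i) u \<partial>lebesgue \<partial>count_space UNIV)"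
    by (rule nn_integral_count_space_nn_integral)
       (simp, intro borel_measurable_times_ennreal borel_measurable_const borel_measurable_indicator, simp)
  also have "\<dots> = (\<integral>\<^sup>+i. F i \<partial>count_space UNIV)"
  proof (rule nn_integral_cong)
    fix i
    have "(\<integral>\<^sup>+u. ?F i * indicator (?I i) u \<partial>lebesgue) = ?F i * ennreal (dyadic i)"
      by (subst nn_integral_cmult_indicator) simp_all
    also have "\<dots> = (ennreal (1 / dyadic i) * ennreal (dyadic i)) * F i" by (simp add: mult_ac)
    also have "\<dots> = F i" by (simp add: ennreal_mult[symmetric])
    finally show "(\<integral>\<^sup>+u. ?F i * indicator (?I i) u \<partial>lebesgue) = F i" .
  qed
  finally show ?thesis .
qed

lemma Lnorm_dyadic_step:
  assumes "0 < r"
  shows "Lnorm r {0<..} (\<lambda>u. ennreal (dyadic (flr u) powr (- recip r)) * a (flr u)) = dnorm r a"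
proof (cases "r = top")
  case True
  have "Inf {z. AE u in lebesgue_on {0<..}. a (flr u) \<le> z} = (SUP i. a i)"
  proof (rule antisym)
    show "Inf {z. AE u in lebesgue_on {0<..}. a (flr u) \<le> z} \<le> (SUP i. a i)"
      by (intro Inf_lower) (auto intro: SUP_upper)
    show "(SUP i. a i) \<le> Inf {z. AE u in lebesgue_on {0<..}. a (flr u) \<le> z}"
    proof (intro SUP_least Inf_greatest)
      fix i z assume "z \<in> {z. AE u in lebesgue_on {0<..}. a (flr u) \<le> z}"
      then have AE: "AE u in lebesgue. u \<in> {0<..} \<longrightarrow> a (flr u) \<le> z"
        by (simp add: AE_restrict_space_iff)
      show "a i \<le> z"
      proof (rule ccontr)
        assume n: "\<not> a i \<le> z"
        \<comment> \<open>If \<open>a i\<close> exceeded the almost everywhere bound z, a whole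
          dyadic interval would be a null set. Hence the essential supremum of a step function is
          its supremum.\<close>
        have "AE u in lebesgue. u \<notin> {dyadic i..<2 * dyadic i}"
          using AE
        proof eventually_elim
          case (elim u)
          show ?case
          proof
            assume u: "u \<in> {dyadic i..<2 * dyadic i}"
            then have "0 < u" using powr_gt_zero[of 2 "real_of_int i"] by (auto simp del: powr_gt_zero)
            then have "flr u = i" using u flr_eq_iff[of u i] by auto
            then show False using elim n \<open>0 < u\<close> by auto
          qed
        qed
        then have "emeasure lebesgue {dyadic i..<2 * dyadic i} = 0"
          by (subst (asm) AE_iff_null_sets[symmetric]) auto
        then show False by simp
      qed
    qed
  qed
  then show ?thesis by (simp add: True Lnorm_top dnorm_def)
next
  case False
  define p where "p = enn2real r"
  have p: "0 < p" "recip r = 1 / p" using recip_finite[OF assms(1) False] by (auto simp: p_def)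
  have "(dyadic i powr (- recip r)) powr p = 1 / dyadic i" for i
    unfolding powr_powr[of "dyadic i"] using p by (simp add: powr_minus_divide)
  then have "epowr (ennreal (dyadic i powr (- recip r)) * a i) p = ennreal (1 / dyadic i) * epowr (a i) p" for i
    using p(1) by (simp only: epowr_mult epowr_ennreal powr_ge_zero)
  then show ?thesis
    unfolding Lnorm_finite[OF assms False] p_def[symmetric]
    using False nn_integral_dyadic_step[of "\<lambda>i. epowr (a i) p"] by (simp add: dnorm_def p_def)
qed

text \<open>Within an octave a tame function varies by at most C 2^n and the weight u^(-1/r) by at
  most 2^(1/r). The second factor is missing in the first estimate because the weight is largest at
  the left endpoint.\<close>

lemma hnorm_discrete:
  assumes "0 < r" "tame C n G" "0 \<le> C" "0 \<le> n"
  shows "hnorm r {0<..} G \<le> ennreal (C * 2 powr n) * dnorm r (\<lambda>i. G (dyadic i))"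
    and "dnorm r (\<lambda>i. G (dyadic i)) \<le> ennreal (C * 2 powr n * 2 powr recip r) * hnorm r {0<..} G"
proof -
  let ?w = "\<lambda>u. ennreal (dyadic (flr u) powr (- recip r))"
  have G: "G u \<le> ennreal (C * 2 powr n) * G (dyadic (flr u))"
      "G (dyadic (flr u)) \<le> ennreal (C * 2 powr n) * G u" if "0 < u" for u
  proof -
    have "ennreal (C * dil n u (dyadic (flr u))) \<le> ennreal (C * 2 powr n)"
      using dil_flr[OF that assms(4)] assms(3) by (intro ennreal_leI mult_left_mono)
    then show "G u \<le> ennreal (C * 2 powr n) * G (dyadic (flr u))"
      "G (dyadic (flr u)) \<le> ennreal (C * 2 powr n) * G u"
      using tameD[OF assms(2) that, of "dyadic (flr u)"] tameD[OF assms(2) _ that, of "dyadic (flr u)"]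
      by (auto simp: dil_commute[of n "dyadic (flr u)" u] elim!: order_trans intro!: mult_right_mono)
  qed
  have w: "ennreal (u powr (- recip r)) \<le> ?w u"
      "?w u \<le> ennreal (2 powr recip r) * ennreal (u powr (- recip r))" if "0 < u" for u
  proof -
    have "dyadic (flr u) powr recip r \<le> u powr recip r"
      using flr_bounds[OF that] by (intro powr_mono2) auto
    then show "ennreal (u powr (- recip r)) \<le> ?w u"
      using that by (intro ennreal_leI) (simp add: powr_minus le_imp_inverse_le)
    have "u powr recip r \<le> (2 * dyadic (flr u)) powr recip r"
      using flr_bounds[OF that] that by (intro powr_mono2) auto
    then show "?w u \<le> ennreal (2 powr recip r) * ennreal (u powr (- recip r))"
      using that by (simp add: ennreal_mult[symmetric] powr_minus powr_mult field_simps ennreal_leI)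
  qed
  have "hnorm r {0<..} G \<le> Lnorm r {0<..} (\<lambda>u. ennreal (C * 2 powr n) * (?w u * G (dyadic (flr u))))"
    unfolding hnorm_def
  proof (rule Lnorm_mono)
    fix u :: real assume "u \<in> {0<..}"
    then have "ennreal (u powr (- recip r)) * G u \<le> ?w u * (ennreal (C * 2 powr n) * G (dyadic (flr u)))"
      using w G by (intro mult_mono) auto
    then show "ennreal (u powr (- recip r)) * G u \<le> ennreal (C * 2 powr n) * (?w u * G (dyadic (flr u)))"
      by (simp add: mult_ac)
  qed
  also have "\<dots> = ennreal (C * 2 powr n) * dnorm r (\<lambda>i. G (dyadic i))"
    using assms(1) by (simp add: Lnorm_cmult Lnorm_dyadic_step[of r "\<lambda>i. G (dyadic i)"])
  finally show "hnorm r {0<..} G \<le> ennreal (C * 2 powr n) * dnorm r (\<lambda>i. G (dyadic i))" .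
  let ?D = "ennreal (C * 2 powr n * 2 powr recip r)"
  have "dnorm r (\<lambda>i. G (dyadic i)) = Lnorm r {0<..} (\<lambda>u. ?w u * G (dyadic (flr u)))"
    using assms(1) by (simp add: Lnorm_dyadic_step[of r "\<lambda>i. G (dyadic i)"])
  also have "\<dots> \<le> Lnorm r {0<..} (\<lambda>u. ?D * (ennreal (u powr (- recip r)) * G u))"
  proof (rule Lnorm_mono)
    fix u :: real assume "u \<in> {0<..}"
    then have "?w u * G (dyadic (flr u)) \<le>
        (ennreal (2 powr recip r) * ennreal (u powr (- recip r))) * (ennreal (C * 2 powr n) * G u)"
      using w G by (intro mult_mono) auto
    also have "\<dots> = ?D * (ennreal (u powr (- recip r)) * G u)"
      using assms(3) by (simp add: ennreal_mult mult_ac)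
    finally show "?w u * G (dyadic (flr u)) \<le> ?D * (ennreal (u powr (- recip r)) * G u)" .
  qed
  also have "\<dots> = ?D * hnorm r {0<..} G"
    using assms(1) by (simp add: Lnorm_cmult hnorm_def)
  finally show "dnorm r (\<lambda>i. G (dyadic i)) \<le> ?D * hnorm r {0<..} G" .
qed

lemma dil_dyadic: "ennreal (dil (- d) (dyadic j) (dyadic i)) = expdec d i j"
proof -
  have "ln (dyadic j) - ln (dyadic i) = (real_of_int j - real_of_int i) * ln 2"
    by (simp add: algebra_simps)
  then have "\<bar>ln (dyadic j) - ln (dyadic i)\<bar> = \<bar>real_of_int i - real_of_int j\<bar> * ln 2"
    by (simp only: abs_mult) (simp add: abs_minus_commute)
  then show ?thesis
    by (simp add: dil_def expdec_def powr_def)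
qed

lemma tame_dil: "0 \<le> d \<Longrightarrow> tame 1 d (\<lambda>t. ennreal (dil (- d) u t))"
proof -
  assume d: "0 \<le> d"
  have "dil (- d) u s \<le> dil d s t * dil (- d) u t" for s t
    using dil_triangle[OF d, of u t s] by (simp add: dil_uminus dil_commute[of d t s] field_simps)
  then show ?thesis by (simp add: tame_def ennreal_mult[symmetric] ennreal_leI)
qed

lemma dil_flr_le:
  assumes "0 < u" "0 \<le> d"
  shows "dil (- d) u t \<le> 2 powr d * dil (- d) (dyadic (flr u)) t"
proof -
  have "dil d (dyadic (flr u)) t \<le> dil d (dyadic (flr u)) u * dil d u t"
    by (rule dil_triangle[OF assms(2)])
  also have "\<dots> \<le> 2 powr d * dil d u t"
    using dil_flr[OF assms] by (intro mult_right_mono) (auto simp: dil_commute[of d _ u])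
  finally show ?thesis by (simp add: dil_uminus field_simps)
qed

text \<open>The bound is uniform in t: rounding t down to a power of 2 costs 2^d, and the sums of
  the discrete kernel are bounded independently of its centre.\<close>

lemma hnorm_dil_bounded:
  assumes "0 < q" "0 < d"
  obtains K :: real where "0 < K" "\<And>t. 0 < t \<Longrightarrow> hnorm q {0<..} (\<lambda>u. ennreal (dil (- d) u t)) \<le> ennreal K"
proof -
  obtain K where K: "0 < K" "\<And>j. dnorm q (\<lambda>i. expdec d i j) \<le> ennreal K"
    using dnorm_expdec[OF assms(2,1)] by blast
  have t: "tame 1 d (\<lambda>u. ennreal (dil (- d) u t))" for t
    using tame_dil[of d t] assms by (simp add: dil_commute[of "-d" _ t])
  show ?thesis
  proof (rule that[of "2 powr d * (2 powr d * K)"])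
    fix t :: real assume "0 < t"
    have "hnorm q {0<..} (\<lambda>u. ennreal (dil (- d) u t)) \<le> ennreal (1 * 2 powr d) * dnorm q (\<lambda>i. ennreal (dil (- d) (dyadic i) t))"
      using assms by (intro hnorm_discrete(1)[OF assms(1) t]) auto
    also have "dnorm q (\<lambda>i. ennreal (dil (- d) (dyadic i) t)) \<le> ennreal (2 powr d) * dnorm q (\<lambda>i. expdec d i (flr t))"
    proof (rule dnorm_le_cmult[OF assms(1)])
      fix i
      have "dil (- d) (dyadic i) t \<le> 2 powr d * dil (- d) (dyadic (flr t)) (dyadic i)"
        using dil_flr_le[OF \<open>0 < t\<close>, of d "dyadic i"] assms by (simp add: dil_commute[of "- d" t])
      then show "ennreal (dil (- d) (dyadic i) t) \<le> ennreal (2 powr d) * expdec d i (flr t)"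
        by (simp add: dil_dyadic[symmetric] ennreal_mult[symmetric] ennreal_leI)
    qed
    also have "dnorm q (\<lambda>i. expdec d i (flr t)) \<le> ennreal K" by (rule K(2))
    finally show "hnorm q {0<..} (\<lambda>u. ennreal (dil (- d) u t)) \<le> ennreal (2 powr d * (2 powr d * K))"
      using K(1) by (simp add: ennreal_mult mult_left_mono)
  qed (use K in simp)
qed

text \<open>The supremum inherits tameness in t from the kernel alone, so it can be discretised in
  t; tameness of \<open>G\<close> discretises the inner variable u. What remains is
  \<open>dnorm_supconv\<close>.\<close>

lemma hnorm_supconv:
  assumes "0 < r" "0 < d" "0 \<le> C" "0 \<le> n"
  obtains K :: real where "0 < K"
    "\<And>G. tame C n G \<Longrightarrow> hnorm r {0<..} (\<lambda>t. SUP u\<in>{0<..}. ennreal (dil (- d) u t) * G u) \<le> ennreal K * hnorm r {0<..} G"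
proof -
  obtain K where K: "0 < K" "\<And>a. dnorm r (\<lambda>i. SUP j. expdec d i j * a j) \<le> ennreal K * dnorm r a"
    using dnorm_supconv[OF assms(2,1)] by blast
  let ?C = "C * 2 powr n"
  show ?thesis
  \<comment> \<open>The added 1 keeps the constant positive when C = 0.\<close>
  proof (rule that[of "2 powr d * (2 powr d * ?C * (K * (?C * 2 powr recip r))) + 1"])
    fix G assume G: "tame C n G"
    define H where "H t = (SUP u\<in>{0<..}. ennreal (dil (- d) u t) * G u)" for t
    have "tame 1 d H"
      unfolding tame_def H_def
    proof (intro allI impI SUP_least)
      fix s t u :: real assume stu: "0 < s" "0 < t" "u \<in> {0<..}"
      have "ennreal (dil (- d) u s) * G u \<le> (ennreal (1 * dil d s t) * ennreal (dil (- d) u t)) * G u"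
        using tameD[OF tame_dil[of d u]] stu assms by (intro mult_right_mono) auto
      also have "\<dots> \<le> ennreal (1 * dil d s t) * (SUP u\<in>{0<..}. ennreal (dil (- d) u t) * G u)"
        using stu by (subst mult.assoc) (intro mult_left_mono SUP_upper, auto)
      finally show "ennreal (dil (- d) u s) * G u \<le> \<dots>" .
    qed
    then have "hnorm r {0<..} H \<le> ennreal (1 * 2 powr d) * dnorm r (\<lambda>i. H (dyadic i))"
      using assms by (intro hnorm_discrete(1)) auto
    also have "dnorm r (\<lambda>i. H (dyadic i)) \<le> ennreal (2 powr d * ?C) * dnorm r (\<lambda>i. SUP j. expdec d i j * G (dyadic j))"
    proof (rule dnorm_le_cmult[OF assms(1)])
      fix i
      show "H (dyadic i) \<le> ennreal (2 powr d * ?C) * (SUP j. expdec d i j * G (dyadic j))"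
        unfolding H_def
      proof (rule SUP_least)
        fix u :: real assume "u \<in> {0<..}"
        then have u: "0 < u" by simp
        have "G u \<le> ennreal (C * dil n u (dyadic (flr u))) * G (dyadic (flr u))"
          by (rule tameD[OF G]) (use u in auto)
        also have "\<dots> \<le> ennreal ?C * G (dyadic (flr u))"
          using dil_flr[OF u assms(4)] assms(3) by (intro mult_right_mono ennreal_leI mult_left_mono) auto
        finally have 1: "G u \<le> ennreal ?C * G (dyadic (flr u))" .
        have "ennreal (dil (- d) u (dyadic i)) \<le> ennreal (2 powr d) * expdec d i (flr u)"
          using dil_flr_le[OF u, of d "dyadic i"] assms
          by (simp add: dil_dyadic[symmetric] ennreal_mult[symmetric] ennreal_leI)
        then have "ennreal (dil (- d) u (dyadic i)) * G u \<le>
            (ennreal (2 powr d) * expdec d i (flr u)) * (ennreal ?C * G (dyadic (flr u)))"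
          using 1 by (intro mult_mono) auto
        also have "\<dots> = ennreal (2 powr d * ?C) * (expdec d i (flr u) * G (dyadic (flr u)))"
          using assms by (simp add: ennreal_mult mult_ac)
        also have "\<dots> \<le> ennreal (2 powr d * ?C) * (SUP j. expdec d i j * G (dyadic j))"
          by (intro mult_left_mono SUP_upper) auto
        finally show "ennreal (dil (- d) u (dyadic i)) * G u \<le> \<dots>" .
      qed
    qed
    also have "dnorm r (\<lambda>i. SUP j. expdec d i j * G (dyadic j)) \<le> ennreal K * dnorm r (\<lambda>j. G (dyadic j))"
      by (rule K(2))
    also have "dnorm r (\<lambda>j. G (dyadic j)) \<le> ennreal (?C * 2 powr recip r) * hnorm r {0<..} G"
      using assms G by (intro hnorm_discrete(2)) auto
    finally have "hnorm r {0<..} H \<le> ennreal (1 * 2 powr d) * (ennreal (2 powr d * ?C) * (ennreal K *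
        (ennreal (?C * 2 powr recip r) * hnorm r {0<..} G)))"
      by (simp add: mult_left_mono)
    also have "\<dots> = ennreal (2 powr d * (2 powr d * ?C * (K * (?C * 2 powr recip r)))) * hnorm r {0<..} G"
      using assms K(1) by (simp add: ennreal_mult mult_ac)
    also have "\<dots> \<le> ennreal (2 powr d * (2 powr d * ?C * (K * (?C * 2 powr recip r))) + 1) * hnorm r {0<..} G"
      by (intro mult_right_mono ennreal_leI) auto
    finally show "hnorm r {0<..} (\<lambda>t. SUP u\<in>{0<..}. ennreal (dil (- d) u t) * G u) \<le> \<dots>"
      by (simp add: H_def[abs_def])
  qed (use K assms in \<open>auto intro!: add_nonneg_pos\<close>)
qed

section \<open>Substitution along a function comparable to a power\<close>

lemma int_crossing:
  fixes i j :: int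
  assumes "P i" "\<not> P j" "i \<le> j"
  obtains k where "P k" "\<not> P (k + 1)"
proof -
  have "\<exists>k. P k \<and> \<not> P (k + 1)"
  proof (rule ccontr)
    assume n: "\<not> (\<exists>k. P k \<and> \<not> P (k + 1))"
    have "P j" using assms(3,1) n by (induction rule: int_ge_induct) auto
    then show False using assms by simp
  qed
  then show ?thesis using that by blast
qed

text \<open>A nonempty fibre lies in an integer interval of radius \<lfloor>B\<rfloor> about any of
  its elements. The final 1 keeps the bound positive, as \<open>dnorm_fibres\<close>
  demands.\<close>

lemma card_fibres_bounded:
  fixes \<phi> :: "int \<Rightarrow> int"
  assumes "\<And>i k. \<phi> i = \<phi> k \<Longrightarrow> \<bar>real_of_int i - real_of_int k\<bar> \<le> B"
  shows "finite {i. \<phi> i = j}" "card {i. \<phi> i = j} \<le> nat (2 * \<lfloor>B\<rfloor> + 1) + 1"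
proof -
  have "finite {i. \<phi> i = j} \<and> card {i. \<phi> i = j} \<le> nat (2 * \<lfloor>B\<rfloor> + 1) + 1"
  proof (cases "{i. \<phi> i = j} = {}")
    case False
    then obtain k where k: "\<phi> k = j" by blast
    have sub: "{i. \<phi> i = j} \<subseteq> {k - \<lfloor>B\<rfloor>..k + \<lfloor>B\<rfloor>}"
    proof
      fix i assume "i \<in> {i. \<phi> i = j}"
      then have "\<bar>real_of_int i - real_of_int k\<bar> \<le> B" using assms k by auto
      then have "real_of_int \<bar>i - k\<bar> \<le> B" by simp
      then have "\<bar>i - k\<bar> \<le> \<lfloor>B\<rfloor>" by (subst le_floor_iff)
      then show "i \<in> {k - \<lfloor>B\<rfloor>..k + \<lfloor>B\<rfloor>}" by auto
    qed
    then have "finite {i. \<phi> i = j}" by (rule finite_subset) simp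
    moreover have "card {i. \<phi> i = j} \<le> card {k - \<lfloor>B\<rfloor>..k + \<lfloor>B\<rfloor>}"
      using sub by (intro card_mono) auto
    ultimately show ?thesis by simp
  qed simp
  then show "finite {i. \<phi> i = j}" "card {i. \<phi> i = j} \<le> nat (2 * \<lfloor>B\<rfloor> + 1) + 1" by auto
qed

lemma ln_dyadic: "ln (dyadic i) = real_of_int i * ln 2"
  by simp

lemma tame_le:
  assumes "tame C n F" "0 \<le> C" "0 \<le> n" "0 < x" "0 < y" "\<bar>ln x - ln y\<bar> \<le> D"
  shows "F x \<le> ennreal (C * exp (n * D)) * F y"
proof -
  have "F x \<le> ennreal (C * dil n x y) * F y" using assms by (intro tameD)
  also have "\<dots> \<le> ennreal (C * exp (n * D)) * F y"
    using assms by (intro mult_right_mono ennreal_leI mult_left_mono) (auto simp: dil_def intro!: mult_left_mono)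
  finally show ?thesis .
qed

text \<open>Reindexing of the dyadic grid replaces the substitution rule. The map
  \<open>\<phi>'\<close> sends i to the octave containing \<rho>(2^i), and \<open>\<psi>\<close>
  sends m to a grid point whose image is close to 2^m. Both have bounded fibres, since in
  logarithmic variables \<open>\<rho>\<close> neither stretches nor shrinks large distances by more
  than fixed factors.\<close>

lemma hnorm_change_of_variables:
  assumes "0 < r" "0 < \<kappa>" "sv \<phi>" "\<And>t. 0 < t \<Longrightarrow> \<rho> t = t powr \<kappa> * \<phi> t" "0 < C" "0 \<le> n"
  obtains K :: real where "0 < K"
    "\<And>F. tame C n F \<Longrightarrow> hnorm r {0<..} F \<le> ennreal K * hnorm r {0<..} (\<lambda>t. F (\<rho> t))"
    "\<And>F. tame C n F \<Longrightarrow> hnorm r {0<..} (\<lambda>t. F (\<rho> t)) \<le> ennreal K * hnorm r {0<..} F"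
proof -
  have pos: "0 < \<rho> t" if "0 < t" for t using assms(3,4) that by (simp add: sv_pos)
  \<comment> \<open>The slowly varying factor may use up half of the exponent: up to the additive
    error M, the slopes of ln \<rho> against ln t then lie between \<kappa>/2 and 2\<kappa>.\<close>
  have k2: "0 < \<kappa> / 2" using assms by simp
  obtain M where M: "0 \<le> M" "\<And>s t. 0 < s \<Longrightarrow> 0 < t \<Longrightarrow> \<bar>ln (\<phi> s) - ln (\<phi> t)\<bar> \<le> M + \<kappa> / 2 * \<bar>ln s - ln t\<bar>"
    using sv_ln[OF assms(3) k2] by metis
  have ln\<rho>: "\<bar>ln (\<rho> s) - ln (\<rho> t) - \<kappa> * (ln s - ln t)\<bar> \<le> M + \<kappa> / 2 * \<bar>ln s - ln t\<bar>"
    if "0 < s" "0 < t" for s t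
  proof -
    have "ln (\<rho> s) - ln (\<rho> t) - \<kappa> * (ln s - ln t) = ln (\<phi> s) - ln (\<phi> t)"
      using that assms(4) sv_pos[OF assms(3)] by (simp add: ln_mult_pos ln_powr right_diff_distrib)
    then show ?thesis using M(2)[OF that] by simp
  qed
  have up: "\<bar>ln (\<rho> s) - ln (\<rho> t)\<bar> \<le> M + 2 * \<kappa> * \<bar>ln s - ln t\<bar>" if "0 < s" "0 < t" for s t
  proof -
    have "\<bar>\<kappa> * (ln s - ln t)\<bar> = \<kappa> * \<bar>ln s - ln t\<bar>" using assms by (simp add: abs_mult)
    moreover have "0 \<le> \<kappa> * \<bar>ln s - ln t\<bar>" using assms by simp
    ultimately show ?thesis using ln\<rho>[OF that] by linarith
  qed
  have low: "\<kappa> / 2 * (ln s - ln t) - M \<le> ln (\<rho> s) - ln (\<rho> t)" if "0 < t" "t \<le> s" for s t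
  proof -
    have "\<bar>ln s - ln t\<bar> = ln s - ln t" using that by simp
    then have "\<bar>ln (\<rho> s) - ln (\<rho> t) - \<kappa> * (ln s - ln t)\<bar> \<le> M + \<kappa> / 2 * (ln s - ln t)"
      using ln\<rho>[of s t] that by simp
    moreover have "\<kappa> * (ln s - ln t) = 2 * (\<kappa> / 2 * (ln s - ln t))" by simp
    ultimately show ?thesis by linarith
  qed
  \<comment> \<open>This bounds the change of ln \<rho> over one dyadic step.\<close>
  define D where "D = M + 2 * \<kappa> * ln 2"
  have D: "0 \<le> D" using M assms by (simp add: D_def)
  have tame\<rho>: "tame (C * exp (n * M)) (n * (2 * \<kappa>)) (\<lambda>t. F (\<rho> t))" if "tame C n F" for F
    unfolding tame_def
  proof (intro allI impI)
    fix s t :: real assume st: "0 < s" "0 < t"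
    have "F (\<rho> s) \<le> ennreal (C * exp (n * (M + 2 * \<kappa> * \<bar>ln s - ln t\<bar>))) * F (\<rho> t)"
      using assms by (intro tame_le[OF that] pos st up) auto
    then show "F (\<rho> s) \<le> ennreal (C * exp (n * M) * dil (n * (2 * \<kappa>)) s t) * F (\<rho> t)"
      by (simp add: dil_def distrib_left exp_add mult.assoc)
  qed
  define \<phi>' where "\<phi>' i = flr (\<rho> (dyadic i))" for i
  \<comment> \<open>The function \<open>\<rho>\<close> need be neither monotone nor continuous, so a
    preimage of 2^m is replaced by a pair of consecutive grid points between which
    \<open>\<rho>\<close> crosses 2^m.\<close>
  have "\<exists>k. \<rho> (dyadic k) \<le> dyadic m \<and> \<not> \<rho> (dyadic (k + 1)) \<le> dyadic m" for m
  proof -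
    \<comment> \<open>With k \<ge> B the lower slope \<kappa>/2 carries ln \<rho> from its value at
      1 beyond ln 2^m at 2^k, and below it at 2^(-k). The summand 1 gives the strict
      inequality.\<close>
    define B where "B = (\<bar>ln (\<rho> 1)\<bar> + M + \<bar>real_of_int m\<bar> * ln 2 + 1) / (\<kappa> / 2 * ln 2)"
    define k where "k = \<lceil>B\<rceil>"
    have B: "0 \<le> B" using M assms by (simp add: B_def)
    then have "0 \<le> k" by (simp add: k_def)
    have "B \<le> real_of_int k" by (simp add: k_def)
    then have "B * (\<kappa> / 2 * ln 2) \<le> real_of_int k * (\<kappa> / 2 * ln 2)"
      using assms by (intro mult_right_mono) auto
    then have k: "\<bar>ln (\<rho> 1)\<bar> + M + \<bar>real_of_int m\<bar> * ln 2 + 1 \<le> \<kappa> / 2 * (real_of_int k * ln 2)"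
      using assms by (simp add: B_def mult_ac)
    have m: "real_of_int m * ln 2 \<le> \<bar>real_of_int m\<bar> * ln 2" "- real_of_int m * ln 2 \<le> \<bar>real_of_int m\<bar> * ln 2"
      using mult_right_mono[of "real_of_int m" "\<bar>real_of_int m\<bar>" "ln 2"]
        mult_right_mono[of "- real_of_int m" "\<bar>real_of_int m\<bar>" "ln 2"] by simp_all
    have "1 \<le> dyadic k" using \<open>0 \<le> k\<close> by (simp add: ge_one_powr_ge_zero)
    then have "\<kappa> / 2 * (real_of_int k * ln 2) - M \<le> ln (\<rho> (dyadic k)) - ln (\<rho> 1)"
      using low[of 1 "dyadic k"] by simp
    then have "ln (dyadic m) < ln (\<rho> (dyadic k))"
      unfolding ln_dyadic using k m by linarith
    then have 1: "\<not> \<rho> (dyadic k) \<le> dyadic m"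
      using pos[of "dyadic k"] by (simp del: ln_powr)
    have "dyadic (- k) \<le> 1" using \<open>0 \<le> k\<close> powr_mono[of "- real_of_int k" 0 2] by simp
    then have "\<kappa> / 2 * (real_of_int k * ln 2) - M \<le> ln (\<rho> 1) - ln (\<rho> (dyadic (- k)))"
      using low[of "dyadic (- k)" 1] by simp
    then have "ln (\<rho> (dyadic (- k))) \<le> ln (dyadic m)"
      unfolding ln_dyadic using k m by linarith
    then have 2: "\<rho> (dyadic (- k)) \<le> dyadic m"
      using pos[of "dyadic (- k)"] by (simp del: ln_powr)
    show ?thesis
      using int_crossing[of "\<lambda>k. \<rho> (dyadic k) \<le> dyadic m" "- k" k] 1 2 \<open>0 \<le> k\<close> by auto
  qed
  then obtain \<psi> where \<psi>: "\<And>m. \<rho> (dyadic (\<psi> m)) \<le> dyadic m" "\<And>m. dyadic m < \<rho> (dyadic (\<psi> m + 1))"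
    unfolding not_le by metis
  have \<psi>D: "\<bar>ln (dyadic m) - ln (\<rho> (dyadic (\<psi> m)))\<bar> \<le> D" for m
  proof -
    have "ln (\<rho> (dyadic (\<psi> m))) \<le> ln (dyadic m)"
      using \<psi>(1)[of m] pos[of "dyadic (\<psi> m)"] by (subst ln_le_cancel_iff) auto
    moreover have "ln (dyadic m) \<le> ln (\<rho> (dyadic (\<psi> m + 1)))"
      using \<psi>(2)[of m] pos[of "dyadic (\<psi> m + 1)"] by (subst ln_le_cancel_iff) auto
    moreover have "\<bar>ln (\<rho> (dyadic (\<psi> m + 1))) - ln (\<rho> (dyadic (\<psi> m)))\<bar> \<le> D"
      using up[of "dyadic (\<psi> m + 1)" "dyadic (\<psi> m)"] by (simp add: D_def ln_dyadic algebra_simps)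
    ultimately show ?thesis by linarith
  qed
  define E where "E = C * exp (n * D)"
  have E: "0 < E" using assms by (simp add: E_def)
  \<comment> \<open>Points with images in one octave have ln \<rho> values at most 2 ln 2 apart; the
    lower slope bounds the distance of their indices.\<close>
  define B1 where "B1 = (2 * ln 2 + M) / (\<kappa> / 2 * ln 2)"
  have fib1: "\<bar>real_of_int i - real_of_int k\<bar> \<le> B1" if "\<phi>' i = \<phi>' k" for i k
  proof -
    have *: "real_of_int i - real_of_int k \<le> B1" if "\<phi>' i = \<phi>' k" "k \<le> i" for i k
    proof -
      have "\<bar>ln (\<rho> (dyadic i)) - ln (\<rho> (dyadic k))\<bar> \<le> 2 * ln 2"
        using ln_flr[OF pos, of "dyadic i"] ln_flr[OF pos, of "dyadic k"] that(1) unfolding \<phi>'_def by fastforce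
      moreover have "\<kappa> / 2 * (ln (dyadic i) - ln (dyadic k)) - M \<le> ln (\<rho> (dyadic i)) - ln (\<rho> (dyadic k))"
        using that(2) by (intro low) auto
      ultimately have "(real_of_int i - real_of_int k) * (\<kappa> / 2 * ln 2) \<le> 2 * ln 2 + M"
        by (simp add: algebra_simps)
      then show ?thesis using assms by (simp add: B1_def pos_le_divide_eq)
    qed
    then show ?thesis using *[of i k] *[of k i] that by (cases "k \<le> i") auto
  qed
  \<comment> \<open>Indices with the same \<open>\<psi>\<close> have ln 2^i within D of one common
    value.\<close>
  define B2 where "B2 = 2 * D / ln 2"
  have fib2: "\<bar>real_of_int i - real_of_int k\<bar> \<le> B2" if "\<psi> i = \<psi> k" for i k
  proof -
    have "\<bar>ln (dyadic i) - ln (dyadic k)\<bar> \<le> 2 * D" using \<psi>D[of i] \<psi>D[of k] that by simp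
    moreover have "ln (dyadic i) - ln (dyadic k) = (real_of_int i - real_of_int k) * ln 2"
      by (simp add: algebra_simps)
    ultimately have "\<bar>real_of_int i - real_of_int k\<bar> * ln 2 \<le> 2 * D" by (simp only: abs_mult) simp
    then show ?thesis by (simp add: B2_def pos_le_divide_eq)
  qed
  define N1 where "N1 = nat (2 * \<lfloor>B1\<rfloor> + 1) + 1"
  define N2 where "N2 = nat (2 * \<lfloor>B2\<rfloor> + 1) + 1"
  define n' where "n' = n * (2 * \<kappa>)"
  define C' where "C' = C * exp (n * M)"
  have n': "0 \<le> n'" "0 < C'" using assms by (simp_all add: n'_def C'_def)
  define K1 where "K1 = (C * 2 powr n) * (E * ((real N2 powr recip r) * (C' * 2 powr n' * 2 powr recip r)))"
  define K2 where "K2 = (C' * 2 powr n') * ((C * 2 powr n) * ((real N1 powr recip r) * (C * 2 powr n * 2 powr recip r)))"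
  have K: "0 \<le> K1" "0 \<le> K2" using assms E n' by (simp_all add: K1_def K2_def)
  show ?thesis
  proof (rule that[of "K1 + K2 + 1"])
    show "0 < K1 + K2 + 1" using K by simp
  next
    fix F assume F: "tame C n F"
    have "hnorm r {0<..} F \<le> ennreal (C * 2 powr n) * dnorm r (\<lambda>i. F (dyadic i))"
      using assms by (intro hnorm_discrete(1) F) auto
    also have "dnorm r (\<lambda>i. F (dyadic i)) \<le> ennreal E * dnorm r (\<lambda>i. F (\<rho> (dyadic (\<psi> i))))"
      unfolding E_def using assms by (intro dnorm_le_cmult tame_le[OF F] pos \<psi>D) auto
    also have "dnorm r (\<lambda>i. F (\<rho> (dyadic (\<psi> i)))) \<le> ennreal (real N2 powr recip r) * dnorm r (\<lambda>i. F (\<rho> (dyadic i)))"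
      using card_fibres_bounded[of \<psi>, OF fib2] assms(1) unfolding N2_def
      by (intro dnorm_fibres[where a = "\<lambda>i. F (\<rho> (dyadic i))"]) auto
    also have "dnorm r (\<lambda>i. F (\<rho> (dyadic i))) \<le> ennreal (C' * 2 powr n' * 2 powr recip r) * hnorm r {0<..} (\<lambda>t. F (\<rho> t))"
      using n' assms(1) tame\<rho>[OF F] by (intro hnorm_discrete(2)) (auto simp: C'_def n'_def)
    finally have "hnorm r {0<..} F \<le> ennreal (C * 2 powr n) * (ennreal E * (ennreal (real N2 powr recip r) *
       (ennreal (C' * 2 powr n' * 2 powr recip r) * hnorm r {0<..} (\<lambda>t. F (\<rho> t)))))"
      by (simp add: mult_left_mono)
    also have "\<dots> = ennreal K1 * hnorm r {0<..} (\<lambda>t. F (\<rho> t))"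
      using assms E n' by (simp add: K1_def ennreal_mult mult_ac)
    also have "\<dots> \<le> ennreal (K1 + K2 + 1) * hnorm r {0<..} (\<lambda>t. F (\<rho> t))"
      using K by (intro mult_right_mono ennreal_leI) auto
    finally show "hnorm r {0<..} F \<le> \<dots>" .
    have "hnorm r {0<..} (\<lambda>t. F (\<rho> t)) \<le> ennreal (C' * 2 powr n') * dnorm r (\<lambda>i. F (\<rho> (dyadic i)))"
      using n' assms(1) tame\<rho>[OF F] by (intro hnorm_discrete(1)) (auto simp: C'_def n'_def)
    also have "dnorm r (\<lambda>i. F (\<rho> (dyadic i))) \<le> ennreal (C * 2 powr n) * dnorm r (\<lambda>i. F (dyadic (\<phi>' i)))"
    proof (rule dnorm_le_cmult[OF assms(1)])
      fix i
      have "F (\<rho> (dyadic i)) \<le> ennreal (C * exp (n * ln 2)) * F (dyadic (\<phi>' i))"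
        unfolding \<phi>'_def using assms by (intro tame_le[OF F] pos ln_flr) auto
      then show "F (\<rho> (dyadic i)) \<le> ennreal (C * 2 powr n) * F (dyadic (\<phi>' i))"
        by (simp add: powr_def)
    qed
    also have "dnorm r (\<lambda>i. F (dyadic (\<phi>' i))) \<le> ennreal (real N1 powr recip r) * dnorm r (\<lambda>i. F (dyadic i))"
      using card_fibres_bounded[of \<phi>', OF fib1] assms(1) unfolding N1_def
      by (intro dnorm_fibres[where a = "\<lambda>i. F (dyadic i)"]) auto
    also have "dnorm r (\<lambda>i. F (dyadic i)) \<le> ennreal (C * 2 powr n * 2 powr recip r) * hnorm r {0<..} F"
      using assms F by (intro hnorm_discrete(2)) auto
    finally have "hnorm r {0<..} (\<lambda>t. F (\<rho> t)) \<le> ennreal (C' * 2 powr n') * (ennreal (C * 2 powr n) *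
       (ennreal (real N1 powr recip r) * (ennreal (C * 2 powr n * 2 powr recip r) * hnorm r {0<..} F)))"
      by (simp add: mult_left_mono)
    also have "\<dots> = ennreal K2 * hnorm r {0<..} F"
      using assms E n' by (simp add: K2_def ennreal_mult mult_ac)
    also have "\<dots> \<le> ennreal (K1 + K2 + 1) * hnorm r {0<..} F"
      using K by (intro mult_right_mono ennreal_leI) auto
    finally show "hnorm r {0<..} (\<lambda>t. F (\<rho> t)) \<le> \<dots>" .
  qed
qed

section \<open>Heads and tails of slowly varying weights\<close>

lemma up_closed_borel:
  fixes S :: "real set"
  assumes "\<And>x y. x \<in> S \<Longrightarrow> x \<le> y \<Longrightarrow> y \<in> S"
  shows "S \<in> sets borel"
proof -
  have "is_interval S" unfolding is_interval_1 using assms by blast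
  then have "convex S" by (simp add: is_interval_convex_1)
  then show ?thesis
    using is_real_interval[of S] \<open>is_interval S\<close> by fastforce
qed

lemma borel_measurable_mono_ennreal:
  fixes f :: "real \<Rightarrow> ennreal"
  assumes "mono f"
  shows "f \<in> borel_measurable borel"
proof (rule borel_measurableI_greater)
  fix y show "{x \<in> space borel. y < f x} \<in> sets borel"
    using assms by (intro up_closed_borel) (auto simp: mono_def intro: less_le_trans)
qed

lemma borel_measurable_antimono_ennreal:
  fixes f :: "real \<Rightarrow> ennreal"
  assumes "antimono f"
  shows "f \<in> borel_measurable borel"
proof -
  have "mono (\<lambda>x. f (- x))" using assms by (auto simp: monotone_def)
  then have "(\<lambda>x. f (- x)) \<in> borel_measurable borel" by (rule borel_measurable_mono_ennreal)
  then have "(\<lambda>x. f (- (- x))) \<in> borel_measurable borel"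
    by (rule measurable_compose[rotated]) simp
  then show ?thesis by simp
qed

lemma sv_bound_ennreal:
  assumes "sv b" "0 < e"
  obtains C where "C < top"
    "\<And>s t. 0 < s \<Longrightarrow> 0 < t \<Longrightarrow> ennreal (b s) \<le> C * ennreal (dil e s t) * ennreal (b t)"
proof -
  obtain C where C: "0 < C" "\<And>s t. 0 < s \<Longrightarrow> 0 < t \<Longrightarrow> b s \<le> C * dil e s t * b t"
    using sv_bound[OF assms] by blast
  show ?thesis
  proof (rule that[of "ennreal C"])
    fix s t :: real assume "0 < s" "0 < t"
    then show "ennreal (b s) \<le> ennreal C * ennreal (dil e s t) * ennreal (b t)"
      using C sv_pos[OF assms(1)] by (simp add: ennreal_mult[symmetric] ennreal_leI less_imp_le)
  qed simp
qed

text \<open>Half of the decay absorbs the variation of \<open>b\<close> between u and t; the other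
  half makes the norm converge, uniformly in t.\<close>

lemma hnorm_sv_dil:
  assumes "sv b" "0 < q" "0 < d"
  obtains K where "K < top"
    "\<And>t. 0 < t \<Longrightarrow> hnorm q {0<..} (\<lambda>u. ennreal (b u) * ennreal (dil (- d) u t)) \<le> K * ennreal (b t)"
proof -
  have d2: "0 < d / 2" using assms by simp
  obtain C where C: "C < top"
    "\<And>s t. 0 < s \<Longrightarrow> 0 < t \<Longrightarrow> ennreal (b s) \<le> C * ennreal (dil (d / 2) s t) * ennreal (b t)"
    using sv_bound_ennreal[OF assms(1) d2] by blast
  obtain K where K: "0 < K" "\<And>t. 0 < t \<Longrightarrow> hnorm q {0<..} (\<lambda>u. ennreal (dil (- (d / 2)) u t)) \<le> ennreal K"
    using hnorm_dil_bounded[OF assms(2) d2] by blast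
  show ?thesis
  proof (rule that[of "C * ennreal K"])
    show "C * ennreal K < top" using C(1) by (simp add: ennreal_mult_less_top)
    fix t :: real assume t: "0 < t"
    have "hnorm q {0<..} (\<lambda>u. ennreal (b u) * ennreal (dil (- d) u t)) \<le>
       (C * ennreal (b t)) * hnorm q {0<..} (\<lambda>u. ennreal (dil (- (d / 2)) u t))"
    proof (rule hnorm_le_cmult[OF assms(2)])
      show "C * ennreal (b t) < top" using C(1) by (simp add: ennreal_mult_less_top)
      fix u :: real assume "u \<in> {0<..}"
      then have "ennreal (b u) * ennreal (dil (- d) u t) \<le>
          (C * ennreal (dil (d / 2) u t) * ennreal (b t)) * ennreal (dil (- d) u t)"
        using C(2)[of u t] t by (intro mult_right_mono) auto
      also have "\<dots> = C * ennreal (b t) * (ennreal (dil (d / 2) u t) * ennreal (dil (- d) u t))"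
        by (simp add: mult_ac)
      also have "ennreal (dil (d / 2) u t) * ennreal (dil (- d) u t) = ennreal (dil (- (d / 2)) u t)"
        by (simp add: ennreal_mult[symmetric] dil_mult)
      finally show "ennreal (b u) * ennreal (dil (- d) u t) \<le> C * ennreal (b t) * ennreal (dil (- (d / 2)) u t)" .
    qed
    also have "\<dots> \<le> C * ennreal (b t) * ennreal K"
      by (intro mult_left_mono K(2) t) auto
    finally show "hnorm q {0<..} (\<lambda>u. ennreal (b u) * ennreal (dil (- d) u t)) \<le> C * ennreal K * ennreal (b t)"
      by (simp add: mult_ac)
  qed
qed

text \<open>The octave has length a, and on it the weight is at least (2a)^(-1/q); the product of
  the two contributions is 2^(-1/q) for every a.\<close>

lemma hnorm_1_octave:
  assumes "0 < q" "0 < a"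
  shows "1 \<le> ennreal (2 powr recip q) * hnorm q {a<..<2 * a} (\<lambda>u. 1)"
proof -
  have L1: "ennreal (a powr recip q) \<le> Lnorm q {a<..<2 * a} (\<lambda>u. 1)"
  proof (cases "q = top")
    case True
    have "1 \<le> Inf {z :: ennreal. AE x in lebesgue_on {a<..<2 * a}. 1 \<le> z}"
    proof (rule Inf_greatest)
      fix z :: ennreal assume z: "z \<in> {z. AE x in lebesgue_on {a<..<2 * a}. 1 \<le> z}"
      show "1 \<le> z"
      proof (rule ccontr)
        assume n: "\<not> 1 \<le> z"
        from z have "AE x in lebesgue. x \<in> {a<..<2 * a} \<longrightarrow> 1 \<le> z"
          by (simp add: AE_restrict_space_iff)
        then have "AE x in lebesgue. x \<notin> {a<..<2 * a}"
          by eventually_elim (use n in blast)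
        then have "emeasure lebesgue {a<..<2 * a} = 0"
          by (subst (asm) AE_iff_null_sets[symmetric]) auto
        then show False using assms by simp
      qed
    qed
    then show ?thesis using True assms by (simp add: Lnorm_top)
  next
    case False
    define p where "p = enn2real q"
    have p: "0 < p" "recip q = 1 / p" using recip_finite[OF assms(1) False] by (auto simp: p_def)
    have "(\<integral>\<^sup>+ x. epowr 1 p \<partial>lebesgue_on {a<..<2 * a}) = ennreal a"
      using assms epowr_ennreal[of 1 p]
      by (simp add: emeasure_restrict_space space_restrict_space)
    then show ?thesis
      using p assms by (simp add: Lnorm_finite[OF assms(1) False] p_def[symmetric] epowr_ennreal)
  qed
  have "hnorm q {a<..<2 * a} (\<lambda>u. 1) \<ge> Lnorm q {a<..<2 * a} (\<lambda>u. ennreal ((2 * a) powr (- recip q)) * 1)"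
    unfolding hnorm_def
  proof (intro Lnorm_mono mult_right_mono ennreal_leI)
    fix x assume "x \<in> {a<..<2 * a}"
    then show "(2 * a) powr - recip q \<le> x powr - recip q"
      using assms by (intro powr_mono2') auto
  qed simp_all
  then have "ennreal ((2 * a) powr (- recip q)) * Lnorm q {a<..<2 * a} (\<lambda>u. 1) \<le> hnorm q {a<..<2 * a} (\<lambda>u. 1)"
    by (subst (asm) Lnorm_cmult[OF assms(1)]) simp_all
  then have "ennreal ((2 * a) powr (- recip q)) * ennreal (a powr recip q) \<le> hnorm q {a<..<2 * a} (\<lambda>u. 1)"
    by (rule order_trans[rotated]) (intro mult_left_mono L1, simp)
  then have "ennreal (2 powr recip q) * (ennreal ((2 * a) powr (- recip q)) * ennreal (a powr recip q))
      \<le> ennreal (2 powr recip q) * hnorm q {a<..<2 * a} (\<lambda>u. 1)"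
    by (rule mult_left_mono) simp
  moreover have "2 powr recip q * ((2 * a) powr (- recip q) * a powr recip q) = 1"
    using assms by (simp add: powr_mult powr_minus field_simps)
  ultimately show ?thesis
    by (simp add: ennreal_mult[symmetric])
qed

lemma hnorm_tame_lower:
  assumes "0 < q" "0 \<le> C" "0 \<le> n"
  obtains K where "K < top"
    "\<And>G a s. tame C n G \<Longrightarrow> 0 < a \<Longrightarrow> a \<le> s \<Longrightarrow> s \<le> 2 * a \<Longrightarrow> G s \<le> K * hnorm q {a<..<2 * a} G"
proof (rule that[of "ennreal (2 powr recip q) * ennreal (C * 2 powr n)"])
  show "ennreal (2 powr recip q) * ennreal (C * 2 powr n) < top"
    by (simp add: ennreal_mult_less_top)
  fix G and a s :: real assume G: "tame C n G" and a: "0 < a" "a \<le> s" "s \<le> 2 * a"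
  have Gs: "G s \<le> ennreal (C * 2 powr n) * G u" if u: "u \<in> {a<..<2 * a}" for u
  proof -
    have "\<bar>ln s - ln u\<bar> \<le> ln 2"
    proof -
      have "ln s \<le> ln (2 * u)" "ln u \<le> ln (2 * s)"
        using a u by (auto intro!: ln_mono)
      then show ?thesis using a u by (simp add: ln_mult_pos)
    qed
    then have "G s \<le> ennreal (C * exp (n * ln 2)) * G u"
      using a u assms by (intro tame_le[OF G]) auto
    then show ?thesis by (simp add: powr_def)
  qed
  have "G s = G s * 1" by simp
  also have "\<dots> \<le> G s * (ennreal (2 powr recip q) * hnorm q {a<..<2 * a} (\<lambda>u. 1))"
    by (intro mult_left_mono hnorm_1_octave assms a) auto
  also have "\<dots> = ennreal (2 powr recip q) * (G s * hnorm q {a<..<2 * a} (\<lambda>u. 1))"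
    by (simp add: mult_ac)
  also have "\<dots> \<le> ennreal (2 powr recip q) * hnorm q {a<..<2 * a} (\<lambda>u. G s * 1)"
    by (intro mult_left_mono hnorm_cmult_ge assms) auto
  also have "hnorm q {a<..<2 * a} (\<lambda>u. G s * 1) \<le> ennreal (C * 2 powr n) * hnorm q {a<..<2 * a} G"
    using Gs by (intro hnorm_le_cmult assms) auto
  finally show "G s \<le> ennreal (2 powr recip q) * ennreal (C * 2 powr n) * hnorm q {a<..<2 * a} G"
    by (simp add: mult_left_mono mult.assoc)
qed

text \<open>The head contains the octave (t/2, t) and the tail the octave (t, 2t).\<close>

lemma hnorm_tame_lower':
  assumes "0 < q" "0 \<le> C" "0 \<le> n"
  obtains K where "K < top"
    "\<And>G t. tame C n G \<Longrightarrow> 0 < t \<Longrightarrow> G t \<le> K * hnorm q {0<..<t} G"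
    "\<And>G t. tame C n G \<Longrightarrow> 0 < t \<Longrightarrow> G t \<le> K * hnorm q {t<..} G"
proof -
  obtain K where K: "K < top"
    "\<And>G a s. tame C n G \<Longrightarrow> 0 < a \<Longrightarrow> a \<le> s \<Longrightarrow> s \<le> 2 * a \<Longrightarrow> G s \<le> K * hnorm q {a<..<2 * a} G"
    using hnorm_tame_lower[OF assms] by blast
  show ?thesis
  proof (rule that[OF K(1)])
    fix G and t :: real assume G: "tame C n G" and t: "0 < t"
    have "G t \<le> K * hnorm q {t / 2<..<2 * (t / 2)} G" using K(2)[OF G, of "t / 2" t] t by simp
    also have "\<dots> \<le> K * hnorm q {0<..<t} G"
      using t assms by (intro mult_left_mono hnorm_subset) auto
    finally show "G t \<le> K * hnorm q {0<..<t} G" .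
    have "G t \<le> K * hnorm q {t<..<2 * t} G" using K(2)[OF G, of t t] t by simp
    also have "\<dots> \<le> K * hnorm q {t<..} G"
      using t assms by (intro mult_left_mono hnorm_subset) auto
    finally show "G t \<le> K * hnorm q {t<..} G" .
  qed
qed

lemma hnorm_sv_lower:
  assumes "sv b" "0 < q"
  obtains K where "K < top"
    "\<And>t. 0 < t \<Longrightarrow> ennreal (b t) \<le> K * hnorm q {0<..<t} (\<lambda>u. ennreal (b u))"
    "\<And>t. 0 < t \<Longrightarrow> ennreal (b t) \<le> K * hnorm q {t<..} (\<lambda>u. ennreal (b u))"
proof -
  obtain C where C: "0 < C" "tame C 1 (\<lambda>t. ennreal (b t))" using sv_tame[OF assms(1)] by blast
  then show ?thesis
    using hnorm_tame_lower'[of q C 1] assms(2) that by (metis less_imp_le zero_le_one)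
qed

text \<open>Finiteness at one point spreads to all points through the bound itself. This is how
  hypotheses about the intervals (1, \<infinity>) and (0, 1) yield finite heads and tails
  everywhere.\<close>

lemma sv_enn2real:
  assumes bound: "\<And>e. 0 < e \<Longrightarrow> \<exists>C<top. \<forall>s>0. \<forall>t>0. T s \<le> C * ennreal (dil e s t) * T t"
    and "0 < t0" "T t0 < top" and nz: "\<And>t. 0 < t \<Longrightarrow> T t \<noteq> 0"
  shows "sv (\<lambda>t. enn2real (T t))" and "\<And>t. 0 < t \<Longrightarrow> ennreal (enn2real (T t)) = T t"
proof -
  have fin: "T t < top" if "0 < t" for t
  proof -
    obtain C where "C < top" and C: "\<forall>s>0. \<forall>t>0. T s \<le> C * ennreal (dil 1 s t) * T t"
      using bound[OF zero_less_one] by (elim exE conjE)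
    have "T t \<le> C * ennreal (dil 1 t t0) * T t0" using C that assms(2) by simp
    also have "\<dots> < top" using assms(3) \<open>C < top\<close> by (simp add: ennreal_mult_less_top)
    finally show ?thesis .
  qed
  then show eq: "ennreal (enn2real (T t)) = T t" if "0 < t" for t
    using that by simp
  have pos: "0 < enn2real (T t)" if "0 < t" for t
    using fin[OF that] nz[OF that] by (simp add: enn2real_positive_iff zero_less_iff_neq_zero)
  show "sv (\<lambda>t. enn2real (T t))"
    unfolding sv_def
  proof (intro conjI allI impI pos)
    fix e :: real assume "0 < e"
    then obtain C where "C < top" and "\<forall>s>0. \<forall>t>0. T s \<le> C * ennreal (dil e s t) * T t"
      using bound[OF \<open>0 < e\<close>] by (elim exE conjE)
    then have C: "C < top" "\<And>s t. 0 < s \<Longrightarrow> 0 < t \<Longrightarrow> T s \<le> C * ennreal (dil e s t) * T t"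
      by simp_all
    \<comment> \<open>Adding 1 makes the constant positive, as its logarithm is taken.\<close>
    define c where "c = enn2real C + 1"
    have c: "0 < c" "C \<le> ennreal c"
      using C(1) by (auto simp: c_def add_nonneg_pos ennreal_plus)
    have "ln (enn2real (T s)) - ln (enn2real (T t)) \<le> ln c + e * \<bar>ln s - ln t\<bar>" if "0 < s" "0 < t" for s t
    proof -
      have "ennreal (enn2real (T s)) \<le> ennreal c * ennreal (dil e s t) * ennreal (enn2real (T t))"
        using C(2)[OF that] c(2) eq that
        by (auto elim!: order_trans intro!: mult_right_mono)
      then have "enn2real (T s) \<le> c * dil e s t * enn2real (T t)"
        using c by (simp add: ennreal_mult[symmetric])
      then have "ln (enn2real (T s)) \<le> ln (c * dil e s t * enn2real (T t))"
        using pos that by (intro ln_mono) auto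
      also have "\<dots> = ln c + e * \<bar>ln s - ln t\<bar> + ln (enn2real (T t))"
        using pos[OF that(2)] c by (simp add: ln_mult_pos dil_def)
      finally show ?thesis by simp
    qed
    then show "\<exists>L. \<forall>s>0. \<forall>t>0. ln (enn2real (T s)) - ln (enn2real (T t)) \<le> L + e * \<bar>ln s - ln t\<bar>"
      by blast
  qed
qed

lemma dil_between: "0 < s \<Longrightarrow> s \<le> u \<Longrightarrow> u \<le> t \<Longrightarrow> 0 \<le> e \<Longrightarrow> dil e u t \<le> dil e s t"
  "0 < s \<Longrightarrow> s \<le> u \<Longrightarrow> u \<le> t \<Longrightarrow> 0 \<le> e \<Longrightarrow> dil e u s \<le> dil e s t"
  by (auto simp: dil_def intro!: mult_left_mono)

lemma one_le_dil_between:
  assumes "dil e u t \<le> dil e s t'"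
  shows "1 \<le> ennreal (dil e s t') * ennreal (dil (- e) u t)"
proof -
  have "1 \<le> dil e s t' * dil (- e) u t" using assms by (simp add: dil_uminus field_simps)
  then show ?thesis by (simp add: ennreal_mult[symmetric])
qed

lemma ennreal_dil_ge_1: "0 \<le> e \<Longrightarrow> 1 \<le> ennreal (dil e s t)"
  using dil_ge_1 by simp

text \<open>On (s, t) the product of dil e s t with the decaying kernel about either endpoint is at
  least 1. Inserting it reduces the norm to \<open>hnorm_sv_dil\<close>.\<close>

lemma hnorm_between_le:
  assumes "sv b" "0 < q" "0 < e"
  obtains K where "K < top"
    "\<And>s t. 0 < s \<Longrightarrow> s \<le> t \<Longrightarrow> hnorm q {s<..<t} (\<lambda>u. ennreal (b u)) \<le> K * ennreal (dil e s t) * ennreal (b t)"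
    "\<And>s t. 0 < s \<Longrightarrow> s \<le> t \<Longrightarrow> hnorm q {s<..<t} (\<lambda>u. ennreal (b u)) \<le> K * ennreal (dil e s t) * ennreal (b s)"
proof -
  obtain K where K: "K < top"
    "\<And>t. 0 < t \<Longrightarrow> hnorm q {0<..} (\<lambda>u. ennreal (b u) * ennreal (dil (- e) u t)) \<le> K * ennreal (b t)"
    using hnorm_sv_dil[OF assms] by blast
  have *: "hnorm q {s<..<t} (\<lambda>u. ennreal (b u)) \<le> K * ennreal (dil e s t) * ennreal (b v)"
    if "0 < s" "s \<le> t" "0 < v" "\<And>u. s \<le> u \<Longrightarrow> u \<le> t \<Longrightarrow> dil e u v \<le> dil e s t" for s t v
  proof -
    have "hnorm q {s<..<t} (\<lambda>u. ennreal (b u)) \<le>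
        ennreal (dil e s t) * hnorm q {s<..<t} (\<lambda>u. ennreal (b u) * ennreal (dil (- e) u v))"
    proof (rule hnorm_le_cmult[OF assms(2)])
      fix u assume "u \<in> {s<..<t}"
      then have "1 \<le> ennreal (dil e s t) * ennreal (dil (- e) u v)"
        using that by (intro one_le_dil_between) auto
      then have "ennreal (b u) * 1 \<le> ennreal (b u) * (ennreal (dil e s t) * ennreal (dil (- e) u v))"
        by (rule mult_left_mono) simp
      then show "ennreal (b u) \<le> ennreal (dil e s t) * (ennreal (b u) * ennreal (dil (- e) u v))"
        by (simp add: mult_ac)
    qed simp
    also have "\<dots> \<le> ennreal (dil e s t) * hnorm q {0<..} (\<lambda>u. ennreal (b u) * ennreal (dil (- e) u v))"
      using that assms by (intro mult_left_mono hnorm_subset) auto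
    also have "\<dots> \<le> ennreal (dil e s t) * (K * ennreal (b v))"
      using that by (intro mult_left_mono K(2)) auto
    finally show ?thesis by (simp add: mult_ac)
  qed
  show ?thesis
    by (rule that[OF K(1)]; rule *) (use assms in \<open>auto intro: dil_between\<close>)
qed

lemma sv_tail_bound:
  assumes "sv b" "0 < q" "0 < e"
  shows "\<exists>C<top. \<forall>s>0. \<forall>t>0. hnorm q {s<..} (\<lambda>u. ennreal (b u)) \<le>
    C * ennreal (dil e s t) * hnorm q {t<..} (\<lambda>u. ennreal (b u))"
proof -
  let ?T = "\<lambda>t. hnorm q {t<..} (\<lambda>u. ennreal (b u))"
  obtain K where K: "K < top"
    "\<And>s t. 0 < s \<Longrightarrow> s \<le> t \<Longrightarrow> hnorm q {s<..<t} (\<lambda>u. ennreal (b u)) \<le> K * ennreal (dil e s t) * ennreal (b t)"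
    using hnorm_between_le[OF assms] by metis
  obtain L where L: "L < top" "\<And>t. 0 < t \<Longrightarrow> ennreal (b t) \<le> L * ?T t"
    using hnorm_sv_lower[OF assms(1,2)] by metis
  obtain D where D: "splits q b D" using hnorm_Un_sv[OF assms(2,1)] by blast
  have 1: "?T s \<le> ennreal D * (K * L + 1) * ennreal (dil e s t) * ?T t" if "0 < s" "s \<le> t" for s t
  proof -
    have "{s<..} \<subseteq> {s<..<t} \<union> {t<..} \<union> {t}" "{s<..} \<subseteq> {0<..}" "{t<..} \<subseteq> {0<..}" "{s<..<t} \<subseteq> {0<..}"
      using that by auto
    then have "?T s \<le> ennreal D * (hnorm q {s<..<t} (\<lambda>u. ennreal (b u)) + ?T t)"
      using splitsD[OF D, of "{s<..}" "{s<..<t}" "{t<..}" t "\<lambda>u. 1"] by simp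
    also have "\<dots> \<le> ennreal D * (K * ennreal (dil e s t) * (L * ?T t) + ennreal (dil e s t) * ?T t)"
    proof (intro mult_left_mono add_mono)
      show "hnorm q {s<..<t} (\<lambda>u. ennreal (b u)) \<le> K * ennreal (dil e s t) * (L * ?T t)"
        using K(2)[OF that] L(2)[of t] that by (auto elim!: order_trans intro!: mult_left_mono)
      show "?T t \<le> ennreal (dil e s t) * ?T t"
        using mult_right_mono[OF ennreal_dil_ge_1[of e s t], of "?T t"] assms by simp
    qed auto
    also have "\<dots> = ennreal D * (K * L + 1) * ennreal (dil e s t) * ?T t"
      by (simp add: algebra_simps)
    finally show ?thesis .
  qed
  have 2: "?T s \<le> ennreal (dil e s t) * ?T t" if "0 < t" "t \<le> s" for s t
  proof -
    have "?T s \<le> 1 * ?T t" using that assms by (simp, intro hnorm_subset) auto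
    also have "\<dots> \<le> ennreal (dil e s t) * ?T t"
      using assms by (intro mult_right_mono ennreal_dil_ge_1) auto
    finally show ?thesis .
  qed
  show ?thesis
  proof (intro exI[of _ "ennreal D * (K * L + 1) + 1"] conjI allI impI)
    show "ennreal D * (K * L + 1) + 1 < top"
      using K(1) L(1) by (simp add: ennreal_mult_less_top)
    fix s t :: real assume st: "0 < s" "0 < t"
    have "?T s \<le> ennreal D * (K * L + 1) * ennreal (dil e s t) * ?T t + 1 * ennreal (dil e s t) * ?T t"
    proof (cases "s \<le> t")
      case True
      then show ?thesis using 1[OF st(1) True] by (intro add_increasing2) auto
    next
      case False
      then show ?thesis using 2[OF st(2), of s] by (intro add_increasing) auto
    qed
    then show "?T s \<le> (ennreal D * (K * L + 1) + 1) * ennreal (dil e s t) * ?T t"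
      by (simp add: distrib_right)
  qed
qed

text \<open>The mirror image of \<open>sv_tail_bound\<close>: the piece between t and s is compared
  with b at its left endpoint t, which the head up to t dominates.\<close>

lemma sv_head_bound:
  assumes "sv b" "0 < q" "0 < e"
  shows "\<exists>C<top. \<forall>s>0. \<forall>t>0. hnorm q {0<..<s} (\<lambda>u. ennreal (b u)) \<le>
    C * ennreal (dil e s t) * hnorm q {0<..<t} (\<lambda>u. ennreal (b u))"
proof -
  let ?T = "\<lambda>t. hnorm q {0<..<t} (\<lambda>u. ennreal (b u))"
  obtain K where K: "K < top"
    "\<And>s t. 0 < s \<Longrightarrow> s \<le> t \<Longrightarrow> hnorm q {s<..<t} (\<lambda>u. ennreal (b u)) \<le> K * ennreal (dil e s t) * ennreal (b s)"
    using hnorm_between_le[OF assms] by metis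
  obtain L where L: "L < top" "\<And>t. 0 < t \<Longrightarrow> ennreal (b t) \<le> L * ?T t"
    using hnorm_sv_lower[OF assms(1,2)] by metis
  obtain D where D: "splits q b D" using hnorm_Un_sv[OF assms(2,1)] by blast
  have 1: "?T s \<le> ennreal D * (1 + K * L) * ennreal (dil e s t) * ?T t" if "0 < t" "t \<le> s" for s t
  proof -
    have "{0<..<s} \<subseteq> {0<..<t} \<union> {t<..<s} \<union> {t}" "{0<..<s} \<subseteq> {0<..}" "{0<..<t} \<subseteq> {0<..}" "{t<..<s} \<subseteq> {0<..}"
      using that by auto
    then have "?T s \<le> ennreal D * (?T t + hnorm q {t<..<s} (\<lambda>u. ennreal (b u)))"
      using splitsD[OF D, of "{0<..<s}" "{0<..<t}" "{t<..<s}" t "\<lambda>u. 1"] by simp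
    also have "\<dots> \<le> ennreal D * (ennreal (dil e s t) * ?T t + K * ennreal (dil e s t) * (L * ?T t))"
    proof (intro mult_left_mono add_mono)
      show "hnorm q {t<..<s} (\<lambda>u. ennreal (b u)) \<le> K * ennreal (dil e s t) * (L * ?T t)"
        using K(2)[OF that] L(2)[of t] that
        by (auto simp: dil_commute[of e s t] elim!: order_trans intro!: mult_left_mono)
      show "?T t \<le> ennreal (dil e s t) * ?T t"
        using mult_right_mono[OF ennreal_dil_ge_1[of e s t], of "?T t"] assms by simp
    qed auto
    also have "\<dots> = ennreal D * (1 + K * L) * ennreal (dil e s t) * ?T t"
      by (simp add: algebra_simps)
    finally show ?thesis .
  qed
  have 2: "?T s \<le> ennreal (dil e s t) * ?T t" if "0 < s" "s \<le> t" for s t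
  proof -
    have "?T s \<le> 1 * ?T t" using that assms by (simp, intro hnorm_subset) auto
    also have "\<dots> \<le> ennreal (dil e s t) * ?T t"
      using assms by (intro mult_right_mono ennreal_dil_ge_1) auto
    finally show ?thesis .
  qed
  show ?thesis
  proof (intro exI[of _ "ennreal D * (1 + K * L) + 1"] conjI allI impI)
    show "ennreal D * (1 + K * L) + 1 < top"
      using K(1) L(1) by (simp add: ennreal_mult_less_top)
    fix s t :: real assume st: "0 < s" "0 < t"
    have "?T s \<le> ennreal D * (1 + K * L) * ennreal (dil e s t) * ?T t + 1 * ennreal (dil e s t) * ?T t"
    proof (cases "t \<le> s")
      case True
      then show ?thesis using 1[OF st(2) True] by (intro add_increasing2) auto
    next
      case False
      then show ?thesis using 2[OF st(1), of t] by (intro add_increasing) auto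
    qed
    then show "?T s \<le> (ennreal D * (1 + K * L) + 1) * ennreal (dil e s t) * ?T t"
      by (simp add: distrib_right)
  qed
qed

section \<open>The three terms of Holmstedt's formula\<close>

text \<open>The properties of the K-functional, as a function of its parameter, on which the
  estimates rest: k increases and k(t)/t decreases. Infinite values are allowed.\<close>

definition quasiconcave :: "(real \<Rightarrow> ennreal) \<Rightarrow> bool" where
  "quasiconcave k \<longleftrightarrow> mono k \<and> (\<forall>s t. 0 < s \<longrightarrow> s \<le> t \<longrightarrow> k t \<le> ennreal (t / s) * k s)"

lemma quasiconcave_mono: "quasiconcave k \<Longrightarrow> s \<le> t \<Longrightarrow> k s \<le> k t"
  by (simp add: quasiconcave_def mono_def)

lemma quasiconcave_measurable: "quasiconcave k \<Longrightarrow> k \<in> borel_measurable borel"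
  by (simp add: quasiconcave_def borel_measurable_mono_ennreal)

lemma quasiconcave_tame: "quasiconcave k \<Longrightarrow> tame 1 1 k"
  unfolding tame_def
proof (intro allI impI)
  fix s t :: real assume k: "quasiconcave k" and st: "0 < s" "0 < t"
  show "k s \<le> ennreal (1 * dil 1 s t) * k t"
  proof (cases "s \<le> t")
    case True
    have "k s \<le> 1 * k t" using quasiconcave_mono[OF k True] by simp
    also have "\<dots> \<le> ennreal (1 * dil 1 s t) * k t"
      using dil_ge_1[of 1 s t] by (intro mult_right_mono) auto
    finally show ?thesis .
  next
    case False
    then show ?thesis using k st dil_le[of t s 1] by (simp add: quasiconcave_def dil_commute[of 1 s t])
  qed
qed

lemma quasiconcave_quotient:
  assumes "quasiconcave k" "0 < s" "s \<le> t"
  shows "ennreal (t powr -1) * k t \<le> ennreal (s powr -1) * k s"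
proof -
  have "ennreal (t powr -1) * k t \<le> ennreal (t powr -1) * (ennreal (t / s) * k s)"
    using assms by (intro mult_left_mono) (auto simp: quasiconcave_def)
  also have "\<dots> = ennreal (t powr -1 * (t / s)) * k s"
    using assms by (subst ennreal_mult) (simp_all add: mult.assoc)
  also have "t powr -1 * (t / s) = s powr -1"
    using assms by (simp add: powr_minus_divide)
  finally show ?thesis .
qed

lemma sv_powr_quasiconcave_tame:
  assumes "sv a"
  obtains C n where "0 < (C :: real)" "0 \<le> n"
    "\<And>k. quasiconcave k \<Longrightarrow> tame C n (\<lambda>u. ennreal (a u) * (ennreal (u powr (- \<theta>)) * k u))"
proof -
  obtain C where C: "0 < C" "tame C 1 (\<lambda>t. ennreal (a t))" using sv_tame[OF assms] by blast
  have "tame (C * (1 * 1)) (1 + (\<bar>- \<theta>\<bar> + 1)) (\<lambda>u. ennreal (a u) * (ennreal (u powr (- \<theta>)) * k u))" if "quasiconcave k" for k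
    using C by (intro tame_mult tame_powr quasiconcave_tame that) auto
  then show ?thesis using C(1) by (intro that[of "C * (1 * 1)" "1 + (\<bar>- \<theta>\<bar> + 1)"]) auto
qed

text \<open>Half of the exponent is given up to absorb \<open>v\<close>. What remains is genuine
  monotonicity with a power gain, and not only monotonicity up to a constant.\<close>

lemma powr_sv_decay:
  assumes "sv v" "0 < \<alpha>"
  obtains C where "0 < (C :: real)"
    "\<And>s t. 0 < s \<Longrightarrow> s \<le> t \<Longrightarrow> s powr \<alpha> * v s \<le> C * dil (- (\<alpha> / 2)) s t * (t powr \<alpha> * v t)"
    "\<And>s t. 0 < s \<Longrightarrow> s \<le> t \<Longrightarrow> t powr (- \<alpha>) * v t \<le> C * dil (- (\<alpha> / 2)) s t * (s powr (- \<alpha>) * v s)"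
proof -
  obtain C where C: "0 < C" "\<And>s t. 0 < s \<Longrightarrow> 0 < t \<Longrightarrow> v s \<le> C * dil (\<alpha> / 2) s t * v t"
    using sv_bound[of v "\<alpha> / 2"] assms by auto
  have *: "s powr \<alpha> = dil (- \<alpha>) s t * t powr \<alpha>" "t powr (- \<alpha>) = dil (- \<alpha>) s t * s powr (- \<alpha>)"
    if "0 < s" "s \<le> t" for s t
  proof -
    have "\<bar>ln s - ln t\<bar> = ln t - ln s" using that by simp
    then show "s powr \<alpha> = dil (- \<alpha>) s t * t powr \<alpha>" "t powr (- \<alpha>) = dil (- \<alpha>) s t * s powr (- \<alpha>)"
      using that by (simp_all add: dil_def powr_def exp_add[symmetric] algebra_simps)
  qed
  have dil: "dil (- \<alpha>) s t * dil (\<alpha> / 2) s t = dil (- (\<alpha> / 2)) s t" for s t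
    by (simp add: dil_mult)
  show ?thesis
  proof (rule that[OF C(1)])
    fix s t :: real assume st: "0 < s" "s \<le> t"
    have "s powr \<alpha> * v s \<le> (dil (- \<alpha>) s t * t powr \<alpha>) * (C * dil (\<alpha> / 2) s t * v t)"
      unfolding *(1)[OF st, symmetric] using C(2)[of s t] st by (intro mult_left_mono) auto
    also have "\<dots> = C * (dil (- \<alpha>) s t * dil (\<alpha> / 2) s t) * (t powr \<alpha> * v t)" by (simp add: mult_ac)
    finally show "s powr \<alpha> * v s \<le> C * dil (- (\<alpha> / 2)) s t * (t powr \<alpha> * v t)" by (simp only: dil)
    have "t powr (- \<alpha>) * v t \<le> (dil (- \<alpha>) s t * s powr (- \<alpha>)) * (C * dil (\<alpha> / 2) s t * v s)"
      unfolding *(2)[OF st, symmetric] using C(2)[of t s] st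
      by (intro mult_left_mono) (auto simp: dil_commute[of _ t s])
    also have "\<dots> = C * (dil (- \<alpha>) s t * dil (\<alpha> / 2) s t) * (s powr (- \<alpha>) * v s)" by (simp add: mult_ac)
    finally show "t powr (- \<alpha>) * v t \<le> C * dil (- (\<alpha> / 2)) s t * (s powr (- \<alpha>) * v s)" by (simp only: dil)
  qed
qed

lemma nonzero_factor: "0 < b \<Longrightarrow> ennreal b \<le> L * T \<Longrightarrow> T \<noteq> 0"
  by auto

section \<open>The weights, the functions built from them, and their slow variation\<close>

locale weights =
  fixes \<theta>0 :: real and q0 q1 r0 r1 :: ennreal and a0 a1 b0 b1 :: "real \<Rightarrow> real"
  assumes \<theta>0: "0 < \<theta>0" "\<theta>0 < 1"
    and q0: "0 < q0" and q1: "0 < q1" and r0: "0 < r0" and r1: "0 < r1"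
    and a0: "sv a0" and a1: "sv a1" and b0: "sv b0" and b1: "sv b1"
    and tail0_finite: "hnorm r0 {1<..} (\<lambda>s. ennreal (b0 s)) < top"
    and tail1_finite: "hnorm r1 {1<..} (\<lambda>s. ennreal (b1 s)) < top"
    and head1_finite: "hnorm r1 {0<..<1} (\<lambda>s. ennreal (b1 s) *
      hnorm q1 {0<..<s} (\<lambda>u. ennreal (a1 u))) < top"
begin

definition P :: "(real \<Rightarrow> ennreal) \<Rightarrow> real \<Rightarrow> ennreal" where
  "P k s = hnorm q0 {0<..<s} (\<lambda>u. ennreal (a0 u) * (ennreal (u powr (- \<theta>0)) * k u))"

definition Q :: "(real \<Rightarrow> ennreal) \<Rightarrow> real \<Rightarrow> real \<Rightarrow> ennreal" where
  "Q k t s = hnorm q1 {t<..<s} (\<lambda>u. ennreal (a1 u) * (ennreal (u powr -1) * k u))"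

definition T0 :: "real \<Rightarrow> ennreal" where "T0 t = hnorm r0 {t<..} (\<lambda>s. ennreal (b0 s))"
definition T1 :: "real \<Rightarrow> ennreal" where "T1 t = hnorm r1 {t<..} (\<lambda>s. ennreal (b1 s))"
definition H1 :: "real \<Rightarrow> ennreal" where "H1 t = hnorm q1 {0<..<t} (\<lambda>u. ennreal (a1 u))"
definition \<Phi> :: "real \<Rightarrow> ennreal" where "\<Phi> t = hnorm r1 {0<..<t} (\<lambda>s. ennreal (b1 s) * H1 s)"

text \<open>\<open>X\<close> is \<open>\<chi>\<^sub>1\<close> before it is known to be finite.\<close>

definition X :: "real \<Rightarrow> ennreal" where "X t = \<Phi> t + T1 t * H1 t"

definition I :: "(real \<Rightarrow> ennreal) \<Rightarrow> real \<Rightarrow> ennreal" where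
  "I k t = hnorm r0 {0<..<t} (\<lambda>s. ennreal (b0 s) * P k s)"
definition II :: "(real \<Rightarrow> ennreal) \<Rightarrow> real \<Rightarrow> ennreal" where
  "II k t = T0 t * P k t"
definition III :: "(real \<Rightarrow> ennreal) \<Rightarrow> real \<Rightarrow> ennreal" where
  "III k t = hnorm r1 {t<..} (\<lambda>s. ennreal (b1 s) * Q k t s)"

definition N0 :: "(real \<Rightarrow> ennreal) \<Rightarrow> ennreal" where
  "N0 k = hnorm r0 {0<..} (\<lambda>s. ennreal (b0 s) * P k s)"
definition N1 :: "(real \<Rightarrow> ennreal) \<Rightarrow> ennreal" where
  "N1 k = hnorm r1 {0<..} (\<lambda>s. ennreal (b1 s) * Q k 0 s)"

definition \<chi>0 :: "real \<Rightarrow> real" where "\<chi>0 t = a0 t * enn2real (T0 t)"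
definition \<chi>1 :: "real \<Rightarrow> real" where "\<chi>1 t = enn2real (X t)"
definition \<phi> :: "real \<Rightarrow> real" where "\<phi> t = \<chi>0 t / \<chi>1 t"
definition \<rho> :: "real \<Rightarrow> real" where "\<rho> t = t powr (1 - \<theta>0) * \<phi> t"

lemma T0_antimono: "s \<le> t \<Longrightarrow> T0 t \<le> T0 s"
  unfolding T0_def by (intro hnorm_subset r0) auto

lemma H1_mono: "s \<le> t \<Longrightarrow> H1 s \<le> H1 t"
  unfolding H1_def by (intro hnorm_subset q1) auto

lemma P_mono: "s \<le> t \<Longrightarrow> P k s \<le> P k t"
  unfolding P_def by (intro hnorm_subset q0) auto

lemma Q_mono: "t' \<le> t \<Longrightarrow> s \<le> s' \<Longrightarrow> Q k t s \<le> Q k t' s'"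
  unfolding Q_def by (intro hnorm_subset q1) auto

lemma H1_measurable: "H1 \<in> borel_measurable borel"
  by (intro borel_measurable_mono_ennreal monoI H1_mono)

lemma P_measurable: "P k \<in> borel_measurable borel"
  by (intro borel_measurable_mono_ennreal monoI P_mono)

lemma Q_measurable: "Q k t \<in> borel_measurable borel"
  by (intro borel_measurable_mono_ennreal monoI Q_mono) auto

lemma b0_le_T0:
  obtains L where "L < top" "\<And>t. 0 < t \<Longrightarrow> ennreal (b0 t) \<le> L * T0 t"
  unfolding T0_def using hnorm_sv_lower[OF b0 r0] by metis

lemma a1_le_H1:
  obtains L where "L < top" "\<And>t. 0 < t \<Longrightarrow> ennreal (a1 t) \<le> L * H1 t"
  unfolding H1_def using hnorm_sv_lower[OF a1 q1] by metis

lemma b1_le_T1: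
  obtains L where "L < top" "\<And>t. 0 < t \<Longrightarrow> ennreal (b1 t) \<le> L * T1 t"
  unfolding T1_def using hnorm_sv_lower[OF b1 r1] by metis

lemma T0_nonzero: "0 < t \<Longrightarrow> T0 t \<noteq> 0"
  using b0_le_T0 nonzero_factor[OF sv_pos[OF b0, of t]] by metis

lemma T1_nonzero: "0 < t \<Longrightarrow> T1 t \<noteq> 0"
  using b1_le_T1 nonzero_factor[OF sv_pos[OF b1, of t]] by metis

lemma H1_nonzero: "0 < t \<Longrightarrow> H1 t \<noteq> 0"
  using a1_le_H1 nonzero_factor[OF sv_pos[OF a1, of t]] by metis

lemma T0_bound: "0 < e \<Longrightarrow> \<exists>C<top. \<forall>s>0. \<forall>t>0. T0 s \<le> C * ennreal (dil e s t) * T0 t"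
  unfolding T0_def by (rule sv_tail_bound[OF b0 r0])

lemma T1_bound: "0 < e \<Longrightarrow> \<exists>C<top. \<forall>s>0. \<forall>t>0. T1 s \<le> C * ennreal (dil e s t) * T1 t"
  unfolding T1_def by (rule sv_tail_bound[OF b1 r1])

lemma H1_bound: "0 < e \<Longrightarrow> \<exists>C<top. \<forall>s>0. \<forall>t>0. H1 s \<le> C * ennreal (dil e s t) * H1 t"
  unfolding H1_def by (rule sv_head_bound[OF a1 q1])

lemma sv_T0: "sv (\<lambda>t. enn2real (T0 t))"
  and T0_real: "0 < t \<Longrightarrow> ennreal (enn2real (T0 t)) = T0 t"
  using sv_enn2real[of T0 1, OF T0_bound zero_less_one _ T0_nonzero] tail0_finite
  by (simp_all add: T0_def)

lemma T1_real: "0 < t \<Longrightarrow> ennreal (enn2real (T1 t)) = T1 t"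
  using sv_enn2real(2)[of T1 1, OF T1_bound zero_less_one _ T1_nonzero] tail1_finite
  by (simp add: T1_def)

text \<open>On (1/2, 1) the increasing \<open>H1\<close> is at least its value at 1/2, and
  \<open>b1\<close> has positive norm there. So an infinite value would contradict the finite double
  norm on (0, 1); the argument needs room to the right of the point, hence 1/2 and not 1.\<close>

lemma H1_half_finite: "H1 (1 / 2) < top"
proof -
  let ?c = "hnorm r1 {1 / 2<..<2 * (1 / 2)} (\<lambda>s. ennreal (b1 s))"
  obtain C where C: "0 < C" "tame C 1 (\<lambda>t. ennreal (b1 t))" using sv_tame[OF b1] by blast
  obtain K where K: "ennreal (b1 1) \<le> K * ?c"
    using hnorm_tame_lower[OF r1, of C 1] C by (metis less_imp_le field_sum_of_halves half_gt_zero
      mult_2 order_refl zero_less_one zero_le_one le_add_same_cancel1)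
  then have c: "?c \<noteq> 0" using sv_pos[OF b1, of 1] by (auto simp: ennreal_eq_0_iff)
  have "H1 (1 / 2) * ?c \<le> hnorm r1 {1 / 2<..<2 * (1 / 2)} (\<lambda>s. H1 (1 / 2) * ennreal (b1 s))"
    by (rule hnorm_cmult_ge[OF r1])
  also have "\<dots> \<le> hnorm r1 {1 / 2<..<2 * (1 / 2)} (\<lambda>s. ennreal (b1 s) * H1 s)"
    by (intro hnorm_mono) (auto simp: mult.commute intro!: mult_left_mono H1_mono)
  also have "\<dots> \<le> hnorm r1 {0<..<1} (\<lambda>s. ennreal (b1 s) * H1 s)"
    by (intro hnorm_subset r1) auto
  also have "\<dots> < top" using head1_finite by (simp add: H1_def)
  finally show ?thesis using c by (auto simp: ennreal_mult_less_top)
qed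

lemma H1_real: "0 < t \<Longrightarrow> ennreal (enn2real (H1 t)) = H1 t"
  using sv_enn2real(2)[of H1 "1 / 2", OF H1_bound _ _ H1_nonzero] H1_half_finite
  by simp

lemma finite_lt_top:
  "0 < t \<Longrightarrow> T0 t < top" "0 < t \<Longrightarrow> T1 t < top" "0 < t \<Longrightarrow> H1 t < top"
  using T0_real[of t] T1_real[of t] H1_real[of t] ennreal_less_top by metis+

text \<open>The increment of \<open>\<Phi>\<close> from t to s is estimated through H1(t) T1(t), so
  it is the other summand of \<open>X\<close> that controls it. In that product each factor gets
  half of the exponent.\<close>

lemma X_bound:
  assumes "0 < e"
  shows "\<exists>C<top. \<forall>s>0. \<forall>t>0. X s \<le> C * ennreal (dil e s t) * X t"
proof -
  obtain C where "C < top" and "\<forall>s>0. \<forall>t>0. H1 s \<le> C * ennreal (dil e s t) * H1 t"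
    using H1_bound[OF assms] by (elim exE conjE)
  then have C: "C < top" "\<And>s t. 0 < s \<Longrightarrow> 0 < t \<Longrightarrow> H1 s \<le> C * ennreal (dil e s t) * H1 t" by simp_all
  have e2: "0 < e / 2" using assms by simp
  obtain C1 where "C1 < top" and "\<forall>s>0. \<forall>t>0. H1 s \<le> C1 * ennreal (dil (e / 2) s t) * H1 t"
    using H1_bound[OF e2] by (elim exE conjE)
  then have C1: "C1 < top" "\<And>s t. 0 < s \<Longrightarrow> 0 < t \<Longrightarrow> H1 s \<le> C1 * ennreal (dil (e / 2) s t) * H1 t" by simp_all
  obtain C2 where "C2 < top" and "\<forall>s>0. \<forall>t>0. T1 s \<le> C2 * ennreal (dil (e / 2) s t) * T1 t"
    using T1_bound[OF e2] by (elim exE conjE)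
  then have C2: "C2 < top" "\<And>s t. 0 < s \<Longrightarrow> 0 < t \<Longrightarrow> T1 s \<le> C2 * ennreal (dil (e / 2) s t) * T1 t" by simp_all
  obtain D where D: "splits r1 b1 D" using hnorm_Un_sv[OF r1 b1] by blast
  have \<Phi>1: "\<Phi> s \<le> 1 * ennreal (dil e s t) * X t" if "0 < s" "s \<le> t" for s t
  proof -
    have "\<Phi> s \<le> \<Phi> t" unfolding \<Phi>_def using that by (intro hnorm_subset r1) auto
    also have "\<dots> \<le> 1 * X t" by (simp add: X_def)
    also have "\<dots> \<le> (1 * ennreal (dil e s t)) * X t"
      using assms ennreal_dil_ge_1[of e s t] by (intro mult_right_mono) auto
    finally show ?thesis .
  qed
  have \<Phi>2: "\<Phi> s \<le> (ennreal D * (1 + C)) * ennreal (dil e s t) * X t" if "0 < t" "t \<le> s" for s t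
  proof -
    have "{0<..<s} \<subseteq> {0<..<t} \<union> {t<..<s} \<union> {t}" "{0<..<s} \<subseteq> {0<..}" "{0<..<t} \<subseteq> {0<..}" "{t<..<s} \<subseteq> {0<..}"
      using that by auto
    then have "\<Phi> s \<le> ennreal D * (\<Phi> t + hnorm r1 {t<..<s} (\<lambda>u. ennreal (b1 u) * H1 u))"
      unfolding \<Phi>_def using splitsD[OF D, of "{0<..<s}" "{0<..<t}" "{t<..<s}" t H1] H1_measurable by simp
    moreover have "hnorm r1 {t<..<s} (\<lambda>u. ennreal (b1 u) * H1 u) \<le> C * ennreal (dil e s t) * X t"
    proof -
      have "hnorm r1 {t<..<s} (\<lambda>u. ennreal (b1 u) * H1 u) \<le>
          (C * ennreal (dil e s t) * H1 t) * hnorm r1 {t<..<s} (\<lambda>u. ennreal (b1 u))"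
      proof (rule hnorm_le_cmult[OF r1])
        show "C * ennreal (dil e s t) * H1 t < top"
          using C(1) finite_lt_top that by (simp add: ennreal_mult_less_top)
        fix u assume u: "u \<in> {t<..<s}"
        have "H1 u \<le> C * ennreal (dil e u t) * H1 t" using C(2) u that by auto
        also have "\<dots> \<le> C * ennreal (dil e s t) * H1 t"
          using dil_between(2)[of t u s e] u that assms
          by (intro mult_right_mono mult_left_mono ennreal_leI) (auto simp: dil_commute[of e s t])
        finally have "ennreal (b1 u) * H1 u \<le> ennreal (b1 u) * \<dots>" by (rule mult_left_mono) simp
        then show "ennreal (b1 u) * H1 u \<le> C * ennreal (dil e s t) * H1 t * ennreal (b1 u)"
          by (simp add: mult_ac)
      qed
      also have "\<dots> \<le> (C * ennreal (dil e s t) * H1 t) * T1 t"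
        unfolding T1_def by (intro mult_left_mono hnorm_subset r1) auto
      also have "\<dots> \<le> C * ennreal (dil e s t) * X t"
        unfolding X_def mult.assoc[of _ "H1 t"] by (intro mult_left_mono) (auto simp: mult.commute)
      finally show ?thesis .
    qed
    moreover have "\<Phi> t \<le> ennreal (dil e s t) * X t"
      using mult_mono[OF ennreal_dil_ge_1[of e s t], of "\<Phi> t" "X t"] assms by (simp add: X_def)
    ultimately have "\<Phi> s \<le> ennreal D * (ennreal (dil e s t) * X t + C * ennreal (dil e s t) * X t)"
      by (elim order_trans) (intro mult_left_mono add_mono, auto)
    then show ?thesis by (simp add: algebra_simps)
  qed
  have TH: "T1 s * H1 s \<le> (C2 * C1) * ennreal (dil e s t) * X t" if "0 < s" "0 < t" for s t
  proof -
    have "T1 s * H1 s \<le> (C2 * ennreal (dil (e / 2) s t) * T1 t) * (C1 * ennreal (dil (e / 2) s t) * H1 t)"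
      by (intro mult_mono C1(2) C2(2) that) auto
    also have "\<dots> = (C2 * C1) * (ennreal (dil (e / 2) s t) * ennreal (dil (e / 2) s t)) * (T1 t * H1 t)"
      by (simp add: mult_ac)
    also have "ennreal (dil (e / 2) s t) * ennreal (dil (e / 2) s t) = ennreal (dil e s t)"
      by (simp add: ennreal_mult[symmetric] dil_mult)
    also have "(C2 * C1) * ennreal (dil e s t) * (T1 t * H1 t) \<le> (C2 * C1) * ennreal (dil e s t) * X t"
      unfolding X_def by (intro mult_left_mono) auto
    finally show ?thesis .
  qed
  show ?thesis
  proof (intro exI[of _ "1 + ennreal D * (1 + C) + C2 * C1"] conjI allI impI)
    show "1 + ennreal D * (1 + C) + C2 * C1 < top"
      using C(1) C1(1) C2(1) by (simp add: ennreal_mult_less_top)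
    fix s t :: real assume st: "0 < s" "0 < t"
    have "\<Phi> s \<le> 1 * ennreal (dil e s t) * X t + (ennreal D * (1 + C)) * ennreal (dil e s t) * X t"
    proof (cases "s \<le> t")
      case True
      then show ?thesis using \<Phi>1[OF st(1) True] by (intro add_increasing2) auto
    next
      case False
      then show ?thesis using \<Phi>2[OF st(2), of s] by (intro add_increasing) auto
    qed
    then have "X s \<le> (1 * ennreal (dil e s t) * X t + (ennreal D * (1 + C)) * ennreal (dil e s t) * X t)
        + (C2 * C1) * ennreal (dil e s t) * X t"
      unfolding X_def[of s] using TH[OF st] by (rule add_mono)
    then show "X s \<le> (1 + ennreal D * (1 + C) + C2 * C1) * ennreal (dil e s t) * X t"
      by (simp only: distrib_right)
  qed
qed

lemma X_nonzero: "0 < t \<Longrightarrow> X t \<noteq> 0"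
  using T1_nonzero H1_nonzero by (simp add: X_def)

lemma X_1_finite: "X 1 < top"
proof -
  have "\<Phi> 1 < top" using head1_finite by (simp add: \<Phi>_def H1_def)
  then show ?thesis using finite_lt_top[of 1] by (simp add: X_def ennreal_mult_less_top)
qed

lemma sv_\<chi>1: "sv \<chi>1" and \<chi>1_real: "0 < t \<Longrightarrow> ennreal (\<chi>1 t) = X t"
  using sv_enn2real[of X 1, OF X_bound zero_less_one X_1_finite X_nonzero]
  by (simp_all add: \<chi>1_def[abs_def])

lemma sv_\<chi>0: "sv \<chi>0"
  unfolding \<chi>0_def[abs_def] by (rule sv_mult[OF a0 sv_T0])

lemma \<chi>0_real: "0 < t \<Longrightarrow> ennreal (\<chi>0 t) = ennreal (a0 t) * T0 t"
  using T0_real[of t] sv_pos[OF a0, of t] by (simp add: \<chi>0_def ennreal_mult less_imp_le)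

lemma sv_\<phi>: "sv \<phi>"
  unfolding \<phi>_def[abs_def] by (rule sv_divide[OF sv_\<chi>0 sv_\<chi>1])

lemma \<rho>_pos: "0 < t \<Longrightarrow> 0 < \<rho> t"
  using sv_pos[OF sv_\<phi>, of t] by (simp add: \<rho>_def)

text \<open>Here \<theta>0 < 1 enters: half of the growth of \<open>\<rho>\<close> remains as a
  gain, which later cancels the loss in the Hardy type estimates for the mixed terms.\<close>

lemma \<rho>_decay:
  obtains C where "0 < (C :: real)"
    "\<And>s t. 0 < s \<Longrightarrow> s \<le> t \<Longrightarrow> dil ((1 - \<theta>0) / 2) s t * \<rho> s \<le> C * \<rho> t"
proof -
  obtain C where C: "0 < (C :: real)"
    "\<And>s t. 0 < s \<Longrightarrow> s \<le> t \<Longrightarrow> \<rho> s \<le> C * dil (- ((1 - \<theta>0) / 2)) s t * \<rho> t"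
    unfolding \<rho>_def using powr_sv_decay[OF sv_\<phi>, of "1 - \<theta>0"] \<theta>0 by (metis diff_gt_0_iff_gt)
  show ?thesis
  proof (rule that[OF C(1)])
    fix s t :: real assume "0 < s" "s \<le> t"
    then show "dil ((1 - \<theta>0) / 2) s t * \<rho> s \<le> C * \<rho> t"
      using C(2)[of s t] dil_uminus[of "(1 - \<theta>0) / 2" s t] by (simp add: field_simps)
  qed
qed

text \<open>If k is the K-functional of g, a bound for \<open>khat k\<close> is the pointwise
  estimate characteristic of X0, and a bound for \<open>ktil k\<close> is the one for X1. Up to slow
  variation \<open>khat k\<close> is k(u)/u^\<theta>0 and \<open>ktil k\<close> is k(u)/u.\<close>

definition khat :: "(real \<Rightarrow> ennreal) \<Rightarrow> real \<Rightarrow> ennreal" where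
  "khat k u = ennreal (\<chi>0 u * u powr (- \<theta>0)) * k u"

definition ktil :: "(real \<Rightarrow> ennreal) \<Rightarrow> real \<Rightarrow> ennreal" where
  "ktil k u = ennreal (\<chi>1 u * u powr -1) * k u"

lemma khat_eq: "0 < u \<Longrightarrow> khat k u = T0 u * (ennreal (a0 u) * (ennreal (u powr (- \<theta>0)) * k u))"
  using sv_pos[OF sv_\<chi>0, of u] by (simp add: khat_def ennreal_mult \<chi>0_real less_imp_le mult_ac)

lemma ktil_eq: "0 < u \<Longrightarrow> ktil k u = X u * (ennreal (u powr -1) * k u)"
  unfolding ktil_def ennreal_mult''[OF powr_ge_zero] by (simp only: \<chi>1_real mult.assoc)

lemma khat_ktil: "0 < u \<Longrightarrow> khat k u = ennreal (\<rho> u) * ktil k u"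
proof -
  assume u: "0 < u"
  have "u powr (1 - \<theta>0) = u powr (- \<theta>0) * u"
    using u by (simp add: powr_diff powr_minus_divide)
  then have "\<chi>0 u * u powr (- \<theta>0) = \<rho> u * (\<chi>1 u * u powr -1)"
    using sv_pos[OF sv_\<chi>1 u] u by (simp add: \<rho>_def \<phi>_def powr_minus_divide)
  then show ?thesis
    using ennreal_mult'[OF less_imp_le[OF \<rho>_pos[OF u]]] by (simp only: khat_def ktil_def mult.assoc)
qed

lemma integrand0_le_P:
  obtains K where "K < top"
    "\<And>k t. quasiconcave k \<Longrightarrow> 0 < t \<Longrightarrow> ennreal (a0 t) * (ennreal (t powr (- \<theta>0)) * k t) \<le> K * P k t"
proof -
  obtain C n where C: "0 < (C :: real)" "0 \<le> n"
    "\<And>k. quasiconcave k \<Longrightarrow> tame C n (\<lambda>u. ennreal (a0 u) * (ennreal (u powr (- \<theta>0)) * k u))"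
    using sv_powr_quasiconcave_tame[OF a0] by blast
  obtain K where K: "K < top"
    "\<And>G t. tame C n G \<Longrightarrow> 0 < t \<Longrightarrow> G t \<le> K * hnorm q0 {0<..<t} G"
    using hnorm_tame_lower'[OF q0 less_imp_le[OF C(1)] C(2)] by metis
  show ?thesis
    using K(2)[OF C(3)] by (intro that[OF K(1)]) (simp add: P_def)
qed

text \<open>The octave to the left of t already contributes the value at t to \<open>P k t\<close>.
  Together with \<open>II_le_N0\<close> this bounds \<open>khat k\<close> by the norm of X0.\<close>

lemma khat_le_II:
  obtains K where "K < top" "\<And>k t. quasiconcave k \<Longrightarrow> 0 < t \<Longrightarrow> khat k t \<le> K * II k t"
proof -
  obtain K where K: "K < top"
    "\<And>k t. quasiconcave k \<Longrightarrow> 0 < t \<Longrightarrow> ennreal (a0 t) * (ennreal (t powr (- \<theta>0)) * k t) \<le> K * P k t"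
    using integrand0_le_P by blast
  show ?thesis
  proof (rule that[OF K(1)])
    fix k and t :: real assume k: "quasiconcave k" and t: "0 < t"
    have "khat k t \<le> T0 t * (K * P k t)"
      unfolding khat_eq[OF t] by (intro mult_left_mono K(2) k t) auto
    then show "khat k t \<le> K * II k t" by (simp add: II_def mult_ac)
  qed
qed

lemma I_le_N0: "I k t \<le> N0 k"
  unfolding I_def N0_def by (intro hnorm_subset r0) auto

text \<open>Since \<open>P k\<close> increases, freezing it at t beyond t can only decrease the
  norm, and what remains of the outer norm is the tail of \<open>b0\<close>.\<close>

lemma II_le_N0: "0 < t \<Longrightarrow> II k t \<le> N0 k"
proof -
  assume t: "0 < t"
  have "P k t * T0 t \<le> hnorm r0 {t<..} (\<lambda>s. P k t * ennreal (b0 s))"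
    unfolding T0_def by (rule hnorm_cmult_ge[OF r0])
  also have "\<dots> \<le> hnorm r0 {t<..} (\<lambda>s. ennreal (b0 s) * P k s)"
    by (intro hnorm_mono) (auto simp: mult.commute intro!: mult_left_mono P_mono)
  also have "\<dots> \<le> N0 k" unfolding N0_def using t by (intro hnorm_subset r0) auto
  finally show ?thesis by (simp add: II_def mult.commute)
qed

lemma III_le_N1: "0 < t \<Longrightarrow> III k t \<le> N1 k"
proof -
  assume t: "0 < t"
  have "III k t \<le> hnorm r1 {t<..} (\<lambda>s. ennreal (b1 s) * Q k 0 s)"
    unfolding III_def using t by (intro hnorm_mono mult_left_mono Q_mono) auto
  also have "\<dots> \<le> N1 k" unfolding N1_def using t by (intro hnorm_subset r1) auto
  finally show ?thesis .
qed

text \<open>As k(u)/u decreases, it is at least k(t)/t on (0, t). With this constant pulled out, the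
  outer range (0, t) leaves \<open>\<Phi> t\<close> and the range (t, \<infinity>) leaves
  \<open>T1 t * H1 t\<close>; this is the origin of the two summands of
  \<open>\<chi>1\<close>.\<close>

lemma ktil_le_N1:
  assumes "quasiconcave k" "0 < t"
  shows "ktil k t \<le> 2 * N1 k"
proof -
  let ?c = "ennreal (t powr -1) * k t"
  have Q: "?c * H1 s \<le> Q k 0 s" if "s \<le> t" for s
  proof -
    have "?c * H1 s \<le> hnorm q1 {0<..<s} (\<lambda>u. ?c * ennreal (a1 u))"
      unfolding H1_def by (rule hnorm_cmult_ge[OF q1])
    also have "\<dots> \<le> Q k 0 s"
      unfolding Q_def
    proof (rule hnorm_mono)
      fix u assume "u \<in> {0<..<s}"
      then have "?c \<le> ennreal (u powr -1) * k u" using that by (intro quasiconcave_quotient assms) auto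
      then show "?c * ennreal (a1 u) \<le> ennreal (a1 u) * (ennreal (u powr -1) * k u)"
        by (subst mult.commute) (rule mult_left_mono, simp_all)
    qed
    finally show ?thesis .
  qed
  have "?c * \<Phi> t \<le> hnorm r1 {0<..<t} (\<lambda>s. ?c * (ennreal (b1 s) * H1 s))"
    unfolding \<Phi>_def by (rule hnorm_cmult_ge[OF r1])
  also have "\<dots> \<le> hnorm r1 {0<..<t} (\<lambda>s. ennreal (b1 s) * Q k 0 s)"
  proof (rule hnorm_mono)
    fix s assume "s \<in> {0<..<t}"
    then have "ennreal (b1 s) * (?c * H1 s) \<le> ennreal (b1 s) * Q k 0 s"
      by (intro mult_left_mono Q) auto
    then show "?c * (ennreal (b1 s) * H1 s) \<le> ennreal (b1 s) * Q k 0 s" by (simp add: mult_ac)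
  qed
  also have "\<dots> \<le> N1 k" unfolding N1_def by (intro hnorm_subset r1) auto
  finally have 1: "?c * \<Phi> t \<le> N1 k" .
  have "(?c * H1 t) * T1 t \<le> hnorm r1 {t<..} (\<lambda>s. (?c * H1 t) * ennreal (b1 s))"
    unfolding T1_def by (rule hnorm_cmult_ge[OF r1])
  also have "\<dots> \<le> hnorm r1 {t<..} (\<lambda>s. ennreal (b1 s) * Q k 0 s)"
  proof (rule hnorm_mono)
    fix s assume s: "s \<in> {t<..}"
    have "?c * H1 t \<le> Q k 0 t" by (rule Q) simp
    also have "\<dots> \<le> Q k 0 s" using s by (intro Q_mono) auto
    finally have "ennreal (b1 s) * (?c * H1 t) \<le> ennreal (b1 s) * Q k 0 s"
      by (rule mult_left_mono) simp
    then show "(?c * H1 t) * ennreal (b1 s) \<le> ennreal (b1 s) * Q k 0 s" by (simp add: mult_ac)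
  qed
  also have "\<dots> \<le> N1 k" unfolding N1_def using assms by (intro hnorm_subset r1) auto
  finally have 2: "?c * H1 t * T1 t \<le> N1 k" .
  have "ktil k t = ?c * \<Phi> t + ?c * H1 t * T1 t"
    unfolding ktil_eq[OF assms(2)] X_def by (simp add: algebra_simps)
  also have "\<dots> \<le> N1 k + N1 k" by (intro add_mono 1 2)
  finally show ?thesis by (simp add: mult_2)
qed

text \<open>
  The Hardy type estimates: a nested norm of \<open>k\<close> is bounded by a weighted supremum of \<open>k\<close>, at the cost
  of a factor \<open>(t/u)\<^bsup>\<delta>\<^esup>\<close> with \<open>\<delta>\<close> as small as desired.
\<close>

lemma I_II_le_sup:
  assumes \<delta>: "0 < \<delta>"
  obtains K where "K < top"
    "\<And>k t. quasiconcave k \<Longrightarrow> 0 < t \<Longrightarrow> I k t + II k t \<le> K * (SUP u\<in>{0<..t}. ennreal (dil \<delta> u t) * khat k u)"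
proof -
  obtain K1 where K1: "0 < K1" "\<And>t. 0 < t \<Longrightarrow> hnorm q0 {0<..} (\<lambda>u. ennreal (dil (- \<delta>) u t)) \<le> ennreal K1"
    using hnorm_dil_bounded[OF q0 \<delta>] by blast
  obtain K2 where K2: "K2 < top"
    "\<And>t. 0 < t \<Longrightarrow> hnorm r0 {0<..} (\<lambda>u. ennreal (b0 u) * ennreal (dil (- \<delta>) u t)) \<le> K2 * ennreal (b0 t)"
    using hnorm_sv_dil[OF b0 r0 \<delta>] by blast
  obtain L where L: "L < top" "\<And>t. 0 < t \<Longrightarrow> ennreal (b0 t) \<le> L * T0 t"
    using b0_le_T0 by blast
  let ?K1 = "ennreal K1"
  let ?K = "?K1 * K2 * L + ?K1"
  show ?thesis
  proof (rule that[of "?K + 1"])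
    show "?K + 1 < top" using K2(1) L(1) by (simp add: ennreal_mult_less_top)
    fix k and t :: real assume k: "quasiconcave k" and t: "0 < t"
    define S where "S = (SUP u\<in>{0<..t}. ennreal (dil \<delta> u t) * khat k u)"
    \<comment> \<open>The summand 1 keeps the factor nonzero, so the bound is infinite whenever S
      is. In the other case S is a finite factor that may leave the norms.\<close>
    have "I k t + II k t \<le> (?K + 1) * S"
    proof (cases "S = top")
      case True
      then show ?thesis by (simp add: ennreal_mult_top)
    next
      case False
      then have S: "S < top" by (simp add: less_top)
      \<comment> \<open>\<open>T0\<close> decreases, so its value at t may replace the one at u
        \<le> t. The kernel is inserted together with its reciprocal, which the supremum
        absorbs.\<close>
      have khat: "T0 t * (ennreal (a0 u) * (ennreal (u powr (- \<theta>0)) * k u)) \<le> S * ennreal (dil (- \<delta>) u t)"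
        if "0 < u" "u \<le> t" for u
      proof -
        have "T0 t * (ennreal (a0 u) * (ennreal (u powr (- \<theta>0)) * k u)) \<le> khat k u"
          unfolding khat_eq[OF that(1)] by (intro mult_right_mono T0_antimono that) auto
        also have "\<dots> = (ennreal (dil \<delta> u t) * khat k u) * ennreal (dil (- \<delta>) u t)"
        proof -
          have "ennreal (dil \<delta> u t) * ennreal (dil (- \<delta>) u t) = 1"
            by (simp add: ennreal_mult[symmetric] dil_mult) (simp add: dil_def)
          then show ?thesis by (metis mult.commute mult.left_commute mult_1)
        qed
        also have "\<dots> \<le> S * ennreal (dil (- \<delta>) u t)"
          unfolding S_def using that by (intro mult_right_mono SUP_upper) auto
        finally show ?thesis .
      qed
      have P: "T0 t * P k s \<le> (?K1 * S) * ennreal (dil (- \<delta>) s t)" if s: "0 < s" "s \<le> t" for s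
      proof -
        have "T0 t * P k s \<le> hnorm q0 {0<..<s} (\<lambda>u. T0 t * (ennreal (a0 u) * (ennreal (u powr (- \<theta>0)) * k u)))"
          unfolding P_def by (rule hnorm_cmult_ge[OF q0])
        also have "\<dots> \<le> (S * ennreal (dil (- \<delta>) s t)) * hnorm q0 {0<..<s} (\<lambda>u. ennreal (dil (- \<delta>) u s))"
        proof (rule hnorm_le_cmult[OF q0])
          show "S * ennreal (dil (- \<delta>) s t) < top" using S by (simp add: ennreal_mult_less_top)
          fix u assume u: "u \<in> {0<..<s}"
          then have "dil (- \<delta>) u t = dil (- \<delta>) s t * dil (- \<delta>) u s"
            using s by (simp add: dil_def exp_add[symmetric] algebra_simps)
          then show "T0 t * (ennreal (a0 u) * (ennreal (u powr - \<theta>0) * k u))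
              \<le> S * ennreal (dil (- \<delta>) s t) * ennreal (dil (- \<delta>) u s)"
            using khat[of u] u s by (simp add: ennreal_mult mult.assoc)
        qed
        also have "\<dots> \<le> (S * ennreal (dil (- \<delta>) s t)) * hnorm q0 {0<..} (\<lambda>u. ennreal (dil (- \<delta>) u s))"
          by (intro mult_left_mono hnorm_subset q0) auto
        also have "\<dots> \<le> (S * ennreal (dil (- \<delta>) s t)) * ?K1"
          by (intro mult_left_mono K1(2) s) auto
        finally show ?thesis by (simp add: mult_ac)
      qed
      have II: "II k t \<le> ?K1 * S" using P[OF t order_refl] by (simp add: II_def)
      \<comment> \<open>The factor \<open>T0 t\<close> is carried along because it is needed under
        the norm. Integrating \<open>b0\<close> against the kernel leaves b0(t), at most a multiple
        of \<open>T0 t\<close>, so the factor cancels in the end.\<close>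
      have "T0 t * I k t \<le> hnorm r0 {0<..<t} (\<lambda>s. T0 t * (ennreal (b0 s) * P k s))"
        unfolding I_def by (rule hnorm_cmult_ge[OF r0])
      also have "\<dots> \<le> (?K1 * S) * hnorm r0 {0<..<t} (\<lambda>s. ennreal (b0 s) * ennreal (dil (- \<delta>) s t))"
      proof (rule hnorm_le_cmult[OF r0])
        show "?K1 * S < top" using S by (simp add: ennreal_mult_less_top)
        fix s assume "s \<in> {0<..<t}"
        then have "ennreal (b0 s) * (T0 t * P k s) \<le> ennreal (b0 s) * ((?K1 * S) * ennreal (dil (- \<delta>) s t))"
          by (intro mult_left_mono P) auto
        then show "T0 t * (ennreal (b0 s) * P k s) \<le> (?K1 * S) * (ennreal (b0 s) * ennreal (dil (- \<delta>) s t))"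
          by (simp add: mult_ac)
      qed
      also have "\<dots> \<le> (?K1 * S) * hnorm r0 {0<..} (\<lambda>s. ennreal (b0 s) * ennreal (dil (- \<delta>) s t))"
        by (intro mult_left_mono hnorm_subset r0) auto
      also have "\<dots> \<le> (?K1 * S) * (K2 * (L * T0 t))"
        by (intro mult_left_mono order_trans[OF K2(2)] L(2) t) auto
      finally have "T0 t * I k t \<le> T0 t * (?K1 * K2 * L * S)" by (simp add: mult_ac)
      then have I: "I k t \<le> ?K1 * K2 * L * S"
        using T0_nonzero[OF t] finite_lt_top(1)[OF t] by (simp add: ennreal_mult_le_mult_iff)
      have "I k t + II k t \<le> ?K1 * K2 * L * S + ?K1 * S" by (intro add_mono I II)
      also have "\<dots> \<le> (?K + 1) * S" by (simp add: distrib_right)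
      finally show ?thesis .
    qed
    then show "I k t + II k t \<le> (?K + 1) * (SUP u\<in>{0<..t}. ennreal (dil \<delta> u t) * khat k u)"
      by (simp only: S_def)
  qed
qed

lemma III_le_sup:
  assumes \<delta>: "0 < \<delta>"
  obtains K where "K < top"
    "\<And>k t. quasiconcave k \<Longrightarrow> 0 < t \<Longrightarrow> III k t \<le> K * (SUP u\<in>{t..}. ennreal (dil \<delta> u t) * ktil k u)"
proof -
  \<comment> \<open>Half of the exponent absorbs the variation of \<open>T1\<close> between t and u,
    the other half makes the norm in u converge.\<close>
  have \<delta>2: "0 < \<delta> / 2" using \<delta> by simp
  obtain K1 where K1: "0 < K1" "\<And>t. 0 < t \<Longrightarrow> hnorm q1 {0<..} (\<lambda>u. ennreal (dil (- (\<delta> / 2)) u t)) \<le> ennreal K1"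
    using hnorm_dil_bounded[OF q1 \<delta>2] by blast
  obtain L where L: "L < top" "\<And>t. 0 < t \<Longrightarrow> ennreal (a1 t) \<le> L * H1 t"
    using a1_le_H1 by blast
  obtain C where "C < top" and "\<forall>s>0. \<forall>t>0. T1 s \<le> C * ennreal (dil (\<delta> / 2) s t) * T1 t"
    using T1_bound[OF \<delta>2] by (elim exE conjE)
  then have C: "C < top" "\<And>s t. 0 < s \<Longrightarrow> 0 < t \<Longrightarrow> T1 s \<le> C * ennreal (dil (\<delta> / 2) s t) * T1 t" by simp_all
  let ?K1 = "ennreal K1"
  let ?K = "C * L * ?K1"
  show ?thesis
  proof (rule that[of "?K + 1"])
    show "?K + 1 < top" using C(1) L(1) by (simp add: ennreal_mult_less_top)
    fix k and t :: real assume k: "quasiconcave k" and t: "0 < t"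
    define S where "S = (SUP u\<in>{t..}. ennreal (dil \<delta> u t) * ktil k u)"
    have "III k t \<le> (?K + 1) * S"
    proof (cases "S = top")
      case True
      then show ?thesis by (simp add: ennreal_mult_top)
    next
      case False
      then have S: "S < top" by (simp add: less_top)
      have ktil: "T1 t * (ennreal (a1 u) * (ennreal (u powr -1) * k u)) \<le> (C * L * S) * ennreal (dil (- (\<delta> / 2)) u t)"
        if "t \<le> u" for u
      proof -
        have u: "0 < u" using that t by simp
        \<comment> \<open>Replacing \<open>a1\<close> by the larger \<open>H1\<close> produces
          \<open>T1 u * H1 u\<close>, the second summand of \<open>X u\<close>, and thereby
          \<open>ktil\<close>.\<close>
        have "T1 t * ennreal (a1 u) \<le> (C * ennreal (dil (\<delta> / 2) u t) * T1 u) * (L * H1 u)"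
          using C(2)[OF t u] L(2)[OF u] by (intro mult_mono) (auto simp: dil_commute[of _ u t])
        also have "\<dots> = C * L * ennreal (dil (\<delta> / 2) u t) * (T1 u * H1 u)" by (simp add: mult_ac)
        also have "\<dots> \<le> C * L * ennreal (dil (\<delta> / 2) u t) * X u"
          by (intro mult_left_mono) (auto simp: X_def)
        finally have "T1 t * ennreal (a1 u) * (ennreal (u powr -1) * k u) \<le>
            C * L * ennreal (dil (\<delta> / 2) u t) * X u * (ennreal (u powr -1) * k u)"
          by (rule mult_right_mono) simp
        also have "\<dots> = C * L * ennreal (dil (\<delta> / 2) u t) * ktil k u" by (simp add: ktil_eq[OF u] mult_ac)
        also have "ennreal (dil (\<delta> / 2) u t) = ennreal (dil (- (\<delta> / 2)) u t) * ennreal (dil \<delta> u t)"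
          by (simp add: ennreal_mult[symmetric] dil_mult)
        also have "C * L * (ennreal (dil (- (\<delta> / 2)) u t) * ennreal (dil \<delta> u t)) * ktil k u =
            C * L * ennreal (dil (- (\<delta> / 2)) u t) * (ennreal (dil \<delta> u t) * ktil k u)" by (simp add: mult_ac)
        also have "\<dots> \<le> C * L * ennreal (dil (- (\<delta> / 2)) u t) * S"
          unfolding S_def using that by (intro mult_left_mono SUP_upper) auto
        finally show ?thesis by (simp add: mult_ac)
      qed
      have Q: "T1 t * Q k t s \<le> ?K * S" if s: "t < s" for s
      proof -
        have "T1 t * Q k t s \<le> hnorm q1 {t<..<s} (\<lambda>u. T1 t * (ennreal (a1 u) * (ennreal (u powr -1) * k u)))"
          unfolding Q_def by (rule hnorm_cmult_ge[OF q1])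
        also have "\<dots> \<le> (C * L * S) * hnorm q1 {t<..<s} (\<lambda>u. ennreal (dil (- (\<delta> / 2)) u t))"
          using C(1) L(1) S by (intro hnorm_le_cmult q1 ktil) (auto simp: ennreal_mult_less_top)
        also have "\<dots> \<le> (C * L * S) * hnorm q1 {0<..} (\<lambda>u. ennreal (dil (- (\<delta> / 2)) u t))"
          using t by (intro mult_left_mono hnorm_subset q1) auto
        also have "\<dots> \<le> (C * L * S) * ?K1"
          by (intro mult_left_mono K1(2) t) auto
        finally show ?thesis by (simp add: mult_ac)
      qed
      \<comment> \<open>The bound for \<open>Q\<close> does not depend on s, so the outer norm
        leaves exactly \<open>T1 t\<close>, which is cancelled.\<close>
      have "T1 t * III k t \<le> hnorm r1 {t<..} (\<lambda>s. T1 t * (ennreal (b1 s) * Q k t s))"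
        unfolding III_def by (rule hnorm_cmult_ge[OF r1])
      also have "\<dots> \<le> (?K * S) * hnorm r1 {t<..} (\<lambda>s. ennreal (b1 s))"
      proof (rule hnorm_le_cmult[OF r1])
        show "?K * S < top" using S C(1) L(1) by (simp add: ennreal_mult_less_top)
        fix s assume "s \<in> {t<..}"
        then have "ennreal (b1 s) * (T1 t * Q k t s) \<le> ennreal (b1 s) * (?K * S)"
          by (intro mult_left_mono Q) auto
        then show "T1 t * (ennreal (b1 s) * Q k t s) \<le> (?K * S) * ennreal (b1 s)"
          by (simp add: mult_ac)
      qed
      also have "\<dots> = T1 t * (?K * S)" by (simp add: T1_def mult_ac)
      finally have "III k t \<le> ?K * S"
        using T1_nonzero[OF t] finite_lt_top(2)[OF t] by (simp add: ennreal_mult_le_mult_iff)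
      also have "\<dots> \<le> (?K + 1) * S" by (simp add: distrib_right)
      finally show ?thesis .
    qed
    then show "III k t \<le> (?K + 1) * (SUP u\<in>{t..}. ennreal (dil \<delta> u t) * ktil k u)"
      by (simp only: S_def)
  qed
qed

text \<open>A mixed term: the X0 terms of an element of X1. In the supremum over u \<le> t write
  \<open>khat\<close> as \<open>\<rho>\<close> times \<open>ktil\<close>; then \<open>ktil\<close>
  is bounded by the norm of X1, and the growth of \<open>\<rho>\<close> from u to t pays for the
  factor dil.\<close>

lemma I_II_le_N1:
  obtains K where "K < top"
    "\<And>k t. quasiconcave k \<Longrightarrow> 0 < t \<Longrightarrow> I k t + II k t \<le> K * (ennreal (\<rho> t) * N1 k)"
proof -
  have \<delta>: "0 < (1 - \<theta>0) / 2" using \<theta>0 by simp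
  obtain K where K: "K < top"
    "\<And>k t. quasiconcave k \<Longrightarrow> 0 < t \<Longrightarrow> I k t + II k t \<le> K * (SUP u\<in>{0<..t}. ennreal (dil ((1 - \<theta>0) / 2) u t) * khat k u)"
    using I_II_le_sup[OF \<delta>] by blast
  obtain C where C: "0 < (C :: real)"
    "\<And>s t. 0 < s \<Longrightarrow> s \<le> t \<Longrightarrow> dil ((1 - \<theta>0) / 2) s t * \<rho> s \<le> C * \<rho> t"
    using \<rho>_decay by blast
  show ?thesis
  proof (rule that[of "K * (ennreal C * 2)"])
    show "K * (ennreal C * 2) < top" using K(1) by (simp add: ennreal_mult_less_top)
    fix k and t :: real assume k: "quasiconcave k" and t: "0 < t"
    have "(SUP u\<in>{0<..t}. ennreal (dil ((1 - \<theta>0) / 2) u t) * khat k u) \<le> ennreal C * ennreal (\<rho> t) * (2 * N1 k)"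
    proof (rule SUP_least)
      fix u assume u: "u \<in> {0<..t}"
      then have "ennreal (dil ((1 - \<theta>0) / 2) u t) * khat k u = ennreal (dil ((1 - \<theta>0) / 2) u t * \<rho> u) * ktil k u"
        using \<rho>_pos[of u] by (simp add: khat_ktil ennreal_mult mult.assoc less_imp_le)
      also have "\<dots> \<le> ennreal (C * \<rho> t) * (2 * N1 k)"
        using u by (intro mult_mono ennreal_leI C(2) ktil_le_N1 k) auto
      finally show "ennreal (dil ((1 - \<theta>0) / 2) u t) * khat k u \<le> ennreal C * ennreal (\<rho> t) * (2 * N1 k)"
        using C(1) \<rho>_pos[OF t] by (simp add: ennreal_mult less_imp_le)
    qed
    then have "K * (SUP u\<in>{0<..t}. ennreal (dil ((1 - \<theta>0) / 2) u t) * khat k u) \<le>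
        K * (ennreal C * ennreal (\<rho> t) * (2 * N1 k))" by (rule mult_left_mono) simp
    with K(2)[OF k t] have "I k t + II k t \<le> \<dots>" by (rule order_trans)
    then show "I k t + II k t \<le> K * (ennreal C * 2) * (ennreal (\<rho> t) * N1 k)"
      by (simp add: mult_ac)
  qed
qed

text \<open>The opposite mixed term. Now u \<ge> t, and the growth of \<open>\<rho>\<close> from t
  to u both pays for dil and turns \<open>ktil u\<close> into \<open>khat u\<close>, which the norm
  of X0 bounds.\<close>

lemma III_le_N0:
  obtains K where "K < top"
    "\<And>k t. quasiconcave k \<Longrightarrow> 0 < t \<Longrightarrow> ennreal (\<rho> t) * III k t \<le> K * N0 k"
proof -
  have \<delta>: "0 < (1 - \<theta>0) / 2" using \<theta>0 by simp
  obtain K where K: "K < top"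
    "\<And>k t. quasiconcave k \<Longrightarrow> 0 < t \<Longrightarrow> III k t \<le> K * (SUP u\<in>{t..}. ennreal (dil ((1 - \<theta>0) / 2) u t) * ktil k u)"
    using III_le_sup[OF \<delta>] by blast
  obtain C where C: "0 < (C :: real)"
    "\<And>s t. 0 < s \<Longrightarrow> s \<le> t \<Longrightarrow> dil ((1 - \<theta>0) / 2) s t * \<rho> s \<le> C * \<rho> t"
    using \<rho>_decay by blast
  obtain K' where K': "K' < top" "\<And>k t. quasiconcave k \<Longrightarrow> 0 < t \<Longrightarrow> khat k t \<le> K' * II k t"
    using khat_le_II by blast
  show ?thesis
  proof (rule that[of "K * (ennreal C * K')"])
    show "K * (ennreal C * K') < top" using K(1) K'(1) by (simp add: ennreal_mult_less_top)
    fix k and t :: real assume k: "quasiconcave k" and t: "0 < t"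
    have "ennreal (\<rho> t) * (SUP u\<in>{t..}. ennreal (dil ((1 - \<theta>0) / 2) u t) * ktil k u) \<le> ennreal C * (K' * N0 k)"
      unfolding SUP_mult_left_ennreal
    proof (rule SUP_least)
      fix u assume u: "u \<in> {t..}"
      then have u0: "0 < u" using t by simp
      have "ennreal (\<rho> t) * (ennreal (dil ((1 - \<theta>0) / 2) u t) * ktil k u) = ennreal (dil ((1 - \<theta>0) / 2) t u * \<rho> t) * ktil k u"
        using \<rho>_pos[OF t] by (simp add: ennreal_mult mult_ac less_imp_le dil_commute[of _ t u])
      also have "\<dots> \<le> ennreal (C * \<rho> u) * ktil k u"
        using u t by (intro mult_right_mono ennreal_leI C(2)) auto
      also have "\<dots> = ennreal C * khat k u"
        using C(1) \<rho>_pos[OF u0] by (simp add: khat_ktil[OF u0] ennreal_mult less_imp_le mult.assoc)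
      also have "\<dots> \<le> ennreal C * (K' * N0 k)"
        by (intro mult_left_mono order_trans[OF K'(2)[OF k u0]] II_le_N0 u0) auto
      finally show "ennreal (\<rho> t) * (ennreal (dil ((1 - \<theta>0) / 2) u t) * ktil k u) \<le> ennreal C * (K' * N0 k)" .
    qed
    then have "K * (ennreal (\<rho> t) * (SUP u\<in>{t..}. ennreal (dil ((1 - \<theta>0) / 2) u t) * ktil k u)) \<le>
        K * (ennreal C * (K' * N0 k))" by (rule mult_left_mono) simp
    moreover have "ennreal (\<rho> t) * III k t \<le>
        ennreal (\<rho> t) * (K * (SUP u\<in>{t..}. ennreal (dil ((1 - \<theta>0) / 2) u t) * ktil k u))"
      by (intro mult_left_mono K(2) k t) auto
    ultimately show "ennreal (\<rho> t) * III k t \<le> K * (ennreal C * K') * N0 k"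
      by (simp add: mult_ac)
  qed
qed

end

lemma tame_cong: "tame C n F \<Longrightarrow> (\<And>t. 0 < t \<Longrightarrow> G t = F t) \<Longrightarrow> tame C n G"
  by (simp add: tame_def)

section \<open>The two halves of Holmstedt's formula for quasiconcave functions\<close>

context weights
begin

text \<open>Here \<open>k'\<close> is the K-functional of the X0 component in a decomposition tuned
  to t: dominated by k up to t and by the constant k(t) beyond. Since \<theta>0 > 0, the constant
  part of \<open>P k'\<close> converges and is dominated by \<open>P k t\<close>, so beyond t only
  the tail of \<open>b0\<close> is left.\<close>

lemma N0_le_I_II:
  assumes c: "c < top"
  obtains K where "K < top"
    "\<And>k k' t. quasiconcave k \<Longrightarrow> quasiconcave k' \<Longrightarrow> 0 < t \<Longrightarrow> k t < top \<Longrightarrow> (\<And>u. 0 < u \<Longrightarrow> u \<le> t \<Longrightarrow> k' u \<le> c * k u) \<Longrightarrow>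
      (\<And>u. t \<le> u \<Longrightarrow> k' u \<le> c * k t) \<Longrightarrow> N0 k' \<le> K * (I k t + II k t)"
proof -
  obtain D where D: "splits r0 b0 D" using hnorm_Un_sv[OF r0 b0] by blast
  obtain E where E: "splits q0 a0 E" using hnorm_Un_sv[OF q0 a0] by blast
  obtain B where B: "B < top"
    "\<And>k t. quasiconcave k \<Longrightarrow> 0 < t \<Longrightarrow> ennreal (a0 t) * (ennreal (t powr (- \<theta>0)) * k t) \<le> B * P k t"
    using integrand0_le_P by blast
  obtain M where M: "M < top"
    "\<And>t. 0 < t \<Longrightarrow> hnorm q0 {0<..} (\<lambda>u. ennreal (a0 u) * ennreal (dil (- \<theta>0) u t)) \<le> M * ennreal (a0 t)"
    using hnorm_sv_dil[OF a0 q0 \<theta>0(1)] by blast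
  let ?K' = "ennreal E * (c + c * M * B)"
  show ?thesis
  proof (rule that[of "ennreal D * (c + ?K')"])
    show "ennreal D * (c + ?K') < top" using c B(1) M(1) by (simp add: ennreal_mult_less_top)
    fix k k' and t :: real
    assume k: "quasiconcave k" "quasiconcave k'" and t: "0 < t" and fin: "k t < top"
      and le: "\<And>u. 0 < u \<Longrightarrow> u \<le> t \<Longrightarrow> k' u \<le> c * k u" and ge: "\<And>u. t \<le> u \<Longrightarrow> k' u \<le> c * k t"
    have head: "P k' s \<le> c * P k s" if "s \<le> t" for s
      unfolding P_def
    proof (rule hnorm_le_cmult[OF q0 c])
      fix u assume "u \<in> {0<..<s}"
      then have "ennreal (a0 u) * (ennreal (u powr - \<theta>0) * k' u) \<le> ennreal (a0 u) * (ennreal (u powr - \<theta>0) * (c * k u))"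
        using that by (intro mult_left_mono le) auto
      then show "ennreal (a0 u) * (ennreal (u powr - \<theta>0) * k' u) \<le> c * (ennreal (a0 u) * (ennreal (u powr - \<theta>0) * k u))"
        by (simp add: mult_ac)
    qed
    have tail: "P k' s \<le> ?K' * P k t" if s: "t < s" for s
    proof -
      have "{0<..<s} \<subseteq> {0<..<t} \<union> {t<..<s} \<union> {t}" "{0<..<s} \<subseteq> {0<..}" "{0<..<t} \<subseteq> {0<..}" "{t<..<s} \<subseteq> {0<..}"
        using s t by auto
      moreover have "(\<lambda>u. ennreal (u powr (- \<theta>0)) * k' u) \<in> borel_measurable borel"
        using quasiconcave_measurable[OF k(2)] by measurable
      ultimately have "P k' s \<le> ennreal E * (P k' t + hnorm q0 {t<..<s} (\<lambda>u. ennreal (a0 u) * (ennreal (u powr (- \<theta>0)) * k' u)))"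
        unfolding P_def using splitsD[OF E, of "{0<..<s}" "{0<..<t}" "{t<..<s}" t "\<lambda>u. ennreal (u powr (- \<theta>0)) * k' u"] by simp
      also have "\<dots> \<le> ennreal E * (c * P k t + c * M * B * P k t)"
      proof (intro mult_left_mono add_mono head order_refl)
        let ?c = "c * (ennreal (t powr (- \<theta>0)) * k t)"
        have "hnorm q0 {t<..<s} (\<lambda>u. ennreal (a0 u) * (ennreal (u powr (- \<theta>0)) * k' u)) \<le>
            ?c * hnorm q0 {t<..<s} (\<lambda>u. ennreal (a0 u) * ennreal (dil (- \<theta>0) u t))"
        proof (rule hnorm_le_cmult[OF q0])
          show "?c < top" using c fin by (simp add: ennreal_mult_less_top)
          fix u assume u: "u \<in> {t<..<s}"
          then have "u powr (- \<theta>0) = dil (- \<theta>0) u t * t powr (- \<theta>0)"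
            using t by (simp add: dil_def powr_def exp_add[symmetric] algebra_simps)
          then have eq: "ennreal (u powr (- \<theta>0)) = ennreal (dil (- \<theta>0) u t) * ennreal (t powr (- \<theta>0))"
            by (simp add: ennreal_mult)
          have "ennreal (a0 u) * (ennreal (u powr (- \<theta>0)) * k' u) \<le> ennreal (a0 u) * (ennreal (u powr (- \<theta>0)) * (c * k t))"
            using u by (intro mult_left_mono ge) auto
          then show "ennreal (a0 u) * (ennreal (u powr (- \<theta>0)) * k' u) \<le> ?c * (ennreal (a0 u) * ennreal (dil (- \<theta>0) u t))"
            by (simp add: eq mult_ac)
        qed
        also have "\<dots> \<le> ?c * hnorm q0 {0<..} (\<lambda>u. ennreal (a0 u) * ennreal (dil (- \<theta>0) u t))"
          using t by (intro mult_left_mono hnorm_subset q0) auto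
        also have "\<dots> \<le> ?c * (M * ennreal (a0 t))"
          by (intro mult_left_mono M(2) t) auto
        also have "\<dots> = c * M * (ennreal (a0 t) * (ennreal (t powr (- \<theta>0)) * k t))" by (simp add: mult_ac)
        also have "\<dots> \<le> c * M * (B * P k t)" by (intro mult_left_mono B(2) k t) auto
        finally show "hnorm q0 {t<..<s} (\<lambda>u. ennreal (a0 u) * (ennreal (u powr (- \<theta>0)) * k' u)) \<le> c * M * B * P k t"
          by (simp add: mult_ac)
      qed auto
      also have "\<dots> = ?K' * P k t" by (simp add: algebra_simps)
      finally show ?thesis .
    qed
    have "{0<..} \<subseteq> {0<..<t} \<union> {t<..} \<union> {t}" "{0<..<t} \<subseteq> {0<..}" "{t<..} \<subseteq> {0<..}" using t by auto
    then have "N0 k' \<le> ennreal D * (I k' t + hnorm r0 {t<..} (\<lambda>s. ennreal (b0 s) * P k' s))"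
      unfolding N0_def I_def using splitsD[OF D, of "{0<..}" "{0<..<t}" "{t<..}" t "P k'"] P_measurable by simp
    also have "\<dots> \<le> ennreal D * (c * I k t + ?K' * II k t)"
    proof (intro mult_left_mono add_mono)
      show "I k' t \<le> c * I k t"
        unfolding I_def
      proof (rule hnorm_le_cmult[OF r0 c])
        fix s assume "s \<in> {0<..<t}"
        then have "ennreal (b0 s) * P k' s \<le> ennreal (b0 s) * (c * P k s)" by (intro mult_left_mono head) auto
        then show "ennreal (b0 s) * P k' s \<le> c * (ennreal (b0 s) * P k s)" by (simp add: mult_ac)
      qed
      show "hnorm r0 {t<..} (\<lambda>s. ennreal (b0 s) * P k' s) \<le> ?K' * II k t"
      \<comment> \<open>Only finite factors leave the norm in this direction; an infinite one makes
        the right side infinite, because \<open>T0 t\<close> is not 0.\<close>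
      proof (cases "?K' * P k t = top")
        case True
        then have "?K' * II k t = top"
          using T0_nonzero[OF t] by (simp add: II_def mult.left_commute[of _ "T0 t"] ennreal_mult_top del: mult_eq_0_iff)
        then show ?thesis by simp
      next
        case False
        have "hnorm r0 {t<..} (\<lambda>s. ennreal (b0 s) * P k' s) \<le> (?K' * P k t) * hnorm r0 {t<..} (\<lambda>s. ennreal (b0 s))"
        proof (rule hnorm_le_cmult[OF r0])
          show "?K' * P k t < top" using False by (simp add: less_top)
          fix s assume "s \<in> {t<..}"
          then have "ennreal (b0 s) * P k' s \<le> ennreal (b0 s) * (?K' * P k t)" by (intro mult_left_mono tail) auto
          then show "ennreal (b0 s) * P k' s \<le> (?K' * P k t) * ennreal (b0 s)" by (simp add: mult_ac)
        qed
        then show ?thesis by (simp add: II_def T0_def mult_ac)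
      qed
    qed auto
    also have "\<dots> \<le> ennreal D * ((c + ?K') * I k t + (c + ?K') * II k t)"
      by (intro mult_left_mono add_mono mult_right_mono) auto
    finally show "N0 k' \<le> ennreal D * (c + ?K') * (I k t + II k t)"
      by (simp only: distrib_left[of "c + ?K'"] mult.assoc[of "ennreal D" "c + ?K'"])
  qed
qed

text \<open>Here \<open>k'\<close> is the K-functional of the X1 component: at most linear up to t
  and dominated by k beyond. On (0, t) the quotient k'(u)/u is bounded by a multiple of k(t)/t,
  which yields \<open>ktil k t\<close>; the rest is \<open>III\<close>.\<close>

lemma N1_le_III:
  assumes c: "c < top"
  obtains K where "K < top"
    "\<And>k k' t. quasiconcave k \<Longrightarrow> quasiconcave k' \<Longrightarrow> 0 < t \<Longrightarrow> k t < top \<Longrightarrow>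
      (\<And>u. 0 < u \<Longrightarrow> u \<le> t \<Longrightarrow> k' u \<le> ennreal (u / t) * (c * k t)) \<Longrightarrow>
      (\<And>u. t \<le> u \<Longrightarrow> k' u \<le> c * k u) \<Longrightarrow> N1 k' \<le> K * (ktil k t + III k t)"
proof -
  obtain D where D: "splits r1 b1 D" using hnorm_Un_sv[OF r1 b1] by blast
  obtain E where E: "splits q1 a1 E" using hnorm_Un_sv[OF q1 a1] by blast
  obtain F where F: "adds r1 b1 F" using hnorm_add_sv[OF r1 b1] by blast
  let ?K = "c + ennreal E * c * ennreal F"
  show ?thesis
  proof (rule that[of "ennreal D * ?K"])
    show "ennreal D * ?K < top" using c by (simp add: ennreal_mult_less_top)
    fix k k' and t :: real
    assume k: "quasiconcave k" "quasiconcave k'" and t: "0 < t" and fin: "k t < top"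
      and le: "\<And>u. 0 < u \<Longrightarrow> u \<le> t \<Longrightarrow> k' u \<le> ennreal (u / t) * (c * k t)"
      and ge: "\<And>u. t \<le> u \<Longrightarrow> k' u \<le> c * k u"
    let ?x = "ennreal (t powr -1) * k t"
    have x: "?x < top" using fin by (simp add: ennreal_mult_less_top)
    have head: "Q k' 0 s \<le> c * ?x * H1 s" if "s \<le> t" for s
      unfolding Q_def H1_def
    proof (rule hnorm_le_cmult[OF q1])
      show "c * ?x < top" using c fin by (simp add: ennreal_mult_less_top)
      fix u assume u: "u \<in> {0<..<s}"
      then have "ennreal (u powr -1) * k' u \<le> ennreal (u powr -1) * (ennreal (u / t) * (c * k t))"
        using that by (intro mult_left_mono le) auto
      also have "\<dots> = ennreal (u powr -1 * (u / t)) * (c * k t)"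
        using ennreal_mult'[of "u powr -1" "u / t"] by (simp only: powr_ge_zero mult.assoc)
      also have "u powr -1 * (u / t) = t powr -1" using u t by (simp add: powr_minus_divide)
      finally have "ennreal (a1 u) * (ennreal (u powr -1) * k' u) \<le> ennreal (a1 u) * (ennreal (t powr -1) * (c * k t))"
        by (rule mult_left_mono) simp
      then show "ennreal (a1 u) * (ennreal (u powr -1) * k' u) \<le> c * ?x * ennreal (a1 u)"
        by (simp only: mult_ac)
    qed
    have tail: "Q k' 0 s \<le> ennreal E * c * (?x * H1 t + Q k t s)" if s: "t < s" for s
    proof -
      have "{0<..<s} \<subseteq> {0<..<t} \<union> {t<..<s} \<union> {t}" "{0<..<s} \<subseteq> {0<..}" "{0<..<t} \<subseteq> {0<..}" "{t<..<s} \<subseteq> {0<..}"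
        using s t by auto
      moreover have "(\<lambda>u. ennreal (u powr -1) * k' u) \<in> borel_measurable borel"
        using quasiconcave_measurable[OF k(2)] by measurable
      ultimately have "Q k' 0 s \<le> ennreal E * (Q k' 0 t + Q k' t s)"
        unfolding Q_def using splitsD[OF E, of "{0<..<s}" "{0<..<t}" "{t<..<s}" t "\<lambda>u. ennreal (u powr -1) * k' u"] by simp
      also have "\<dots> \<le> ennreal E * (c * ?x * H1 t + c * Q k t s)"
      proof (intro mult_left_mono add_mono head order_refl)
        show "Q k' t s \<le> c * Q k t s"
          unfolding Q_def
        proof (rule hnorm_le_cmult[OF q1 c])
          fix u assume "u \<in> {t<..<s}"
          then have "ennreal (a1 u) * (ennreal (u powr -1) * k' u) \<le> ennreal (a1 u) * (ennreal (u powr -1) * (c * k u))"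
            by (intro mult_left_mono ge) auto
          then show "ennreal (a1 u) * (ennreal (u powr -1) * k' u) \<le> c * (ennreal (a1 u) * (ennreal (u powr -1) * k u))"
            by (simp only: mult_ac)
        qed
      qed auto
      finally show ?thesis by (simp only: distrib_left mult.assoc)
    qed
    have "{0<..} \<subseteq> {0<..<t} \<union> {t<..} \<union> {t}" "{0<..<t} \<subseteq> {0<..}" and sub: "{t<..} \<subseteq> {0<..}" using t by auto
    then have "N1 k' \<le> ennreal D * (hnorm r1 {0<..<t} (\<lambda>s. ennreal (b1 s) * Q k' 0 s) + hnorm r1 {t<..} (\<lambda>s. ennreal (b1 s) * Q k' 0 s))"
      unfolding N1_def using splitsD[OF D, of "{0<..}" "{0<..<t}" "{t<..}" t "Q k' 0"] Q_measurable by simp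
    also have "\<dots> \<le> ennreal D * (c * ktil k t + ennreal E * c * ennreal F * (ktil k t + III k t))"
    proof (intro mult_left_mono add_mono)
      have "hnorm r1 {0<..<t} (\<lambda>s. ennreal (b1 s) * Q k' 0 s) \<le> (c * ?x) * \<Phi> t"
        unfolding \<Phi>_def
      proof (rule hnorm_le_cmult[OF r1])
        show "c * ?x < top" using c fin by (simp add: ennreal_mult_less_top)
        fix s assume "s \<in> {0<..<t}"
        then have "ennreal (b1 s) * Q k' 0 s \<le> ennreal (b1 s) * (c * ?x * H1 s)" by (intro mult_left_mono head) auto
        then show "ennreal (b1 s) * Q k' 0 s \<le> c * ?x * (ennreal (b1 s) * H1 s)" by (simp only: mult_ac)
      qed
      also have "\<dots> \<le> (c * ?x) * X t" by (intro mult_left_mono) (auto simp: X_def)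
      finally show "hnorm r1 {0<..<t} (\<lambda>s. ennreal (b1 s) * Q k' 0 s) \<le> c * ktil k t"
        by (simp only: ktil_eq[OF t] mult_ac)
      have "hnorm r1 {t<..} (\<lambda>s. ennreal (b1 s) * Q k' 0 s) \<le>
          (ennreal E * c) * hnorm r1 {t<..} (\<lambda>s. ennreal (b1 s) * (?x * H1 t + Q k t s))"
      proof (rule hnorm_le_cmult[OF r1])
        show "ennreal E * c < top" using c by (simp add: ennreal_mult_less_top)
        fix s assume "s \<in> {t<..}"
        then have "ennreal (b1 s) * Q k' 0 s \<le> ennreal (b1 s) * (ennreal E * c * (?x * H1 t + Q k t s))"
          by (intro mult_left_mono tail) auto
        then show "ennreal (b1 s) * Q k' 0 s \<le> ennreal E * c * (ennreal (b1 s) * (?x * H1 t + Q k t s))"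
          by (simp only: mult_ac)
      qed
      also have "\<dots> \<le> (ennreal E * c) * (ennreal F * (hnorm r1 {t<..} (\<lambda>s. ennreal (b1 s) * (?x * H1 t)) + III k t))"
        unfolding III_def using sub Q_measurable by (intro mult_left_mono addsD[OF F]) auto
      \<comment> \<open>For s > t the contribution of (0, t) to \<open>Q k' 0 s\<close> has a bound
        constant in s. Its outer norm is the second summand of \<open>ktil k t\<close>.\<close>
      also have "hnorm r1 {t<..} (\<lambda>s. ennreal (b1 s) * (?x * H1 t)) = (?x * H1 t) * T1 t"
        unfolding T1_def mult.commute[of "ennreal (b1 _)"]
        using x finite_lt_top[OF t] by (intro hnorm_cmult r1) (simp add: ennreal_mult_less_top)
      also have "(?x * H1 t) * T1 t = (T1 t * H1 t) * ?x" by (simp only: mult_ac)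
      also have "(ennreal E * c) * (ennreal F * ((T1 t * H1 t) * ?x + III k t)) \<le> (ennreal E * c) * (ennreal F * (ktil k t + III k t))"
        unfolding ktil_eq[OF t] by (intro mult_left_mono add_mono mult_right_mono) (auto simp: X_def)
      finally show "hnorm r1 {t<..} (\<lambda>s. ennreal (b1 s) * Q k' 0 s) \<le> ennreal E * c * ennreal F * (ktil k t + III k t)"
        by (simp only: mult.assoc)
    qed auto
    also have "\<dots> \<le> ennreal D * (c * (ktil k t + III k t) + ennreal E * c * ennreal F * (ktil k t + III k t))"
      by (intro mult_left_mono add_mono) auto
    finally show "N1 k' \<le> ennreal D * ?K * (ktil k t + III k t)"
      by (simp only: distrib_right mult.assoc)
  qed
qed

text \<open>With k, k0 and k1 the K-functionals of f and of its components in X0 and X1, this is the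
  lower half of the formula. After quasi-additivity of the three terms, the diagonal contributions
  are at most \<open>N0\<close> and \<open>N1\<close>, and the others are the two mixed
  estimates.\<close>

lemma I_II_III_le_sum:
  assumes c: "c < top"
  obtains K where "K < top"
    "\<And>k k0 k1 t. quasiconcave k \<Longrightarrow> quasiconcave k0 \<Longrightarrow> quasiconcave k1 \<Longrightarrow> 0 < t \<Longrightarrow> (\<And>u. 0 < u \<Longrightarrow> k u \<le> c * (k0 u + k1 u)) \<Longrightarrow>
      I k t + II k t + ennreal (\<rho> t) * III k t \<le> K * (N0 k0 + ennreal (\<rho> t) * N1 k1)"
proof -
  obtain A where A: "adds q0 a0 A" using hnorm_add_sv[OF q0 a0] by blast
  obtain B where B: "adds r0 b0 B" using hnorm_add_sv[OF r0 b0] by blast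
  obtain A1 where A1: "adds q1 a1 A1" using hnorm_add_sv[OF q1 a1] by blast
  obtain B1 where B1: "adds r1 b1 B1" using hnorm_add_sv[OF r1 b1] by blast
  obtain J where J: "J < top"
    "\<And>k t. quasiconcave k \<Longrightarrow> 0 < t \<Longrightarrow> I k t + II k t \<le> J * (ennreal (\<rho> t) * N1 k)"
    using I_II_le_N1 by blast
  obtain L where L: "L < top"
    "\<And>k t. quasiconcave k \<Longrightarrow> 0 < t \<Longrightarrow> ennreal (\<rho> t) * III k t \<le> L * N0 k"
    using III_le_N0 by blast
  let ?K1 = "c * ennreal A" and ?K2 = "c * ennreal A1"
  let ?M1 = "?K1 * ennreal B + ?K1" and ?M2 = "?K2 * ennreal B1"
  show ?thesis
  proof (rule that[of "?M1 * (2 + J) + ?M2 * (L + 1)"])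
    show "?M1 * (2 + J) + ?M2 * (L + 1) < top"
      using c J(1) L(1) by (simp add: ennreal_mult_less_top)
    fix k k0 k1 and t :: real
    assume k: "quasiconcave k" "quasiconcave k0" "quasiconcave k1" and t: "0 < t" and le: "\<And>u. 0 < u \<Longrightarrow> k u \<le> c * (k0 u + k1 u)"
    let ?\<rho> = "ennreal (\<rho> t)"
    have P: "P k s \<le> ?K1 * (P k0 s + P k1 s)" for s
    proof -
      have "P k s \<le> c * hnorm q0 {0<..<s} (\<lambda>u. ennreal (a0 u) * (ennreal (u powr (- \<theta>0)) * k0 u + ennreal (u powr (- \<theta>0)) * k1 u))"
        unfolding P_def
      proof (rule hnorm_le_cmult[OF q0 c])
        fix u assume "u \<in> {0<..<s}"
        then have "ennreal (a0 u) * (ennreal (u powr (- \<theta>0)) * k u) \<le>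
            ennreal (a0 u) * (ennreal (u powr (- \<theta>0)) * (c * (k0 u + k1 u)))"
          by (intro mult_left_mono le) auto
        also have "\<dots> = c * (ennreal (a0 u) * (ennreal (u powr (- \<theta>0)) * k0 u + ennreal (u powr (- \<theta>0)) * k1 u))"
          by (simp only: distrib_left mult_ac)
        finally show "ennreal (a0 u) * (ennreal (u powr (- \<theta>0)) * k u) \<le> \<dots>" .
      qed
      also have "\<dots> \<le> c * (ennreal A * (P k0 s + P k1 s))"
        unfolding P_def using quasiconcave_measurable[OF k(2)] quasiconcave_measurable[OF k(3)]
        by (intro mult_left_mono addsD[OF A]) (auto intro: borel_measurable_times_ennreal)
      finally show ?thesis by (simp only: mult.assoc)
    qed
    have Q: "Q k t s \<le> ?K2 * (Q k0 t s + Q k1 t s)" for s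
    proof -
      have "Q k t s \<le> c * hnorm q1 {t<..<s} (\<lambda>u. ennreal (a1 u) * (ennreal (u powr -1) * k0 u + ennreal (u powr -1) * k1 u))"
        unfolding Q_def
      proof (rule hnorm_le_cmult[OF q1 c])
        fix u assume "u \<in> {t<..<s}"
        then have "ennreal (a1 u) * (ennreal (u powr -1) * k u) \<le>
            ennreal (a1 u) * (ennreal (u powr -1) * (c * (k0 u + k1 u)))"
          using t by (intro mult_left_mono le) auto
        also have "\<dots> = c * (ennreal (a1 u) * (ennreal (u powr -1) * k0 u + ennreal (u powr -1) * k1 u))"
          by (simp only: distrib_left mult_ac)
        finally show "ennreal (a1 u) * (ennreal (u powr -1) * k u) \<le> \<dots>" .
      qed
      also have "\<dots> \<le> c * (ennreal A1 * (Q k0 t s + Q k1 t s))"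
        unfolding Q_def using quasiconcave_measurable[OF k(2)] quasiconcave_measurable[OF k(3)] t
        by (intro mult_left_mono addsD[OF A1]) (auto intro: borel_measurable_times_ennreal)
      finally show ?thesis by (simp only: mult.assoc)
    qed
    have "I k t \<le> ?K1 * hnorm r0 {0<..<t} (\<lambda>s. ennreal (b0 s) * (P k0 s + P k1 s))"
      unfolding I_def
    proof (rule hnorm_le_cmult[OF r0])
      show "?K1 < top" using c by (simp add: ennreal_mult_less_top)
      fix s
      have "ennreal (b0 s) * P k s \<le> ennreal (b0 s) * (?K1 * (P k0 s + P k1 s))" by (intro mult_left_mono P) auto
      then show "ennreal (b0 s) * P k s \<le> ?K1 * (ennreal (b0 s) * (P k0 s + P k1 s))" by (simp only: mult_ac)
    qed
    also have "\<dots> \<le> ?K1 * (ennreal B * (I k0 t + I k1 t))"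
      unfolding I_def using P_measurable by (intro mult_left_mono addsD[OF B]) auto
    finally have I: "I k t \<le> ?K1 * (ennreal B * (I k0 t + I k1 t))" .
    have "II k t \<le> T0 t * (?K1 * (P k0 t + P k1 t))" unfolding II_def by (intro mult_left_mono P) auto
    then have II: "II k t \<le> ?K1 * (II k0 t + II k1 t)" by (simp only: II_def distrib_left mult_ac)
    have "III k t \<le> ?K2 * hnorm r1 {t<..} (\<lambda>s. ennreal (b1 s) * (Q k0 t s + Q k1 t s))"
      unfolding III_def
    proof (rule hnorm_le_cmult[OF r1])
      show "?K2 < top" using c by (simp add: ennreal_mult_less_top)
      fix s
      have "ennreal (b1 s) * Q k t s \<le> ennreal (b1 s) * (?K2 * (Q k0 t s + Q k1 t s))" by (intro mult_left_mono Q) auto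
      then show "ennreal (b1 s) * Q k t s \<le> ?K2 * (ennreal (b1 s) * (Q k0 t s + Q k1 t s))" by (simp only: mult_ac)
    qed
    also have "\<dots> \<le> ?K2 * (ennreal B1 * (III k0 t + III k1 t))"
      unfolding III_def using Q_measurable t by (intro mult_left_mono addsD[OF B1]) auto
    finally have III: "III k t \<le> ?M2 * (III k0 t + III k1 t)" by (simp only: mult.assoc)
    let ?N = "N0 k0 + ?\<rho> * N1 k1"
    have i0: "I k0 t \<le> N0 k0" "II k0 t \<le> N0 k0" by (rule I_le_N0, rule II_le_N0[OF t])
    have i1: "I k1 t + II k1 t \<le> J * ?N"
      by (rule order_trans[OF J(2)[OF k(3) t]]) (intro mult_left_mono, auto)
    \<comment> \<open>The 2 counts \<open>I\<close> and \<open>II\<close> of the X0 part, and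
      \<open>J\<close> comes from the mixed estimate for the X1 part.\<close>
    have i2: "I k0 t + I k1 t + (II k0 t + II k1 t) \<le> (2 + J) * ?N"
    proof -
      have "I k0 t + I k1 t + (II k0 t + II k1 t) = (I k0 t + II k0 t) + (I k1 t + II k1 t)" by (simp only: add_ac)
      also have "\<dots> \<le> (?N + ?N) + J * ?N"
        using i0 i1 by (intro add_mono) (auto intro: add_increasing2)
      finally show ?thesis by (simp only: distrib_right mult_2)
    qed
    have "I k t + II k t \<le> ?M1 * (I k0 t + I k1 t) + ?M1 * (II k0 t + II k1 t)"
    proof (intro add_mono)
      show "I k t \<le> ?M1 * (I k0 t + I k1 t)"
        using I by (simp only: distrib_right mult.assoc) (erule add_increasing2[rotated], simp)
      show "II k t \<le> ?M1 * (II k0 t + II k1 t)"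
        using II by (simp only: distrib_right[of "?K1 * ennreal B"]) (erule add_increasing[rotated], simp)
    qed
    also have "\<dots> = ?M1 * (I k0 t + I k1 t + (II k0 t + II k1 t))" by (simp only: distrib_left)
    also have "\<dots> \<le> ?M1 * ((2 + J) * ?N)" by (intro mult_left_mono i2) auto
    finally have 1: "I k t + II k t \<le> ?M1 * ((2 + J) * ?N)" .
    have "?\<rho> * III k t \<le> ?\<rho> * (?M2 * (III k0 t + III k1 t))" by (intro mult_left_mono III) auto
    also have "\<dots> = ?M2 * (?\<rho> * III k0 t + ?\<rho> * III k1 t)" by (simp only: distrib_left mult_ac)
    also have "\<dots> \<le> ?M2 * (L * ?N + 1 * ?N)"
    proof (intro mult_left_mono add_mono)
      show "?\<rho> * III k0 t \<le> L * ?N"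
        by (rule order_trans[OF L(2)[OF k(2) t]]) (intro mult_left_mono, auto)
      have "?\<rho> * III k1 t \<le> ?\<rho> * N1 k1" by (intro mult_left_mono III_le_N1 t) auto
      then show "?\<rho> * III k1 t \<le> 1 * ?N" by (simp add: add_increasing)
    qed auto
    finally have 2: "?\<rho> * III k t \<le> ?M2 * ((L + 1) * ?N)" by (simp only: distrib_right)
    have "I k t + II k t + ?\<rho> * III k t \<le> ?M1 * ((2 + J) * ?N) + ?M2 * ((L + 1) * ?N)"
      by (rule add_mono[OF 1 2])
    then show "I k t + II k t + ?\<rho> * III k t \<le> (?M1 * (2 + J) + ?M2 * (L + 1)) * ?N"
      by (simp only: distrib_right mult.assoc)
  qed
qed

section \<open>The outer norm\<close>

text \<open>The weight \<open>u\<^bsup>-\<theta>\<^esup> a(u)\<close> after the substitution \<open>u = \<rho>(t)\<close>.\<close>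

definition w :: "real \<Rightarrow> (real \<Rightarrow> real) \<Rightarrow> real \<Rightarrow> real" where
  "w \<theta> a t = \<rho> t powr (- \<theta>) * a (\<rho> t)"

lemma sv_a_\<rho>: "sv a \<Longrightarrow> sv (\<lambda>t. a (\<rho> t))"
  using sv_comp[OF _ sv_\<phi>, of a \<rho> "1 - \<theta>0"] by (simp add: \<rho>_def)

lemma \<rho>_powr: "0 < t \<Longrightarrow> \<rho> t powr x = t powr ((1 - \<theta>0) * x) * \<phi> t powr x"
  using sv_pos[OF sv_\<phi>, of t] by (simp add: \<rho>_def powr_mult powr_powr)

lemma w_pos: "sv a \<Longrightarrow> 0 < t \<Longrightarrow> 0 < w \<theta> a t"
  using \<rho>_pos[of t] sv_pos[of a "\<rho> t"] by (simp add: w_def)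

lemma w_tame:
  assumes "sv a"
  obtains C n where "0 < (C :: real)" "0 \<le> n" "tame C n (\<lambda>t. ennreal (w \<theta> a t))"
proof -
  have "sv (\<lambda>t. \<phi> t powr (- \<theta>) * a (\<rho> t))" by (intro sv_mult sv_powr sv_\<phi> sv_a_\<rho> assms)
  then obtain C where C: "0 < C" "tame C 1 (\<lambda>t. ennreal (\<phi> t powr (- \<theta>) * a (\<rho> t)))"
    using sv_tame by blast
  have "tame (1 * C) (\<bar>(1 - \<theta>0) * (- \<theta>)\<bar> + 1) (\<lambda>t. ennreal (w \<theta> a t))"
  proof (rule tame_cong)
    show "tame (1 * C) (\<bar>(1 - \<theta>0) * (- \<theta>)\<bar> + 1)
        (\<lambda>t. ennreal (t powr ((1 - \<theta>0) * (- \<theta>))) * ennreal (\<phi> t powr (- \<theta>) * a (\<rho> t)))"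
      using C by (intro tame_mult tame_powr) auto
    fix t :: real assume "0 < t"
    show "ennreal (w \<theta> a t) = ennreal (t powr ((1 - \<theta>0) * (- \<theta>))) * ennreal (\<phi> t powr (- \<theta>) * a (\<rho> t))"
      unfolding w_def \<rho>_powr[OF \<open>0 < t\<close>] ennreal_mult'[OF powr_ge_zero, symmetric] mult.assoc by (rule refl)
  qed
  then show ?thesis using C(1) by (intro that) auto
qed

lemma w_khat_tame:
  assumes "sv a"
  obtains C n where "0 < (C :: real)" "0 \<le> n" "\<And>k. quasiconcave k \<Longrightarrow> tame C n (\<lambda>t. ennreal (w \<theta> a t) * khat k t)"
proof -
  obtain C n where C: "0 < (C :: real)" "0 \<le> n" "tame C n (\<lambda>t. ennreal (w \<theta> a t))"
    using w_tame[OF assms] by blast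
  obtain D where D: "0 < D" "tame D 1 (\<lambda>t. ennreal (\<chi>0 t))" using sv_tame[OF sv_\<chi>0] by blast
  show ?thesis
  proof (rule that[of "C * (D * (1 * 1))" "n + (1 + (\<bar>- \<theta>0\<bar> + 1))"])
    fix k assume k: "quasiconcave k"
    have "tame (D * (1 * 1)) (1 + (\<bar>- \<theta>0\<bar> + 1)) (khat k)"
    proof (rule tame_cong)
      show "tame (D * (1 * 1)) (1 + (\<bar>- \<theta>0\<bar> + 1)) (\<lambda>t. ennreal (\<chi>0 t) * (ennreal (t powr (- \<theta>0)) * k t))"
        using D by (intro tame_mult tame_powr quasiconcave_tame k) auto
    qed (simp add: khat_def ennreal_mult'' mult.assoc)
    then show "tame (C * (D * (1 * 1))) (n + (1 + (\<bar>- \<theta>0\<bar> + 1))) (\<lambda>t. ennreal (w \<theta> a t) * khat k t)"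
      using C D by (intro tame_mult) auto
  qed (use C D in auto)
qed

text \<open>Reduces a norm estimate to a pointwise one: once F lies below a supremum of the weighted
  \<open>khat\<close> against a decaying kernel, the discrete Hardy inequality applies. No
  measurability of F enters.\<close>

lemma hnorm_w_sup:
  assumes "sv a" "0 < r" "0 < d" "c < top"
  obtains K where "K < top"
    "\<And>k F. quasiconcave k \<Longrightarrow> (\<And>t. 0 < t \<Longrightarrow> F t \<le> c * (SUP u\<in>{0<..}. ennreal (dil (- d) u t) * (ennreal (w \<theta> a u) * khat k u))) \<Longrightarrow>
      hnorm r {0<..} F \<le> K * hnorm r {0<..} (\<lambda>t. ennreal (w \<theta> a t) * khat k t)"
proof -
  obtain C n where C: "0 < (C :: real)" "0 \<le> n" "\<And>k. quasiconcave k \<Longrightarrow> tame C n (\<lambda>t. ennreal (w \<theta> a t) * khat k t)"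
    using w_khat_tame[OF assms(1)] by blast
  obtain K where K: "0 < K" "\<And>G. tame C n G \<Longrightarrow>
      hnorm r {0<..} (\<lambda>t. SUP u\<in>{0<..}. ennreal (dil (- d) u t) * G u) \<le> ennreal K * hnorm r {0<..} G"
    using hnorm_supconv[OF assms(2,3) less_imp_le[OF C(1)] C(2)] by blast
  show ?thesis
  proof (rule that[of "c * ennreal K"])
    show "c * ennreal K < top" using assms(4) by (simp add: ennreal_mult_less_top)
    fix k F assume k: "quasiconcave k" and F: "\<And>t. 0 < t \<Longrightarrow> F t \<le> c * (SUP u\<in>{0<..}. ennreal (dil (- d) u t) * (ennreal (w \<theta> a u) * khat k u))"
    have "hnorm r {0<..} F \<le> c * hnorm r {0<..} (\<lambda>t. SUP u\<in>{0<..}. ennreal (dil (- d) u t) * (ennreal (w \<theta> a u) * khat k u))"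
      by (rule hnorm_le_cmult[OF assms(2,4)]) (use F in auto)
    also have "\<dots> \<le> c * (ennreal K * hnorm r {0<..} (\<lambda>t. ennreal (w \<theta> a t) * khat k t))"
      by (intro mult_left_mono K(2) C(3) k) auto
    finally show "hnorm r {0<..} F \<le> c * ennreal K * hnorm r {0<..} (\<lambda>t. ennreal (w \<theta> a t) * khat k t)"
      by (simp only: mult.assoc)
  qed
qed

text \<open>For \<theta> > 0 the weight \<open>w \<theta> a\<close> decays like t^(-\<alpha>) up to
  slow variation. Half of \<alpha> absorbs that variation, a quarter pays for the Hardy type
  estimate, and the last quarter is the decay of the kernel.\<close>

lemma hnorm_I_II_le:
  assumes "sv a" "0 < r" "0 < \<theta>"
  obtains K where "K < top"
    "\<And>k. quasiconcave k \<Longrightarrow> hnorm r {0<..} (\<lambda>t. ennreal (w \<theta> a t) * (I k t + II k t)) \<le>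
      K * hnorm r {0<..} (\<lambda>t. ennreal (w \<theta> a t) * khat k t)"
proof -
  define \<alpha> where "\<alpha> = (1 - \<theta>0) * \<theta>"
  have \<alpha>: "0 < \<alpha>" "0 < \<alpha> / 4" using assms \<theta>0 by (auto simp: \<alpha>_def)
  have w: "w \<theta> a t = t powr (- \<alpha>) * (\<phi> t powr (- \<theta>) * a (\<rho> t))" if "0 < t" for t
    using that by (simp add: w_def \<rho>_powr \<alpha>_def)
  have "sv (\<lambda>t. \<phi> t powr (- \<theta>) * a (\<rho> t))" by (intro sv_mult sv_powr sv_\<phi> sv_a_\<rho> assms)
  then obtain C where "0 < C" and C': "\<And>s t. 0 < s \<Longrightarrow> s \<le> t \<Longrightarrow>
      t powr (- \<alpha>) * (\<phi> t powr (- \<theta>) * a (\<rho> t)) \<le>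
      C * dil (- (\<alpha> / 2)) s t * (s powr (- \<alpha>) * (\<phi> s powr (- \<theta>) * a (\<rho> s)))"
    by (rule powr_sv_decay[OF _ \<alpha>(1)]) (rule that, assumption, blast)
  have C: "0 < C" "\<And>s t. 0 < s \<Longrightarrow> s \<le> t \<Longrightarrow> w \<theta> a t \<le> C * dil (- (\<alpha> / 2)) s t * w \<theta> a s"
    using \<open>0 < C\<close> C' by (simp_all only: w less_le_trans)
  obtain J where J: "J < top"
    "\<And>k t. quasiconcave k \<Longrightarrow> 0 < t \<Longrightarrow> I k t + II k t \<le> J * (SUP u\<in>{0<..t}. ennreal (dil (\<alpha> / 4) u t) * khat k u)"
    using I_II_le_sup[OF \<alpha>(2)] by blast
  have "J * ennreal C < top" using J(1) by (simp add: ennreal_mult_less_top)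
  then obtain K where K: "K < top"
    "\<And>k F. quasiconcave k \<Longrightarrow> (\<And>t. 0 < t \<Longrightarrow> F t \<le> J * ennreal C * (SUP u\<in>{0<..}. ennreal (dil (- (\<alpha> / 4)) u t) * (ennreal (w \<theta> a u) * khat k u))) \<Longrightarrow>
      hnorm r {0<..} F \<le> K * hnorm r {0<..} (\<lambda>t. ennreal (w \<theta> a t) * khat k t)"
    using hnorm_w_sup[OF assms(1,2) \<alpha>(2)] by blast
  show ?thesis
  proof (rule that[OF K(1)], rule K(2))
    fix k and t :: real assume k: "quasiconcave k" and t: "0 < t"
    let ?S = "SUP u\<in>{0<..}. ennreal (dil (- (\<alpha> / 4)) u t) * (ennreal (w \<theta> a u) * khat k u)"
    have "ennreal (w \<theta> a t) * (SUP u\<in>{0<..t}. ennreal (dil (\<alpha> / 4) u t) * khat k u) \<le> ennreal C * ?S"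
      unfolding SUP_mult_left_ennreal[of "ennreal (w \<theta> a t)"]
    proof (rule SUP_least)
      fix u assume u: "u \<in> {0<..t}"
      have "w \<theta> a t * dil (\<alpha> / 4) u t \<le> (C * dil (- (\<alpha> / 2)) u t * w \<theta> a u) * dil (\<alpha> / 4) u t"
        using u by (intro mult_right_mono C(2)) auto
      also have "\<dots> = C * ((dil (- (\<alpha> / 2)) u t * dil (\<alpha> / 4) u t) * w \<theta> a u)" by (simp only: mult_ac)
      also have "dil (- (\<alpha> / 2)) u t * dil (\<alpha> / 4) u t = dil (- (\<alpha> / 4)) u t" by (simp add: dil_mult)
      finally have "ennreal (w \<theta> a t) * ennreal (dil (\<alpha> / 4) u t) \<le> ennreal C * (ennreal (dil (- (\<alpha> / 4)) u t) * ennreal (w \<theta> a u))"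
        using C(1) w_pos[OF assms(1) t] w_pos[OF assms(1), of u] u
        by (simp add: ennreal_mult[symmetric] less_imp_le ennreal_leI)
      then have "ennreal (w \<theta> a t) * (ennreal (dil (\<alpha> / 4) u t) * khat k u) \<le>
          ennreal C * (ennreal (dil (- (\<alpha> / 4)) u t) * (ennreal (w \<theta> a u) * khat k u))"
        using mult_right_mono[of _ _ "khat k u"] by (simp only: mult.assoc[symmetric] zero_le)
      also have "\<dots> \<le> ennreal C * ?S" using u by (intro mult_left_mono SUP_upper) auto
      finally show "ennreal (w \<theta> a t) * (ennreal (dil (\<alpha> / 4) u t) * khat k u) \<le> ennreal C * ?S" .
    qed
    then have "J * (ennreal (w \<theta> a t) * (SUP u\<in>{0<..t}. ennreal (dil (\<alpha> / 4) u t) * khat k u)) \<le> J * (ennreal C * ?S)"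
      by (rule mult_left_mono) simp
    moreover have "ennreal (w \<theta> a t) * (I k t + II k t) \<le>
        ennreal (w \<theta> a t) * (J * (SUP u\<in>{0<..t}. ennreal (dil (\<alpha> / 4) u t) * khat k u))"
      by (intro mult_left_mono J(2) k t) auto
    ultimately show "ennreal (w \<theta> a t) * (I k t + II k t) \<le> J * ennreal C * ?S"
      by (simp only: mult_ac)
  qed
qed

text \<open>The mirror image of \<open>hnorm_I_II_le\<close>: for \<theta> < 1 the product of
  \<open>w \<theta> a\<close> with \<open>\<rho>\<close> grows like t^\<alpha>, and \<alpha> is
  distributed in the same proportions.\<close>

lemma hnorm_III_le:
  assumes "sv a" "0 < r" "\<theta> < 1"
  obtains K where "K < top"
    "\<And>k. quasiconcave k \<Longrightarrow> hnorm r {0<..} (\<lambda>t. ennreal (w \<theta> a t) * (ennreal (\<rho> t) * III k t)) \<le>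
      K * hnorm r {0<..} (\<lambda>t. ennreal (w \<theta> a t) * khat k t)"
proof -
  define \<alpha> where "\<alpha> = (1 - \<theta>0) * (1 - \<theta>)"
  have \<alpha>: "0 < \<alpha>" "0 < \<alpha> / 4" using assms \<theta>0 by (auto simp: \<alpha>_def)
  have w: "w \<theta> a t * \<rho> t = t powr \<alpha> * (\<phi> t powr (1 - \<theta>) * a (\<rho> t))" if "0 < t" for t
  proof -
    have "\<rho> t powr (- \<theta>) * \<rho> t = \<rho> t powr (1 - \<theta>)"
      using \<rho>_pos[OF that] by (simp add: powr_diff powr_minus_divide)
    then have "w \<theta> a t * \<rho> t = \<rho> t powr (1 - \<theta>) * a (\<rho> t)" by (simp add: w_def mult_ac)
    then show ?thesis using that by (simp add: \<rho>_powr \<alpha>_def)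
  qed
  have "sv (\<lambda>t. \<phi> t powr (1 - \<theta>) * a (\<rho> t))" by (intro sv_mult sv_powr sv_\<phi> sv_a_\<rho> assms)
  then obtain C where "0 < C" and C': "\<And>s t. 0 < s \<Longrightarrow> s \<le> t \<Longrightarrow>
      s powr \<alpha> * (\<phi> s powr (1 - \<theta>) * a (\<rho> s)) \<le>
      C * dil (- (\<alpha> / 2)) s t * (t powr \<alpha> * (\<phi> t powr (1 - \<theta>) * a (\<rho> t)))"
    by (rule powr_sv_decay[OF _ \<alpha>(1)]) (rule that, assumption, blast)
  have C: "0 < C" "\<And>s t. 0 < s \<Longrightarrow> s \<le> t \<Longrightarrow> w \<theta> a s * \<rho> s \<le> C * dil (- (\<alpha> / 2)) s t * (w \<theta> a t * \<rho> t)"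
    using \<open>0 < C\<close> C' by (simp_all only: w less_le_trans)
  obtain J where J: "J < top"
    "\<And>k t. quasiconcave k \<Longrightarrow> 0 < t \<Longrightarrow> III k t \<le> J * (SUP u\<in>{t..}. ennreal (dil (\<alpha> / 4) u t) * ktil k u)"
    using III_le_sup[OF \<alpha>(2)] by blast
  have "J * ennreal C < top" using J(1) by (simp add: ennreal_mult_less_top)
  then obtain K where K: "K < top"
    "\<And>k F. quasiconcave k \<Longrightarrow> (\<And>t. 0 < t \<Longrightarrow> F t \<le> J * ennreal C * (SUP u\<in>{0<..}. ennreal (dil (- (\<alpha> / 4)) u t) * (ennreal (w \<theta> a u) * khat k u))) \<Longrightarrow>
      hnorm r {0<..} F \<le> K * hnorm r {0<..} (\<lambda>t. ennreal (w \<theta> a t) * khat k t)"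
    using hnorm_w_sup[OF assms(1,2) \<alpha>(2)] by blast
  show ?thesis
  proof (rule that[OF K(1)], rule K(2))
    fix k and t :: real assume k: "quasiconcave k" and t: "0 < t"
    let ?S = "SUP u\<in>{0<..}. ennreal (dil (- (\<alpha> / 4)) u t) * (ennreal (w \<theta> a u) * khat k u)"
    let ?v = "ennreal (w \<theta> a t) * ennreal (\<rho> t)"
    have "?v * (SUP u\<in>{t..}. ennreal (dil (\<alpha> / 4) u t) * ktil k u) \<le> ennreal C * ?S"
      unfolding SUP_mult_left_ennreal[of ?v]
    proof (rule SUP_least)
      fix u assume u: "u \<in> {t..}"
      then have u0: "0 < u" using t by simp
      have "w \<theta> a t * \<rho> t * dil (\<alpha> / 4) u t \<le> (C * dil (- (\<alpha> / 2)) t u * (w \<theta> a u * \<rho> u)) * dil (\<alpha> / 4) u t"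
        using u t by (intro mult_right_mono C(2)) auto
      also have "\<dots> = C * ((dil (- (\<alpha> / 2)) u t * dil (\<alpha> / 4) u t) * (w \<theta> a u * \<rho> u))"
        by (simp only: dil_commute[of _ t u] mult_ac)
      also have "dil (- (\<alpha> / 2)) u t * dil (\<alpha> / 4) u t = dil (- (\<alpha> / 4)) u t" by (simp add: dil_mult)
      finally have "?v * ennreal (dil (\<alpha> / 4) u t) \<le> ennreal C * (ennreal (dil (- (\<alpha> / 4)) u t) * (ennreal (w \<theta> a u) * ennreal (\<rho> u)))"
        using C(1) w_pos[OF assms(1) t] w_pos[OF assms(1) u0] \<rho>_pos[OF t] \<rho>_pos[OF u0]
        by (simp add: ennreal_mult[symmetric] less_imp_le ennreal_leI)
      then have "?v * ennreal (dil (\<alpha> / 4) u t) * ktil k u \<le>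
          ennreal C * (ennreal (dil (- (\<alpha> / 4)) u t) * (ennreal (w \<theta> a u) * ennreal (\<rho> u))) * ktil k u"
        by (rule mult_right_mono) simp
      then have "?v * (ennreal (dil (\<alpha> / 4) u t) * ktil k u) \<le>
          ennreal C * (ennreal (dil (- (\<alpha> / 4)) u t) * (ennreal (w \<theta> a u) * khat k u))"
        by (simp only: mult.assoc khat_ktil[OF u0])
      also have "\<dots> \<le> ennreal C * ?S" using u0 by (intro mult_left_mono SUP_upper) auto
      finally show "?v * (ennreal (dil (\<alpha> / 4) u t) * ktil k u) \<le> ennreal C * ?S" .
    qed
    then have "J * (?v * (SUP u\<in>{t..}. ennreal (dil (\<alpha> / 4) u t) * ktil k u)) \<le> J * (ennreal C * ?S)"
      by (rule mult_left_mono) simp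
    moreover have "?v * III k t \<le> ?v * (J * (SUP u\<in>{t..}. ennreal (dil (\<alpha> / 4) u t) * ktil k u))"
      by (intro mult_left_mono J(2) k t) auto
    ultimately show "ennreal (w \<theta> a t) * (ennreal (\<rho> t) * III k t) \<le> J * ennreal C * ?S"
      by (simp only: mult_ac)
  qed
qed

end

section \<open>The K-functional\<close>

text \<open>A zero factor must be excluded, since it would annihilate the infinite infimum of the
  empty set. This is why constants are enlarged by 1 before a bound is passed to a
  K-functional.\<close>

lemma ennreal_le_mult_Inf:
  fixes Z C :: ennreal
  assumes "C \<noteq> 0" "C < top" "\<And>z. z \<in> S \<Longrightarrow> Z \<le> C * z"
  shows "Z \<le> C * Inf S"
proof -
  have CC: "inverse C * C = 1" "C * inverse C = 1"
    using assms ennreal_divide_self[of C] by (simp_all add: divide_ennreal_def mult.commute)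
  have "inverse C * Z \<le> Inf S"
  proof (rule Inf_greatest)
    fix z assume "z \<in> S"
    then have "inverse C * Z \<le> inverse C * (C * z)" by (intro mult_left_mono assms) auto
    then show "inverse C * Z \<le> z" by (simp only: mult.assoc[symmetric] CC mult_1)
  qed
  then have "C * (inverse C * Z) \<le> C * Inf S" by (rule mult_left_mono) simp
  then show ?thesis by (simp only: mult.assoc[symmetric] CC mult_1)
qed

lemma Kfun_le: "x \<in> carr X \<Longrightarrow> y \<in> carr Y \<Longrightarrow> Kfun t (x + y) X Y \<le> qnorm X x + ennreal t * qnorm Y y"
  unfolding Kfun_def by (intro Inf_lower) blast

lemma Kfun_greatest:
  assumes "\<And>x y. x \<in> carr X \<Longrightarrow> y \<in> carr Y \<Longrightarrow> f = x + y \<Longrightarrow> Z \<le> qnorm X x + ennreal t * qnorm Y y"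
  shows "Z \<le> Kfun t f X Y"
  unfolding Kfun_def by (intro Inf_greatest) (use assms in blast)

lemma Kfun_eq_top: "f \<notin> sum_carr X Y \<Longrightarrow> Kfun t f X Y = top"
  using Kfun_greatest[of X Y f top t] by (auto simp: sum_carr_def top_unique)

lemma Kfun_quasiconcave: "quasiconcave (\<lambda>t. Kfun t f X Y)"
  unfolding quasiconcave_def
proof (intro conjI allI impI monoI)
  show "Kfun s f X Y \<le> Kfun t f X Y" if "s \<le> t" for s t
  proof (rule Kfun_greatest)
    fix x y assume "x \<in> carr X" "y \<in> carr Y" "f = x + y"
    then have "Kfun s f X Y \<le> qnorm X x + ennreal s * qnorm Y y" using Kfun_le by blast
    also have "\<dots> \<le> qnorm X x + ennreal t * qnorm Y y"
      using that by (intro add_left_mono mult_right_mono ennreal_leI) auto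
    finally show "Kfun s f X Y \<le> qnorm X x + ennreal t * qnorm Y y" .
  qed
  fix s t :: real assume st: "0 < s" "s \<le> t"
  have ts: "ennreal (t / s) * ennreal s = ennreal t"
    using st by (simp add: ennreal_mult[symmetric])
  show "Kfun t f X Y \<le> ennreal (t / s) * Kfun s f X Y"
    unfolding Kfun_def[of s]
  proof (rule ennreal_le_mult_Inf)
    show "ennreal (t / s) \<noteq> 0" using st by simp
    fix z assume "z \<in> {qnorm X x + ennreal s * qnorm Y y |x y. x \<in> carr X \<and> y \<in> carr Y \<and> f = x + y}"
    then obtain x y where xy: "z = qnorm X x + ennreal s * qnorm Y y" "x \<in> carr X" "y \<in> carr Y" "f = x + y"
      by blast
    then have "Kfun t f X Y \<le> 1 * qnorm X x + ennreal t * qnorm Y y" using Kfun_le[of x X y Y t] by simp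
    also have "\<dots> \<le> ennreal (t / s) * qnorm X x + ennreal t * qnorm Y y"
      using st by (intro add_right_mono mult_right_mono) auto
    also have "\<dots> = ennreal (t / s) * z" unfolding xy(1) distrib_left mult.assoc[symmetric] ts ..
    finally show "Kfun t f X Y \<le> ennreal (t / s) * z" .
  qed simp
qed

section \<open>Decompositions in a compatible couple of quasi-Banach spaces\<close>

locale couple =
  fixes A0 A1 :: "'a::hausdorff_tvs qspace"
  assumes compat: "compatible_couple A0 A1"
begin

lemma quasi_normed: "quasi_normed A0" "quasi_normed A1"
  using compat by (auto simp: compatible_couple_def quasi_banach_def)

lemma subspaces: "subspace (carr A0)" "subspace (carr A1)"
  using quasi_normed by (auto simp: quasi_normed_def)

lemma zero_carr [simp]: "0 \<in> carr A0" "0 \<in> carr A1"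
  using subspaces subspace_0 by auto

lemma qnorm_zero [simp]: "qnorm A0 0 = 0" "qnorm A1 0 = 0"
  using quasi_normed zero_carr by (simp_all add: quasi_normed_def)

lemma qnorm_finite: "x \<in> carr A0 \<Longrightarrow> qnorm A0 x < top" "x \<in> carr A1 \<Longrightarrow> qnorm A1 x < top"
  using quasi_normed by (simp_all add: quasi_normed_def)

lemma qnorm_uminus: "x \<in> carr A0 \<Longrightarrow> qnorm A0 (- x) = qnorm A0 x" "x \<in> carr A1 \<Longrightarrow> qnorm A1 (- x) = qnorm A1 x"
proof -
  have "\<forall>c. \<forall>x\<in>carr A0. qnorm A0 (c *\<^sub>R x) = ennreal \<bar>c\<bar> * qnorm A0 x"
    "\<forall>c. \<forall>x\<in>carr A1. qnorm A1 (c *\<^sub>R x) = ennreal \<bar>c\<bar> * qnorm A1 x"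
    using quasi_normed by (simp_all add: quasi_normed_def)
  from this[THEN spec, of "-1"] show "x \<in> carr A0 \<Longrightarrow> qnorm A0 (- x) = qnorm A0 x" "x \<in> carr A1 \<Longrightarrow> qnorm A1 (- x) = qnorm A1 x"
    by simp_all
qed

lemma Kfun_finite: "f \<in> sum_carr A0 A1 \<Longrightarrow> Kfun t f A0 A1 < top"
proof -
  assume "f \<in> sum_carr A0 A1"
  then obtain x y where xy: "f = x + y" "x \<in> carr A0" "y \<in> carr A1" by (auto simp: sum_carr_def)
  then have "Kfun t f A0 A1 \<le> qnorm A0 x + ennreal t * qnorm A1 y" using Kfun_le by blast
  also have "\<dots> < top" using qnorm_finite xy by (simp add: ennreal_mult_less_top)
  finally show ?thesis .
qed

lemma Kfun_le_qnorm0: "x \<in> carr A0 \<Longrightarrow> Kfun t x A0 A1 \<le> qnorm A0 x"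
  using Kfun_le[of x A0 0 A1 t] by simp

lemma Kfun_le_qnorm1: "y \<in> carr A1 \<Longrightarrow> Kfun t y A0 A1 \<le> ennreal t * qnorm A1 y"
  using Kfun_le[of 0 A0 y A1 t] by simp

lemma Kfun_add:
  obtains C where "1 \<le> C" "C < top"
    "\<And>u f g. Kfun u (f + g) A0 A1 \<le> C * (Kfun u f A0 A1 + Kfun u g A0 A1)"
proof -
  have "\<exists>C::real. \<forall>x\<in>carr A0. \<forall>y\<in>carr A0. qnorm A0 (x + y) \<le> ennreal C * (qnorm A0 x + qnorm A0 y)"
    using quasi_normed(1) by (simp add: quasi_normed_def)
  then obtain C0 :: real where C0: "\<And>x y. x \<in> carr A0 \<Longrightarrow> y \<in> carr A0 \<Longrightarrow> qnorm A0 (x + y) \<le> ennreal C0 * (qnorm A0 x + qnorm A0 y)"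
    by blast
  have "\<exists>C::real. \<forall>x\<in>carr A1. \<forall>y\<in>carr A1. qnorm A1 (x + y) \<le> ennreal C * (qnorm A1 x + qnorm A1 y)"
    using quasi_normed(2) by (simp add: quasi_normed_def)
  then obtain C1 :: real where C1: "\<And>x y. x \<in> carr A1 \<Longrightarrow> y \<in> carr A1 \<Longrightarrow> qnorm A1 (x + y) \<le> ennreal C1 * (qnorm A1 x + qnorm A1 y)"
    by blast
  \<comment> \<open>The 1 makes \<open>C\<close> invertible, whatever the sign of the given
    constants, and at least 1.\<close>
  define C where "C = ennreal C0 + ennreal C1 + 1"
  have C: "1 \<le> C" "C < top" "ennreal C0 \<le> C" "ennreal C1 \<le> C" "C \<noteq> 0"
    by (auto simp: C_def add_increasing add_increasing2)
  show ?thesis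
  proof (rule that[OF C(1,2)])
    fix u f g
    let ?S = "\<lambda>f. {qnorm A0 x + ennreal u * qnorm A1 y |x y. x \<in> carr A0 \<and> y \<in> carr A1 \<and> f = x + y}"
    have le: "Kfun u (f + g) A0 A1 \<le> C * (a + b)" if ab: "a \<in> ?S f" "b \<in> ?S g" for a b
    proof -
      obtain x y where xy: "x \<in> carr A0" "y \<in> carr A1" "f = x + y" "a = qnorm A0 x + ennreal u * qnorm A1 y"
        using ab(1) by blast
      obtain x' y' where xy': "x' \<in> carr A0" "y' \<in> carr A1" "g = x' + y'" "b = qnorm A0 x' + ennreal u * qnorm A1 y'"
        using ab(2) by blast
      have fg: "f + g = (x + x') + (y + y')" using xy xy' by (simp add: algebra_simps)
      have "Kfun u (f + g) A0 A1 \<le> qnorm A0 (x + x') + ennreal u * qnorm A1 (y + y')"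
        unfolding fg by (intro Kfun_le subspace_add subspaces xy(1,2) xy'(1,2))
      also have "\<dots> \<le> C * (qnorm A0 x + qnorm A0 x') + ennreal u * (C * (qnorm A1 y + qnorm A1 y'))"
        using C xy xy' by (intro add_mono mult_left_mono order_trans[OF C0] order_trans[OF C1] mult_right_mono) auto
      also have "\<dots> = C * (a + b)" unfolding xy(4) xy'(4) by (simp only: distrib_left mult_ac add_ac)
      finally show ?thesis .
    qed
    have CC: "inverse C * C = 1" "C * inverse C = 1"
      using C ennreal_divide_self[of C] by (simp_all add: divide_ennreal_def mult.commute)
    have "inverse C * Kfun u (f + g) A0 A1 \<le> Inf (?S f) + Inf (?S g)"
    proof (rule ennreal_le_Inf_add)
      fix a b assume "a \<in> ?S f" "b \<in> ?S g"
      then have "inverse C * Kfun u (f + g) A0 A1 \<le> inverse C * (C * (a + b))"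
        by (intro mult_left_mono le) auto
      then show "inverse C * Kfun u (f + g) A0 A1 \<le> a + b" by (simp only: mult.assoc[symmetric] CC mult_1)
    qed
    then have "C * (inverse C * Kfun u (f + g) A0 A1) \<le> C * (Kfun u f A0 A1 + Kfun u g A0 A1)"
      unfolding Kfun_def[of u f] Kfun_def[of u g] by (rule mult_left_mono) simp
    then show "Kfun u (f + g) A0 A1 \<le> C * (Kfun u f A0 A1 + Kfun u g A0 A1)"
      by (simp only: mult.assoc[symmetric] CC mult_1)
  qed
qed

text \<open>The Hausdorff property of the ambient space enters here. If f had decompositions of
  arbitrarily small cost, both parts would lie in small neighbourhoods of 0, and by continuity of
  addition so would f.\<close>

lemma Kfun_eq_0:
  assumes "0 < t" "Kfun t f A0 A1 = 0"
  shows "f = 0"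
proof (rule ccontr)
  assume "f \<noteq> 0"
  from hausdorff[OF this] obtain U V where UV: "open U" "open V" "f \<in> U" "0 \<in> V" "U \<inter> V = {}"
    by (elim exE conjE)
  have "LIM p (nhds (0::'a) \<times>\<^sub>F nhds 0). fst p + snd p :> nhds (0 + 0)"
    by (rule tendsto_add_Pair)
  moreover have "eventually (\<lambda>x. x \<in> V) (nhds (0 + 0))"
    using UV by (auto simp: eventually_nhds)
  ultimately have "eventually (\<lambda>p. fst p + snd p \<in> V) (nhds (0::'a) \<times>\<^sub>F nhds 0)"
    unfolding filterlim_iff by blast
  then obtain Pf Pg where Pfg: "eventually Pf (nhds (0::'a))" "eventually Pg (nhds (0::'a))"
    "\<And>x y. Pf x \<Longrightarrow> Pg y \<Longrightarrow> x + y \<in> V"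
    unfolding eventually_prod_filter by auto
  from Pfg(1) obtain W where W: "open W" "0 \<in> W" "\<forall>x\<in>W. Pf x"
    unfolding eventually_nhds by (elim exE conjE)
  from Pfg(2) obtain W' where W': "open W'" "0 \<in> W'" "\<forall>x\<in>W'. Pg x"
    unfolding eventually_nhds by (elim exE conjE)
  have "embedded_in_ambient A0" "embedded_in_ambient A1"
    using compat by (simp_all add: compatible_couple_def)
  then have "\<exists>e>0. \<forall>x\<in>carr A0. qnorm A0 x < e \<longrightarrow> x \<in> W" "\<exists>e>0. \<forall>x\<in>carr A1. qnorm A1 x < e \<longrightarrow> x \<in> W'"
    unfolding embedded_in_ambient_def using W W' by simp_all
  then obtain e e' where e: "0 < e" "\<forall>x\<in>carr A0. qnorm A0 x < e \<longrightarrow> x \<in> W"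
      and e': "0 < e'" "\<forall>x\<in>carr A1. qnorm A1 x < e' \<longrightarrow> x \<in> W'"
    by (elim exE conjE)
  have "Kfun t f A0 A1 < min e (ennreal t * e')"
    using assms e(1) e'(1) by (simp add: ennreal_zero_less_mult_iff)
  then obtain x y where xy: "x \<in> carr A0" "y \<in> carr A1" "f = x + y"
      "qnorm A0 x + ennreal t * qnorm A1 y < min e (ennreal t * e')"
    unfolding Kfun_def Inf_less_iff by blast
  have "qnorm A0 x \<le> qnorm A0 x + ennreal t * qnorm A1 y" by simp
  also have "\<dots> < e" using xy(4) by simp
  finally have "x \<in> W" using e(2) xy(1) by blast
  have "ennreal t * qnorm A1 y \<le> qnorm A0 x + ennreal t * qnorm A1 y" by simp
  also have "\<dots> < ennreal t * e'" using xy(4) by simp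
  finally have "qnorm A1 y < e'"
    using mult_left_mono[of e' "qnorm A1 y" "ennreal t"] by (meson leD leI zero_le)
  then have "y \<in> W'" using e'(2) xy(2) by blast
  then have "x + y \<in> V" using W(3) W'(3) \<open>x \<in> W\<close> by (intro Pfg(3)) simp_all
  then show False using UV(3,5) xy(3) by auto
qed

text \<open>The infimum need not be attained, and the factor 2 leaves room only if K is positive and
  finite. If K is 0 the cost must be 0, which is possible because then f = 0.\<close>

lemma near_optimal_decomposition:
  assumes "f \<in> sum_carr A0 A1" "0 < t"
  obtains x y where "x \<in> carr A0" "y \<in> carr A1" "f = x + y"
    "qnorm A0 x + ennreal t * qnorm A1 y \<le> 2 * Kfun t f A0 A1"
proof (cases "Kfun t f A0 A1 = 0")
  case True
  then have "f = 0" using Kfun_eq_0 assms by blast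
  then show ?thesis by (intro that[of 0 0]) auto
next
  case False
  obtain r where r: "0 \<le> r" "Kfun t f A0 A1 = ennreal r"
    using Kfun_finite[OF assms(1), of t] less_top_ennreal by blast
  have "ennreal r < ennreal (2 * r)" using False r by (intro ennreal_lessI) auto
  then have less: "Kfun t f A0 A1 < 2 * Kfun t f A0 A1"
    using r(2) ennreal_mult'[of 2 r] by simp
  show ?thesis
  proof (rule ccontr)
    assume n: "\<not> thesis"
    have "2 * Kfun t f A0 A1 \<le> Kfun t f A0 A1"
    proof (rule Kfun_greatest)
      fix x y assume "x \<in> carr A0" "y \<in> carr A1" "f = x + y"
      then have "\<not> qnorm A0 x + ennreal t * qnorm A1 y \<le> 2 * Kfun t f A0 A1"
        using n that by metis
      then show "2 * Kfun t f A0 A1 \<le> qnorm A0 x + ennreal t * qnorm A1 y" by simp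
    qed
    then show False using less by simp
  qed
qed

text \<open>Each component has a direct bound by its own norm and an indirect one as f minus the
  other component. For x the indirect one is used up to t and the direct one in general; for y the
  direct bound is linear in u, and the indirect one is used beyond t.\<close>

lemma Kfun_decomposition:
  obtains c where "c < top"
    "\<And>f t. f \<in> sum_carr A0 A1 \<Longrightarrow> 0 < t \<Longrightarrow> \<exists>x\<in>carr A0. \<exists>y\<in>carr A1. f = x + y \<and>
      (\<forall>u. 0 < u \<longrightarrow> u \<le> t \<longrightarrow> Kfun u x A0 A1 \<le> c * Kfun u f A0 A1) \<and>
      (\<forall>u. Kfun u x A0 A1 \<le> c * Kfun t f A0 A1) \<and>
      (\<forall>u. 0 < u \<longrightarrow> Kfun u y A0 A1 \<le> ennreal (u / t) * (c * Kfun t f A0 A1)) \<and>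
      (\<forall>u. t \<le> u \<longrightarrow> Kfun u y A0 A1 \<le> c * Kfun u f A0 A1)"
proof -
  obtain C where C: "1 \<le> C" "C < top"
    "\<And>u f g. Kfun u (f + g) A0 A1 \<le> C * (Kfun u f A0 A1 + Kfun u g A0 A1)"
    using Kfun_add by blast
  show ?thesis
  \<comment> \<open>The 3 is 1 + 2: the K-functional of f itself, and twice it for the other
    component.\<close>
  proof (rule that[of "C * 3"])
    show "C * 3 < top" using C(2) by (simp add: ennreal_mult_less_top)
    fix f and t :: real assume f: "f \<in> sum_carr A0 A1" and t: "0 < t"
    let ?k = "\<lambda>u. Kfun u f A0 A1"
    have k: "quasiconcave ?k" by (rule Kfun_quasiconcave)
    obtain x y where xy: "x \<in> carr A0" "y \<in> carr A1" "f = x + y" "qnorm A0 x + ennreal t * qnorm A1 y \<le> 2 * ?k t"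
      using near_optimal_decomposition[OF f t] by blast
    have x: "qnorm A0 x \<le> 2 * ?k t" by (rule order_trans[OF _ xy(4)]) simp
    have yt: "ennreal t * qnorm A1 y \<le> 2 * ?k t" by (rule order_trans[OF _ xy(4)]) simp
    have y: "ennreal u * qnorm A1 y \<le> ennreal (u / t) * (2 * ?k t)" if "0 < u" for u
    proof -
      have "ennreal u = ennreal (u / t) * ennreal t" using that t by (simp add: ennreal_mult[symmetric])
      then have "ennreal u * qnorm A1 y = ennreal (u / t) * (ennreal t * qnorm A1 y)" by (simp add: mult.assoc)
      also have "\<dots> \<le> ennreal (u / t) * (2 * ?k t)" by (intro mult_left_mono yt) auto
      finally show ?thesis .
    qed
    have two: "2 * z \<le> C * 3 * z" for z :: ennreal
    proof -
      have "(2::ennreal) \<le> 1 * 3" by simp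
      also have "\<dots> \<le> C * 3" using C(1) by (intro mult_right_mono) auto
      finally show ?thesis by (rule mult_right_mono) simp
    qed
    have three: "C * (z + 2 * z) = C * 3 * z" for z :: ennreal
    proof -
      have "z + 2 * z = 3 * z" using distrib_right[of 1 2 z] by simp
      then show ?thesis by (simp add: mult.assoc)
    qed
    have 1: "Kfun u x A0 A1 \<le> C * 3 * ?k u" if u: "0 < u" "u \<le> t" for u
    proof -
      have "x = f + (- y)" using xy by simp
      then have "Kfun u x A0 A1 \<le> C * (?k u + Kfun u (- y) A0 A1)" using C(3) by metis
      also have "Kfun u (- y) A0 A1 \<le> ennreal u * qnorm A1 y"
        using Kfun_le_qnorm1[of "- y" u] xy(2) subspace_neg[OF subspaces(2)] qnorm_uminus(2) by simp
      also have "\<dots> \<le> ennreal (u / t) * (2 * ?k t)" by (rule y[OF u(1)])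
      also have "\<dots> \<le> ennreal (u / t) * (2 * (ennreal (t / u) * ?k u))"
        using k u by (intro mult_left_mono) (auto simp: quasiconcave_def)
      also have "\<dots> = (ennreal (u / t) * ennreal (t / u)) * (2 * ?k u)" by (simp add: mult_ac)
      also have "ennreal (u / t) * ennreal (t / u) = 1" using u t by (simp add: ennreal_mult[symmetric])
      finally show ?thesis unfolding mult_1 three by (simp add: mult_left_mono)
    qed
    have 2: "Kfun u x A0 A1 \<le> C * 3 * ?k t" for u
      by (rule order_trans[OF Kfun_le_qnorm0[OF xy(1)] order_trans[OF x two]])
    have 3: "Kfun u y A0 A1 \<le> ennreal (u / t) * (C * 3 * ?k t)" if "0 < u" for u
      by (rule order_trans[OF Kfun_le_qnorm1[OF xy(2)] order_trans[OF y[OF that] mult_left_mono[OF two]]]) simp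
    have 4: "Kfun u y A0 A1 \<le> C * 3 * ?k u" if u: "t \<le> u" for u
    proof -
      have "y = f + (- x)" using xy by simp
      then have "Kfun u y A0 A1 \<le> C * (?k u + Kfun u (- x) A0 A1)" using C(3) by metis
      also have "Kfun u (- x) A0 A1 \<le> qnorm A0 x"
        using Kfun_le_qnorm0[of "- x" u] xy(1) subspace_neg[OF subspaces(1)] qnorm_uminus(1) by simp
      also have "\<dots> \<le> 2 * ?k t" by (rule x)
      also have "\<dots> \<le> 2 * ?k u" using quasiconcave_mono[OF k u] by (rule mult_left_mono) simp
      finally show ?thesis unfolding three by (simp add: mult_left_mono)
    qed
    show "\<exists>x\<in>carr A0. \<exists>y\<in>carr A1. f = x + y \<and>
      (\<forall>u. 0 < u \<longrightarrow> u \<le> t \<longrightarrow> Kfun u x A0 A1 \<le> C * 3 * Kfun u f A0 A1) \<and>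
      (\<forall>u. Kfun u x A0 A1 \<le> C * 3 * Kfun t f A0 A1) \<and>
      (\<forall>u. 0 < u \<longrightarrow> Kfun u y A0 A1 \<le> ennreal (u / t) * (C * 3 * Kfun t f A0 A1)) \<and>
      (\<forall>u. t \<le> u \<longrightarrow> Kfun u y A0 A1 \<le> C * 3 * Kfun u f A0 A1)"
      using xy 1 2 3 4 by blast
  qed
qed

lemma sum_carr_add: "f \<in> sum_carr A0 A1 \<Longrightarrow> g \<in> sum_carr A0 A1 \<Longrightarrow> f + g \<in> sum_carr A0 A1"
proof -
  assume "f \<in> sum_carr A0 A1" "g \<in> sum_carr A0 A1"
  then obtain x y x' y' where *: "f = x + y" "g = x' + y'" "x \<in> carr A0" "y \<in> carr A1" "x' \<in> carr A0" "y' \<in> carr A1"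
    by (auto simp: sum_carr_def)
  then have "f + g = (x + x') + (y + y')" by (simp add: algebra_simps)
  then show ?thesis using * subspace_add[OF subspaces(1)] subspace_add[OF subspaces(2)]
    unfolding sum_carr_def by blast
qed

lemma carr_in_sum: "x \<in> carr A0 \<Longrightarrow> x \<in> sum_carr A0 A1" "y \<in> carr A1 \<Longrightarrow> y \<in> sum_carr A0 A1"
  using zero_carr unfolding sum_carr_def by force+

end

section \<open>The interpolation spaces\<close>

lemma Lnorm_weight: "Lnorm q S (\<lambda>u. weight \<theta> q b u * k u) = hnorm q S (\<lambda>u. ennreal (b u) * (ennreal (u powr (- \<theta>)) * k u))"
proof -
  have e: "u powr (- \<theta> - recip q) * b u = u powr (- recip q) * (u powr (- \<theta>) * b u)" for u
  proof -
    have "- \<theta> - recip q = - recip q + - \<theta>" by simp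
    then show ?thesis by (simp only: powr_add mult.assoc)
  qed
  have "weight \<theta> q b u * k u = ennreal (u powr (- recip q)) * (ennreal (b u) * (ennreal (u powr (- \<theta>)) * k u))" for u
    unfolding weight_def e ennreal_mult'[OF powr_ge_zero] by (simp only: mult_ac)
  then show ?thesis by (simp add: hnorm_def)
qed

lemma Lnorm_weight_0: "Lnorm q S (\<lambda>u. weight 0 q b u * k u) = hnorm q S (\<lambda>u. ennreal (b u) * k u)"
  by (simp add: hnorm_def weight_def ennreal_mult' mult.assoc)

lemma Lnorm_weight_0': "Lnorm q S (weight 0 q b) = hnorm q S (\<lambda>u. ennreal (b u))"
  using Lnorm_weight_0[of q S b "\<lambda>u. 1"] by simp

lemma finite_space_inter:
  "finite_space X Y N \<inter>\<^sub>q finite_space X Y M = finite_space X Y (\<lambda>f. max (N f) (M f))"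
  by (auto simp: finite_space_def space_inter_def)

text \<open>The two sides consist of elements of different sums, of which only one inclusion is
  available in general. The third hypothesis recovers membership in the smaller sum from finiteness
  of the norm.\<close>

lemma space_eq_finite_spaces:
  assumes "K < top" "sum_carr X Y \<subseteq> sum_carr A B"
    and "\<And>f. f \<in> sum_carr A B \<Longrightarrow> N f < top \<Longrightarrow> f \<in> sum_carr X Y"
    and "\<And>f. f \<in> sum_carr A B \<Longrightarrow> N f \<le> K * M f" "\<And>f. f \<in> sum_carr A B \<Longrightarrow> M f \<le> K * N f"
  shows "finite_space X Y N \<cong>\<^sub>q finite_space A B M"
proof -
  have K: "ennreal (enn2real K) = K" using assms(1) by simp
  have fin: "K * x < top" if "x < top" for x
    using assms(1) that by (simp add: ennreal_mult_less_top)
  have 1: "cont_embedded (finite_space X Y N) (finite_space A B M)"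
  proof -
    have "M f < top" if "f \<in> sum_carr X Y" "N f < top" for f
      using assms(5)[of f] fin[OF that(2)] assms(2) that(1) by (auto intro: le_less_trans)
    then show ?thesis
      unfolding cont_embedded_def finite_space_def
      using assms(2,5) by (auto intro!: exI[of _ "enn2real K"] simp: K)
  qed
  have 2: "cont_embedded (finite_space A B M) (finite_space X Y N)"
  proof -
    have "N f < top" if "f \<in> sum_carr A B" "M f < top" for f
      using assms(4)[OF that(1)] fin[OF that(2)] by (rule le_less_trans)
    then show ?thesis
      unfolding cont_embedded_def finite_space_def
      using assms(3,4) by (auto intro!: exI[of _ "enn2real K"] simp: K)
  qed
  show ?thesis using 1 2 by (simp add: space_eq_def)
qed

text \<open>A quasi-triangle inequality for nonmeasurable F and F', at the cost of the constant in
  their equivalence with Borel functions.\<close>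

lemma hnorm_add_equiv:
  assumes "0 < q" "S \<in> sets borel" "S \<subseteq> {0<..}" "c < top"
    and [measurable]: "G \<in> borel_measurable borel" "G' \<in> borel_measurable borel"
    and "\<And>t. t \<in> S \<Longrightarrow> F t \<le> G t" "\<And>t. t \<in> S \<Longrightarrow> G t \<le> c * F t"
    and "\<And>t. t \<in> S \<Longrightarrow> F' t \<le> G' t" "\<And>t. t \<in> S \<Longrightarrow> G' t \<le> c * F' t"
  shows "hnorm q S (\<lambda>t. F t + F' t) \<le> ennreal (qconst q) * c * (hnorm q S F + hnorm q S F')"
proof -
  have "hnorm q S (\<lambda>t. F t + F' t) \<le> hnorm q S (\<lambda>t. G t + G' t)"
    using assms by (intro hnorm_mono add_mono) auto
  also have "\<dots> \<le> ennreal (qconst q) * (hnorm q S G + hnorm q S G')"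
    unfolding hnorm_def distrib_left
  proof (rule Lnorm_add[OF assms(1), unfolded distrib_left])
    have *: "h \<in> borel_measurable (lebesgue_on S)" if "h \<in> borel_measurable borel" for h :: "real \<Rightarrow> ennreal"
      by (intro measurable_restrict_space1 measurable_completion) (use that in simp)
    show "(\<lambda>u. ennreal (u powr - recip q) * G u) \<in> borel_measurable (lebesgue_on S)"
      "(\<lambda>u. ennreal (u powr - recip q) * G' u) \<in> borel_measurable (lebesgue_on S)"
      by (rule *; measurable)+
  qed
  also have "\<dots> \<le> ennreal (qconst q) * (c * hnorm q S F + c * hnorm q S F')"
    using assms by (intro mult_left_mono add_mono hnorm_le_cmult) auto
  finally show ?thesis by (simp only: distrib_left mult.assoc)
qed

section \<open>Holmstedt's formula for the couple of limiting spaces\<close>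

locale weighted_couple = weights \<theta>0 q0 q1 r0 r1 a0 a1 b0 b1 + couple A0 A1
  for \<theta>0 q0 q1 r0 r1 a0 a1 b0 b1 and A0 A1 :: "'a::hausdorff_tvs qspace"
begin

definition K\<^sub>A :: "'a \<Rightarrow> real \<Rightarrow> ennreal" where "K\<^sub>A f t = Kfun t f A0 A1"

definition X0 :: "'a qspace" where "X0 = interp_L A0 A1 \<theta>0 r0 b0 q0 a0"
definition X1 :: "'a qspace" where "X1 = interp_L A0 A1 1 r1 b1 q1 a1"

abbreviation \<Sigma> :: "'a set" where "\<Sigma> \<equiv> sum_carr A0 A1"

lemma K\<^sub>A_quasiconcave: "quasiconcave (K\<^sub>A f)"
  unfolding K\<^sub>A_def[abs_def] by (rule Kfun_quasiconcave)

lemma X0_eq: "X0 = finite_space A0 A1 (\<lambda>f. N0 (K\<^sub>A f))"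
  unfolding X0_def interp_L_def Lnorm_weight_0 Lnorm_weight N0_def P_def K\<^sub>A_def ..

lemma X1_eq: "X1 = finite_space A0 A1 (\<lambda>f. N1 (K\<^sub>A f))"
  unfolding X1_def interp_L_def Lnorm_weight_0 Lnorm_weight N1_def Q_def K\<^sub>A_def ..

lemma carr_X: "x \<in> carr X0 \<longleftrightarrow> x \<in> \<Sigma> \<and> N0 (K\<^sub>A x) < top" "x \<in> carr X1 \<longleftrightarrow> x \<in> \<Sigma> \<and> N1 (K\<^sub>A x) < top"
  by (simp_all add: X0_eq X1_eq finite_space_def)

lemma qnorm_X: "qnorm X0 x = N0 (K\<^sub>A x)" "qnorm X1 x = N1 (K\<^sub>A x)"
  by (simp_all add: X0_eq X1_eq finite_space_def)

lemma sum_carr_X: "sum_carr X0 X1 \<subseteq> \<Sigma>"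
  using sum_carr_add carr_X by (auto simp: sum_carr_def[of X0 X1])

definition holmstedt :: "(real \<Rightarrow> ennreal) \<Rightarrow> real \<Rightarrow> ennreal" where
  "holmstedt k t = I k t + II k t + ennreal (\<rho> t) * III k t"

lemma Kfun_X_le_holmstedt:
  obtains K where "K < top"
    "\<And>f t. f \<in> \<Sigma> \<Longrightarrow> 0 < t \<Longrightarrow> Kfun (\<rho> t) f X0 X1 \<le> K * holmstedt (K\<^sub>A f) t"
proof -
  obtain c where c: "c < top" and dec:
    "\<And>f t. f \<in> \<Sigma> \<Longrightarrow> 0 < t \<Longrightarrow> \<exists>x\<in>carr A0. \<exists>y\<in>carr A1. f = x + y \<and>
      (\<forall>u. 0 < u \<longrightarrow> u \<le> t \<longrightarrow> Kfun u x A0 A1 \<le> c * Kfun u f A0 A1) \<and>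
      (\<forall>u. Kfun u x A0 A1 \<le> c * Kfun t f A0 A1) \<and>
      (\<forall>u. 0 < u \<longrightarrow> Kfun u y A0 A1 \<le> ennreal (u / t) * (c * Kfun t f A0 A1)) \<and>
      (\<forall>u. t \<le> u \<longrightarrow> Kfun u y A0 A1 \<le> c * Kfun u f A0 A1)"
    using Kfun_decomposition by blast
  obtain L0 where L0: "L0 < top"
    "\<And>k k' t. quasiconcave k \<Longrightarrow> quasiconcave k' \<Longrightarrow> 0 < t \<Longrightarrow> k t < top \<Longrightarrow> (\<And>u. 0 < u \<Longrightarrow> u \<le> t \<Longrightarrow> k' u \<le> c * k u) \<Longrightarrow>
      (\<And>u. t \<le> u \<Longrightarrow> k' u \<le> c * k t) \<Longrightarrow> N0 k' \<le> L0 * (I k t + II k t)"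
    using N0_le_I_II[OF c] by blast
  obtain L1 where L1: "L1 < top"
    "\<And>k k' t. quasiconcave k \<Longrightarrow> quasiconcave k' \<Longrightarrow> 0 < t \<Longrightarrow> k t < top \<Longrightarrow>
      (\<And>u. 0 < u \<Longrightarrow> u \<le> t \<Longrightarrow> k' u \<le> ennreal (u / t) * (c * k t)) \<Longrightarrow>
      (\<And>u. t \<le> u \<Longrightarrow> k' u \<le> c * k u) \<Longrightarrow> N1 k' \<le> L1 * (ktil k t + III k t)"
    using N1_le_III[OF c] by blast
  obtain L2 where L2: "L2 < top" "\<And>k t. quasiconcave k \<Longrightarrow> 0 < t \<Longrightarrow> khat k t \<le> L2 * II k t"
    using khat_le_II by blast
  show ?thesis
  proof (rule that[of "L0 + L1 * (L2 + 1)"])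
    show "L0 + L1 * (L2 + 1) < top" using L0(1) L1(1) L2(1) by (simp add: ennreal_mult_less_top)
    fix f and t :: real assume f: "f \<in> \<Sigma>" and t: "0 < t"
    let ?k = "K\<^sub>A f"
    obtain x y where xy: "x \<in> carr A0" "y \<in> carr A1" "f = x + y" and
      d: "\<forall>u. 0 < u \<longrightarrow> u \<le> t \<longrightarrow> K\<^sub>A x u \<le> c * ?k u" "\<forall>u. K\<^sub>A x u \<le> c * ?k t"
         "\<forall>u. 0 < u \<longrightarrow> K\<^sub>A y u \<le> ennreal (u / t) * (c * ?k t)" "\<forall>u. t \<le> u \<longrightarrow> K\<^sub>A y u \<le> c * ?k u"
      using dec[OF f t] unfolding K\<^sub>A_def by blast
    have fin: "?k t < top" unfolding K\<^sub>A_def by (rule Kfun_finite[OF f])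
    have n0: "N0 (K\<^sub>A x) \<le> L0 * (I ?k t + II ?k t)"
      using d(1,2) by (intro L0(2) K\<^sub>A_quasiconcave t fin) auto
    have n1: "N1 (K\<^sub>A y) \<le> L1 * (ktil ?k t + III ?k t)"
      using d(3,4) by (intro L1(2) K\<^sub>A_quasiconcave t fin) auto
    have n0': "N0 (K\<^sub>A x) \<le> L0 * holmstedt ?k t"
      by (rule order_trans[OF n0]) (intro mult_left_mono, auto simp: holmstedt_def)
    \<comment> \<open>The factor \<open>\<rho> t\<close> turns \<open>ktil\<close> into
      \<open>khat\<close>, which \<open>II\<close> dominates, so that only the three terms of the
      formula remain.\<close>
    have "ennreal (\<rho> t) * N1 (K\<^sub>A y) \<le> ennreal (\<rho> t) * (L1 * (ktil ?k t + III ?k t))"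
      by (rule mult_left_mono[OF n1]) simp
    also have "\<dots> = L1 * (khat ?k t + ennreal (\<rho> t) * III ?k t)"
      by (simp only: khat_ktil[OF t] distrib_left mult_ac)
    also have "\<dots> \<le> L1 * (L2 * holmstedt ?k t + 1 * holmstedt ?k t)"
    proof (intro mult_left_mono add_mono)
      show "khat ?k t \<le> L2 * holmstedt ?k t"
        by (rule order_trans[OF L2(2)[OF K\<^sub>A_quasiconcave t]]) (intro mult_left_mono, auto simp: holmstedt_def add_increasing add_increasing2)
    qed (auto simp: holmstedt_def)
    also have "\<dots> = L1 * (L2 + 1) * holmstedt ?k t" by (simp only: distrib_right mult.assoc)
    finally have n1': "ennreal (\<rho> t) * N1 (K\<^sub>A y) \<le> L1 * (L2 + 1) * holmstedt ?k t" .
    have sum: "N0 (K\<^sub>A x) + ennreal (\<rho> t) * N1 (K\<^sub>A y) \<le> (L0 + L1 * (L2 + 1)) * holmstedt ?k t"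
      using add_mono[OF n0' n1'] by (simp only: distrib_right)
    \<comment> \<open>The components belong to X0 and X1 only if their norms are finite, which a
      finite right side guarantees. Otherwise the claim is trivial.\<close>
    show "Kfun (\<rho> t) f X0 X1 \<le> (L0 + L1 * (L2 + 1)) * holmstedt ?k t"
    proof (cases "(L0 + L1 * (L2 + 1)) * holmstedt ?k t = top")
      case True
      show ?thesis unfolding True by simp
    next
      case False
      then have lt: "N0 (K\<^sub>A x) + ennreal (\<rho> t) * N1 (K\<^sub>A y) < top"
        by (intro le_less_trans[OF sum]) (simp only: less_top)
      then have "x \<in> carr X0" "y \<in> carr X1"
        using carr_in_sum xy \<rho>_pos[OF t] by (auto simp: carr_X ennreal_mult_less_top)
      then have "Kfun (\<rho> t) f X0 X1 \<le> N0 (K\<^sub>A x) + ennreal (\<rho> t) * N1 (K\<^sub>A y)"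
        using Kfun_le[of x X0 y X1 "\<rho> t"] xy(3) by (simp add: qnorm_X)
      then show ?thesis using sum by (rule order_trans)
    qed
  qed
qed

lemma holmstedt_le_Kfun_X:
  obtains K where "K < top"
    "\<And>f t. 0 < t \<Longrightarrow> holmstedt (K\<^sub>A f) t \<le> K * Kfun (\<rho> t) f X0 X1"
proof -
  obtain C where C: "1 \<le> C" "C < top"
    "\<And>u f g. Kfun u (f + g) A0 A1 \<le> C * (Kfun u f A0 A1 + Kfun u g A0 A1)"
    using Kfun_add by blast
  obtain K where K: "K < top"
    "\<And>k k0 k1 t. quasiconcave k \<Longrightarrow> quasiconcave k0 \<Longrightarrow> quasiconcave k1 \<Longrightarrow> 0 < t \<Longrightarrow> (\<And>u. 0 < u \<Longrightarrow> k u \<le> C * (k0 u + k1 u)) \<Longrightarrow>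
      I k t + II k t + ennreal (\<rho> t) * III k t \<le> K * (N0 k0 + ennreal (\<rho> t) * N1 k1)"
    using I_II_III_le_sum[OF C(2)] by blast
  show ?thesis
  proof (rule that[of "K + 1"])
    show "K + 1 < top" using K(1) by simp
    fix f and t :: real assume t: "0 < t"
    show "holmstedt (K\<^sub>A f) t \<le> (K + 1) * Kfun (\<rho> t) f X0 X1"
      unfolding Kfun_def
    proof (rule ennreal_le_mult_Inf)
      show "K + 1 \<noteq> 0" "K + 1 < top" using K(1) by auto
      fix z assume "z \<in> {qnorm X0 x + ennreal (\<rho> t) * qnorm X1 y |x y. x \<in> carr X0 \<and> y \<in> carr X1 \<and> f = x + y}"
      then obtain x y where xy: "f = x + y" "z = N0 (K\<^sub>A x) + ennreal (\<rho> t) * N1 (K\<^sub>A y)"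
        by (auto simp: qnorm_X)
      have "holmstedt (K\<^sub>A f) t \<le> K * z"
        unfolding holmstedt_def xy(2)
      proof (rule K(2)[OF K\<^sub>A_quasiconcave K\<^sub>A_quasiconcave K\<^sub>A_quasiconcave t])
        show "K\<^sub>A f u \<le> C * (K\<^sub>A x u + K\<^sub>A y u)" for u
          unfolding K\<^sub>A_def xy(1) by (rule C(3))
      qed
      also have "\<dots> \<le> (K + 1) * z" by (intro mult_right_mono) auto
      finally show "holmstedt (K\<^sub>A f) t \<le> (K + 1) * z" .
    qed
  qed
qed

definition interp_norm :: "real \<Rightarrow> ennreal \<Rightarrow> (real \<Rightarrow> real) \<Rightarrow> 'a \<Rightarrow> ennreal" where
  "interp_norm \<theta> r a f = hnorm r {0<..} (\<lambda>u. ennreal (a u) * (ennreal (u powr (- \<theta>)) * Kfun u f X0 X1))"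

definition holmstedt_norm :: "real \<Rightarrow> ennreal \<Rightarrow> (real \<Rightarrow> real) \<Rightarrow> 'a \<Rightarrow> ennreal" where
  "holmstedt_norm \<theta> r a f = hnorm r {0<..} (\<lambda>t. ennreal (w \<theta> a t) * holmstedt (K\<^sub>A f) t)"

lemma interp_X: "interp X0 X1 \<theta> r a = finite_space X0 X1 (interp_norm \<theta> r a)"
  unfolding interp_def Lnorm_weight interp_norm_def[abs_def] ..

text \<open>The integrand of the outer norm is tame because the K-functional of any couple is
  quasiconcave. So the substitution applies to it before anything is known about X0 and X1, and the
  formula is inserted afterwards.\<close>

lemma interp_norm_holmstedt_norm:
  assumes "sv a" "0 < r"
  obtains K where "K < top"
    "\<And>f. f \<in> \<Sigma> \<Longrightarrow> interp_norm \<theta> r a f \<le> K * holmstedt_norm \<theta> r a f"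
    "\<And>f. f \<in> \<Sigma> \<Longrightarrow> holmstedt_norm \<theta> r a f \<le> K * interp_norm \<theta> r a f"
proof -
  obtain C n where C: "0 < (C :: real)" "0 \<le> n"
    "\<And>k. quasiconcave k \<Longrightarrow> tame C n (\<lambda>u. ennreal (a u) * (ennreal (u powr (- \<theta>)) * k u))"
    using sv_powr_quasiconcave_tame[OF assms(1)] by blast
  have \<kappa>: "0 < 1 - \<theta>0" using \<theta>0 by simp
  obtain V where V: "0 < V"
    "\<And>F. tame C n F \<Longrightarrow> hnorm r {0<..} F \<le> ennreal V * hnorm r {0<..} (\<lambda>t. F (\<rho> t))"
    "\<And>F. tame C n F \<Longrightarrow> hnorm r {0<..} (\<lambda>t. F (\<rho> t)) \<le> ennreal V * hnorm r {0<..} F"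
    by (rule hnorm_change_of_variables[OF assms(2) \<kappa> sv_\<phi> \<rho>_def C(1,2)]) (rule that, assumption, blast, blast)
  obtain L where L: "L < top"
    "\<And>f t. f \<in> \<Sigma> \<Longrightarrow> 0 < t \<Longrightarrow> Kfun (\<rho> t) f X0 X1 \<le> L * holmstedt (K\<^sub>A f) t"
    using Kfun_X_le_holmstedt by blast
  obtain M where M: "M < top"
    "\<And>f t. 0 < t \<Longrightarrow> holmstedt (K\<^sub>A f) t \<le> M * Kfun (\<rho> t) f X0 X1"
    using holmstedt_le_Kfun_X by blast
  have w: "ennreal (a (\<rho> t)) * (ennreal (\<rho> t powr (- \<theta>)) * z) = ennreal (w \<theta> a t) * z" for t z
    unfolding w_def ennreal_mult'[OF powr_ge_zero] by (simp only: mult_ac)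
  have t: "tame C n (\<lambda>u. ennreal (a u) * (ennreal (u powr (- \<theta>)) * Kfun u f X0 X1))" for f
    by (intro C(3) Kfun_quasiconcave)
  show ?thesis
  proof (rule that[of "ennreal V * L + M * ennreal V"])
    show "ennreal V * L + M * ennreal V < top" using L(1) M(1) by (simp add: ennreal_mult_less_top)
    fix f assume f: "f \<in> \<Sigma>"
    have "interp_norm \<theta> r a f \<le> ennreal V * hnorm r {0<..} (\<lambda>t. ennreal (w \<theta> a t) * Kfun (\<rho> t) f X0 X1)"
      unfolding interp_norm_def using V(2)[OF t[of f]] by (simp only: w)
    also have "\<dots> \<le> ennreal V * (L * holmstedt_norm \<theta> r a f)"
      unfolding holmstedt_norm_def
    proof (intro mult_left_mono hnorm_le_cmult assms L(1))
      fix s :: real assume "s \<in> {0<..}"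
      then have "ennreal (w \<theta> a s) * Kfun (\<rho> s) f X0 X1 \<le> ennreal (w \<theta> a s) * (L * holmstedt (K\<^sub>A f) s)"
        using f by (intro mult_left_mono L(2)) auto
      then show "ennreal (w \<theta> a s) * Kfun (\<rho> s) f X0 X1 \<le> L * (ennreal (w \<theta> a s) * holmstedt (K\<^sub>A f) s)"
        by (simp only: mult_ac)
    qed simp
    also have "\<dots> \<le> (ennreal V * L + M * ennreal V) * holmstedt_norm \<theta> r a f"
      by (simp add: distrib_right mult.assoc)
    finally show "interp_norm \<theta> r a f \<le> (ennreal V * L + M * ennreal V) * holmstedt_norm \<theta> r a f" .
    have "holmstedt_norm \<theta> r a f \<le> M * hnorm r {0<..} (\<lambda>t. ennreal (w \<theta> a t) * Kfun (\<rho> t) f X0 X1)"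
      unfolding holmstedt_norm_def
    proof (intro hnorm_le_cmult assms M(1))
      fix s :: real assume "s \<in> {0<..}"
      then have "ennreal (w \<theta> a s) * holmstedt (K\<^sub>A f) s \<le> ennreal (w \<theta> a s) * (M * Kfun (\<rho> s) f X0 X1)"
        by (intro mult_left_mono M(2)) auto
      then show "ennreal (w \<theta> a s) * holmstedt (K\<^sub>A f) s \<le> M * (ennreal (w \<theta> a s) * Kfun (\<rho> s) f X0 X1)"
        by (simp only: mult_ac)
    qed
    also have "\<dots> \<le> M * (ennreal V * interp_norm \<theta> r a f)"
      unfolding interp_norm_def using V(3)[OF t[of f]] by (intro mult_left_mono) (simp_all only: w zero_le)
    also have "\<dots> \<le> (ennreal V * L + M * ennreal V) * interp_norm \<theta> r a f"
      by (simp add: distrib_right mult.assoc)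
    finally show "holmstedt_norm \<theta> r a f \<le> (ennreal V * L + M * ennreal V) * interp_norm \<theta> r a f" .
  qed
qed

text \<open>Outside the sum of X0 and X1 the K-functional is an infimum over the empty set, hence
  infinite at every argument, and one infinite value of a tame integrand makes the norm
  infinite.\<close>

lemma interp_norm_finite:
  assumes "sv a" "0 < r" "interp_norm \<theta> r a f < top"
  shows "f \<in> sum_carr X0 X1"
proof (rule ccontr)
  assume "f \<notin> sum_carr X0 X1"
  then have top: "Kfun 1 f X0 X1 = top" by (rule Kfun_eq_top)
  obtain C n where C: "0 < (C :: real)" "0 \<le> n"
    "\<And>k. quasiconcave k \<Longrightarrow> tame C n (\<lambda>u. ennreal (a u) * (ennreal (u powr (- \<theta>)) * k u))"
    using sv_powr_quasiconcave_tame[OF assms(1)] by blast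
  let ?F = "\<lambda>u. ennreal (a u) * (ennreal (u powr (- \<theta>)) * Kfun u f X0 X1)"
  obtain K where K: "K < top"
    "\<And>G t. tame C n G \<Longrightarrow> 0 < t \<Longrightarrow> G t \<le> K * hnorm r {t<..} G"
    using hnorm_tame_lower'[OF assms(2) less_imp_le[OF C(1)] C(2)] by metis
  have F1: "?F 1 \<le> K * hnorm r {1<..} ?F"
    by (rule K(2)[OF C(3)[OF Kfun_quasiconcave] zero_less_one])
  have "?F 1 = top" using sv_pos[OF assms(1), of 1] by (simp add: top ennreal_mult_top)
  moreover have "hnorm r {1<..} ?F < top"
    by (rule le_less_trans[OF _ assms(3)]) (unfold interp_norm_def, intro hnorm_subset assms, auto)
  then have "K * hnorm r {1<..} ?F < top"
    using K(1) by (simp add: ennreal_mult_less_top)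
  ultimately show False using F1 by (simp only: top_unique less_irrefl)
qed

section \<open>Outer norms of the three terms\<close>

lemma w_shift: "0 < t \<Longrightarrow> w (\<theta> - 1) a t = w \<theta> a t * \<rho> t"
  using \<rho>_pos[of t] by (simp add: w_def powr_diff powr_minus_divide)

lemma w_borel:
  assumes "sv a"
  obtains g c where "g \<in> borel_measurable borel" "c < top"
    "\<And>t. 0 < t \<Longrightarrow> ennreal (w \<theta> a t) \<le> g t" "\<And>t. 0 < t \<Longrightarrow> g t \<le> c * ennreal (w \<theta> a t)"
proof -
  have sv: "sv (\<lambda>t. \<phi> t powr (- \<theta>) * a (\<rho> t))" by (intro sv_mult sv_powr sv_\<phi> sv_a_\<rho> assms)
  then obtain v D where v [measurable]: "v \<in> borel_measurable borel" and "0 < D"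
    and vb: "\<And>t. 0 < t \<Longrightarrow> \<phi> t powr (- \<theta>) * a (\<rho> t) \<le> v t" "\<And>t. 0 < t \<Longrightarrow> v t \<le> D * (\<phi> t powr (- \<theta>) * a (\<rho> t))"
    using sv_equiv_borel by blast
  have w: "w \<theta> a t = t powr ((1 - \<theta>0) * (- \<theta>)) * (\<phi> t powr (- \<theta>) * a (\<rho> t))" if "0 < t" for t
    unfolding w_def \<rho>_powr[OF that] mult.assoc by (rule refl)
  show ?thesis
  proof (rule that[of "\<lambda>t. ennreal (t powr ((1 - \<theta>0) * (- \<theta>)) * v t)" "ennreal D"])
    show "(\<lambda>t. ennreal (t powr ((1 - \<theta>0) * (- \<theta>)) * v t)) \<in> borel_measurable borel" by measurable
    fix t :: real assume t: "0 < t"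
    show "ennreal (w \<theta> a t) \<le> ennreal (t powr ((1 - \<theta>0) * (- \<theta>)) * v t)"
      unfolding w[OF t] by (intro ennreal_leI mult_left_mono vb t) simp
    have "t powr ((1 - \<theta>0) * (- \<theta>)) * v t \<le> t powr ((1 - \<theta>0) * (- \<theta>)) * (D * (\<phi> t powr (- \<theta>) * a (\<rho> t)))"
      by (intro mult_left_mono vb t) simp
    also have "\<dots> = D * w \<theta> a t" unfolding w[OF t] by (simp only: mult_ac)
    finally show "ennreal (t powr ((1 - \<theta>0) * (- \<theta>)) * v t) \<le> ennreal D * ennreal (w \<theta> a t)"
      using \<open>0 < D\<close> w_pos[OF assms t] by (simp add: ennreal_mult[symmetric] less_imp_le ennreal_leI)
  qed simp
qed

text \<open>Two exponents occur because \<open>III\<close> carries the weight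
  \<open>w (\<theta> - 1) a\<close>, while \<open>I\<close> and \<open>II\<close> carry
  \<open>w \<theta> a\<close>.\<close>

lemma hnorm_w_add:
  assumes "sv a" "0 < r"
  obtains K where "K < top"
    "\<And>g h. g \<in> borel_measurable borel \<Longrightarrow> h \<in> borel_measurable borel \<Longrightarrow>
      hnorm r {0<..} (\<lambda>t. ennreal (w \<theta> a t) * g t + ennreal (w \<theta>' a t) * h t) \<le>
      K * (hnorm r {0<..} (\<lambda>t. ennreal (w \<theta> a t) * g t) + hnorm r {0<..} (\<lambda>t. ennreal (w \<theta>' a t) * h t))"
proof -
  obtain u c where u [measurable]: "u \<in> borel_measurable borel" and c: "c < top"
    "\<And>t. 0 < t \<Longrightarrow> ennreal (w \<theta> a t) \<le> u t" "\<And>t. 0 < t \<Longrightarrow> u t \<le> c * ennreal (w \<theta> a t)"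
    using w_borel[OF assms(1)] by blast
  obtain u' c' where u' [measurable]: "u' \<in> borel_measurable borel" and c': "c' < top"
    "\<And>t. 0 < t \<Longrightarrow> ennreal (w \<theta>' a t) \<le> u' t" "\<And>t. 0 < t \<Longrightarrow> u' t \<le> c' * ennreal (w \<theta>' a t)"
    using w_borel[OF assms(1)] by blast
  have le: "x \<le> (c + c') * z" if "x \<le> c * z \<or> x \<le> c' * z" for x z
    using that by (auto simp: distrib_right add_increasing add_increasing2)
  show ?thesis
  proof (rule that[of "ennreal (qconst r) * (c + c')"])
    show "ennreal (qconst r) * (c + c') < top" using c(1) c'(1) by (simp add: ennreal_mult_less_top)
    fix g h :: "real \<Rightarrow> ennreal" assume [measurable]: "g \<in> borel_measurable borel" "h \<in> borel_measurable borel"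
    show "hnorm r {0<..} (\<lambda>t. ennreal (w \<theta> a t) * g t + ennreal (w \<theta>' a t) * h t) \<le>
      ennreal (qconst r) * (c + c') * (hnorm r {0<..} (\<lambda>t. ennreal (w \<theta> a t) * g t) + hnorm r {0<..} (\<lambda>t. ennreal (w \<theta>' a t) * h t))"
    proof (rule hnorm_add_equiv[where G = "\<lambda>t. u t * g t" and G' = "\<lambda>t. u' t * h t"])
      show "c + c' < top" using c(1) c'(1) by simp
      fix t :: real assume "t \<in> {0<..}"
      then have t: "0 < t" by simp
      show "ennreal (w \<theta> a t) * g t \<le> u t * g t" "ennreal (w \<theta>' a t) * h t \<le> u' t * h t"
        using c(2) c'(2) t by (auto intro: mult_right_mono)
      have "u t * g t \<le> c * ennreal (w \<theta> a t) * g t" "u' t * h t \<le> c' * ennreal (w \<theta>' a t) * h t"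
        using c(3) c'(3) t by (auto intro: mult_right_mono)
      then show "u t * g t \<le> (c + c') * (ennreal (w \<theta> a t) * g t)" "u' t * h t \<le> (c + c') * (ennreal (w \<theta>' a t) * h t)"
        by (auto intro!: le simp: mult.assoc)
    qed (use assms in measurable)
  qed
qed

lemma I_measurable: "I k \<in> borel_measurable borel"
proof -
  have "I k s \<le> I k t" if "s \<le> t" for s t
    unfolding I_def using that by (intro hnorm_subset r0) auto
  then show ?thesis by (intro borel_measurable_mono_ennreal monoI)
qed

lemma II_measurable: "II k \<in> borel_measurable borel"
proof -
  have "T0 \<in> borel_measurable borel"
    by (intro borel_measurable_antimono_ennreal antimonoI T0_antimono)
  then show ?thesis using P_measurable[of k] unfolding II_def[abs_def] by measurable
qed

lemma III_measurable: "III k \<in> borel_measurable borel"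
proof -
  have "III k t \<le> III k s" if "s \<le> t" for s t
  proof -
    have "III k t \<le> hnorm r1 {t<..} (\<lambda>u. ennreal (b1 u) * Q k s u)"
      unfolding III_def using that by (intro hnorm_mono mult_left_mono Q_mono) auto
    also have "\<dots> \<le> III k s" unfolding III_def using that by (intro hnorm_subset r1) auto
    finally show ?thesis .
  qed
  then show ?thesis by (intro borel_measurable_antimono_ennreal antimonoI)
qed

definition nI :: "real \<Rightarrow> ennreal \<Rightarrow> (real \<Rightarrow> real) \<Rightarrow> (real \<Rightarrow> ennreal) \<Rightarrow> ennreal" where
  "nI \<theta> r a k = hnorm r {0<..} (\<lambda>t. ennreal (w \<theta> a t) * I k t)"
definition nII :: "real \<Rightarrow> ennreal \<Rightarrow> (real \<Rightarrow> real) \<Rightarrow> (real \<Rightarrow> ennreal) \<Rightarrow> ennreal" where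
  "nII \<theta> r a k = hnorm r {0<..} (\<lambda>t. ennreal (w \<theta> a t) * II k t)"
text \<open>The factor \<open>\<rho>\<close> is absorbed into the weight by lowering \<theta> by 1,
  see \<open>w_shift\<close>. The remaining factor \<open>III\<close> is monotone, hence Borel, as
  \<open>hnorm_w_add\<close> requires.\<close>

definition nIII :: "real \<Rightarrow> ennreal \<Rightarrow> (real \<Rightarrow> real) \<Rightarrow> (real \<Rightarrow> ennreal) \<Rightarrow> ennreal" where
  "nIII \<theta> r a k = hnorm r {0<..} (\<lambda>t. ennreal (w (\<theta> - 1) a t) * III k t)"
definition nkhat :: "real \<Rightarrow> ennreal \<Rightarrow> (real \<Rightarrow> real) \<Rightarrow> (real \<Rightarrow> ennreal) \<Rightarrow> ennreal" where
  "nkhat \<theta> r a k = hnorm r {0<..} (\<lambda>t. ennreal (w \<theta> a t) * khat k t)"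

lemma w_shift_ennreal: "sv a \<Longrightarrow> 0 < t \<Longrightarrow> ennreal (w (\<theta> - 1) a t) = ennreal (w \<theta> a t) * ennreal (\<rho> t)"
  using w_pos[of a t \<theta>] \<rho>_pos[of t] by (simp add: w_shift ennreal_mult less_imp_le)

lemma parts_le_holmstedt_norm:
  assumes "sv a"
  shows "nI \<theta> r a (K\<^sub>A f) \<le> holmstedt_norm \<theta> r a f" "nII \<theta> r a (K\<^sub>A f) \<le> holmstedt_norm \<theta> r a f"
    "nIII \<theta> r a (K\<^sub>A f) \<le> holmstedt_norm \<theta> r a f"
proof -
  show "nI \<theta> r a (K\<^sub>A f) \<le> holmstedt_norm \<theta> r a f" "nII \<theta> r a (K\<^sub>A f) \<le> holmstedt_norm \<theta> r a f"
    unfolding nI_def nII_def holmstedt_norm_def holmstedt_def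
    by (intro hnorm_mono mult_left_mono; simp add: add_increasing add_increasing2)+
  show "nIII \<theta> r a (K\<^sub>A f) \<le> holmstedt_norm \<theta> r a f"
    unfolding nIII_def holmstedt_norm_def holmstedt_def
    by (intro hnorm_mono) (simp add: w_shift_ennreal[OF assms] mult.assoc mult_left_mono)
qed

lemma nkhat_le:
  assumes "0 < r"
  obtains K where "K < top" "\<And>k. quasiconcave k \<Longrightarrow> nkhat \<theta> r a k \<le> K * nII \<theta> r a k"
proof -
  obtain L where L: "L < top" "\<And>k t. quasiconcave k \<Longrightarrow> 0 < t \<Longrightarrow> khat k t \<le> L * II k t"
    using khat_le_II by blast
  show ?thesis
  proof (rule that[OF L(1)])
    fix k assume k: "quasiconcave k"
    show "nkhat \<theta> r a k \<le> L * nII \<theta> r a k"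
      unfolding nkhat_def nII_def
    proof (rule hnorm_le_cmult[OF assms L(1)])
      fix t :: real assume "t \<in> {0<..}"
      then have "ennreal (w \<theta> a t) * khat k t \<le> ennreal (w \<theta> a t) * (L * II k t)"
        using k by (intro mult_left_mono L(2)) auto
      then show "ennreal (w \<theta> a t) * khat k t \<le> L * (ennreal (w \<theta> a t) * II k t)" by (simp only: mult_ac)
    qed
  qed
qed

lemma nIII_le_nkhat:
  assumes "sv a" "0 < r" "\<theta> < 1"
  obtains K where "K < top" "\<And>k. quasiconcave k \<Longrightarrow> nIII \<theta> r a k \<le> K * nkhat \<theta> r a k"
proof -
  have "nIII \<theta> r a k = hnorm r {0<..} (\<lambda>t. ennreal (w \<theta> a t) * (ennreal (\<rho> t) * III k t))" for k
    unfolding nIII_def by (intro hnorm_cong) (simp add: w_shift_ennreal[OF assms(1)] mult.assoc)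
  then show ?thesis using hnorm_III_le[OF assms] that unfolding nkhat_def by metis
qed

text \<open>\<open>I\<close> and \<open>II\<close> stay together in the first estimate, because for
  \<theta> > 0 they are bounded jointly by \<open>khat\<close>. The second one separates them for
  \<theta> = 0.\<close>

lemma holmstedt_norm_le_parts:
  assumes "sv a" "0 < r"
  obtains K where "K < top"
    "\<And>f. holmstedt_norm \<theta> r a f \<le> K * (hnorm r {0<..} (\<lambda>t. ennreal (w \<theta> a t) * (I (K\<^sub>A f) t + II (K\<^sub>A f) t)) + nIII \<theta> r a (K\<^sub>A f))"
    "\<And>f. hnorm r {0<..} (\<lambda>t. ennreal (w \<theta> a t) * (I (K\<^sub>A f) t + II (K\<^sub>A f) t)) \<le> K * (nI \<theta> r a (K\<^sub>A f) + nII \<theta> r a (K\<^sub>A f))"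
proof -
  obtain K where K: "K < top" "\<And>g h. g \<in> borel_measurable borel \<Longrightarrow> h \<in> borel_measurable borel \<Longrightarrow>
      hnorm r {0<..} (\<lambda>t. ennreal (w \<theta> a t) * g t + ennreal (w (\<theta> - 1) a t) * h t) \<le>
      K * (hnorm r {0<..} (\<lambda>t. ennreal (w \<theta> a t) * g t) + hnorm r {0<..} (\<lambda>t. ennreal (w (\<theta> - 1) a t) * h t))"
    using hnorm_w_add[OF assms] by blast
  obtain L where L: "L < top" "\<And>g h. g \<in> borel_measurable borel \<Longrightarrow> h \<in> borel_measurable borel \<Longrightarrow>
      hnorm r {0<..} (\<lambda>t. ennreal (w \<theta> a t) * g t + ennreal (w \<theta> a t) * h t) \<le>
      L * (hnorm r {0<..} (\<lambda>t. ennreal (w \<theta> a t) * g t) + hnorm r {0<..} (\<lambda>t. ennreal (w \<theta> a t) * h t))"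
    using hnorm_w_add[OF assms] by blast
  have KL: "K * z \<le> (K + L) * z" "L * z \<le> (K + L) * z" for z
    by (auto intro: mult_right_mono)
  show ?thesis
  proof (rule that[of "K + L"])
    show "K + L < top" using K(1) L(1) by simp
    fix f
    let ?k = "K\<^sub>A f"
    have m: "(\<lambda>t. I ?k t + II ?k t) \<in> borel_measurable borel"
      by (rule borel_measurable_add[OF I_measurable II_measurable])
    have "holmstedt_norm \<theta> r a f = hnorm r {0<..} (\<lambda>t. ennreal (w \<theta> a t) * (I ?k t + II ?k t) + ennreal (w (\<theta> - 1) a t) * III ?k t)"
      unfolding holmstedt_norm_def holmstedt_def
      by (intro hnorm_cong) (simp add: w_shift_ennreal[OF assms(1)] distrib_left mult.assoc)
    also have "\<dots> \<le> K * (hnorm r {0<..} (\<lambda>t. ennreal (w \<theta> a t) * (I ?k t + II ?k t)) + nIII \<theta> r a ?k)"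
      unfolding nIII_def by (rule K(2)[OF m III_measurable])
    also note KL(1)
    finally show "holmstedt_norm \<theta> r a f \<le> (K + L) * (hnorm r {0<..} (\<lambda>t. ennreal (w \<theta> a t) * (I ?k t + II ?k t)) + nIII \<theta> r a ?k)" .
    have "hnorm r {0<..} (\<lambda>t. ennreal (w \<theta> a t) * (I ?k t + II ?k t)) \<le> L * (nI \<theta> r a ?k + nII \<theta> r a ?k)"
      unfolding nI_def nII_def distrib_left[of "ennreal (w \<theta> a _)"]
      by (rule L(2)[OF I_measurable II_measurable])
    also note KL(2)
    finally show "hnorm r {0<..} (\<lambda>t. ennreal (w \<theta> a t) * (I ?k t + II ?k t)) \<le> (K + L) * (nI \<theta> r a ?k + nII \<theta> r a ?k)" .
  qed
qed

section \<open>The interior case and the two endpoint cases\<close>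

lemma interp_X_eqI:
  assumes "sv a" "0 < r" "K < top"
    "\<And>f. f \<in> \<Sigma> \<Longrightarrow> holmstedt_norm \<theta> r a f \<le> K * M f" "\<And>f. f \<in> \<Sigma> \<Longrightarrow> M f \<le> K * holmstedt_norm \<theta> r a f"
  shows "interp X0 X1 \<theta> r a \<cong>\<^sub>q finite_space A0 A1 M"
proof -
  obtain L where L: "L < top"
    "\<And>f. f \<in> \<Sigma> \<Longrightarrow> interp_norm \<theta> r a f \<le> L * holmstedt_norm \<theta> r a f"
    "\<And>f. f \<in> \<Sigma> \<Longrightarrow> holmstedt_norm \<theta> r a f \<le> L * interp_norm \<theta> r a f"
    using interp_norm_holmstedt_norm[OF assms(1,2)] by blast
  show ?thesis
    unfolding interp_X
  proof (rule space_eq_finite_spaces[where K = "L * K", OF _ sum_carr_X])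
    show "L * K < top" using L(1) assms(3) by (simp add: ennreal_mult_less_top)
    fix f assume f: "f \<in> \<Sigma>"
    show "f \<in> sum_carr X0 X1" if "interp_norm \<theta> r a f < top" using interp_norm_finite[OF assms(1,2) that] .
    have "L * holmstedt_norm \<theta> r a f \<le> L * (K * M f)" by (intro mult_left_mono assms f) simp
    then show "interp_norm \<theta> r a f \<le> L * K * M f"
      using L(2)[OF f] by (simp add: mult.assoc)
    have "K * holmstedt_norm \<theta> r a f \<le> K * (L * interp_norm \<theta> r a f)" by (intro mult_left_mono L(3) f) simp
    then show "M f \<le> L * K * interp_norm \<theta> r a f"
      using assms(5)[OF f] by (simp add: mult_ac)
  qed
qed

text \<open>For 0 < \<theta> < 1 both Hardy type estimates are available, so every term is absorbed
  by the norm of \<open>khat\<close>. Conversely \<open>khat\<close> lies below \<open>II\<close>.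
  The norm of \<open>khat\<close> is the one on the right, by a computation with weights.\<close>

lemma interp_between:
  assumes "sv a" "0 < r" "0 < \<theta>" "\<theta> < 1"
  shows "interp X0 X1 \<theta> r a \<cong>\<^sub>q interp A0 A1 ((1 - \<theta>) * \<theta>0 + \<theta>) r (\<lambda>t. \<chi>0 t powr (1 - \<theta>) * \<chi>1 t powr \<theta> * a (\<rho> t))"
proof -
  let ?\<eta> = "(1 - \<theta>) * \<theta>0 + \<theta>"
  let ?ash = "\<lambda>t. \<chi>0 t powr (1 - \<theta>) * \<chi>1 t powr \<theta> * a (\<rho> t)"
  \<comment> \<open>Inserting the definition of \<open>\<rho>\<close> combines \<phi>^(-\<theta>)
    with \<chi>0 to the mixed product of powers of \<chi>0 and \<chi>1, and the powers of t to the
    exponent -\<eta>.\<close>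
  have weight: "?ash t * t powr (- ?\<eta>) = w \<theta> a t * (\<chi>0 t * t powr (- \<theta>0))" if t: "0 < t" for t
  proof -
    have p: "0 < \<chi>0 t" "0 < \<chi>1 t" using sv_pos[OF sv_\<chi>0 t] sv_pos[OF sv_\<chi>1 t] by auto
    have "\<phi> t powr (- \<theta>) * \<chi>0 t = \<chi>0 t powr (1 - \<theta>) * \<chi>1 t powr \<theta>"
      using p by (simp add: \<phi>_def powr_divide powr_diff powr_minus field_simps)
    moreover have "t powr ((1 - \<theta>0) * (- \<theta>)) * t powr (- \<theta>0) = t powr (- ?\<eta>)"
      by (simp only: powr_add[symmetric]) (simp add: algebra_simps)
    ultimately have "?ash t * t powr (- ?\<eta>) = (\<phi> t powr (- \<theta>) * \<chi>0 t) * a (\<rho> t) * (t powr ((1 - \<theta>0) * (- \<theta>)) * t powr (- \<theta>0))"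
      by simp
    also have "\<dots> = w \<theta> a t * (\<chi>0 t * t powr (- \<theta>0))" unfolding w_def \<rho>_powr[OF t] by (simp only: mult_ac)
    finally show ?thesis .
  qed
  have rhs: "interp A0 A1 ?\<eta> r ?ash = finite_space A0 A1 (\<lambda>f. nkhat \<theta> r a (K\<^sub>A f))"
  proof -
    have "ennreal (?ash t) * (ennreal (t powr (- ?\<eta>)) * z) = ennreal (w \<theta> a t) * (ennreal (\<chi>0 t * t powr (- \<theta>0)) * z)"
      if t: "0 < t" for t z
    proof -
      have "ennreal (?ash t) * ennreal (t powr (- ?\<eta>)) = ennreal (w \<theta> a t) * ennreal (\<chi>0 t * t powr (- \<theta>0))"
        using ennreal_mult''[of "t powr (- ?\<eta>)" "?ash t"] ennreal_mult'[OF less_imp_le[OF w_pos[OF assms(1) t]], of \<theta> "\<chi>0 t * t powr (- \<theta>0)"]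
          weight[OF t] by (simp only: powr_ge_zero)
      then show ?thesis by (simp only: mult.assoc[symmetric])
    qed
    then have "hnorm r {0<..} (\<lambda>t. ennreal (?ash t) * (ennreal (t powr (- ?\<eta>)) * k t)) = nkhat \<theta> r a k" for k
      unfolding nkhat_def khat_def by (intro hnorm_cong) auto
    then show ?thesis unfolding interp_def Lnorm_weight by (simp add: K\<^sub>A_def[abs_def])
  qed
  obtain K where K: "K < top"
    "\<And>f. holmstedt_norm \<theta> r a f \<le> K * (hnorm r {0<..} (\<lambda>t. ennreal (w \<theta> a t) * (I (K\<^sub>A f) t + II (K\<^sub>A f) t)) + nIII \<theta> r a (K\<^sub>A f))"
    "\<And>f. hnorm r {0<..} (\<lambda>t. ennreal (w \<theta> a t) * (I (K\<^sub>A f) t + II (K\<^sub>A f) t)) \<le> K * (nI \<theta> r a (K\<^sub>A f) + nII \<theta> r a (K\<^sub>A f))"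
    using holmstedt_norm_le_parts[OF assms(1,2)] by blast
  obtain L where L: "L < top"
    "\<And>k. quasiconcave k \<Longrightarrow> hnorm r {0<..} (\<lambda>t. ennreal (w \<theta> a t) * (I k t + II k t)) \<le> L * nkhat \<theta> r a k"
    unfolding nkhat_def using hnorm_I_II_le[OF assms(1,2,3)] by blast
  obtain M where M: "M < top" "\<And>k. quasiconcave k \<Longrightarrow> nIII \<theta> r a k \<le> M * nkhat \<theta> r a k"
    using nIII_le_nkhat[OF assms(1,2,4)] by blast
  obtain S where S: "S < top" "\<And>k. quasiconcave k \<Longrightarrow> nkhat \<theta> r a k \<le> S * nII \<theta> r a k"
    using nkhat_le[OF assms(2)] by blast
  show ?thesis
    unfolding rhs
  proof (rule interp_X_eqI[where K = "K * (L + M) + S", OF assms(1,2)])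
    show "K * (L + M) + S < top" using K(1) L(1) M(1) S(1) by (simp add: ennreal_mult_less_top)
    fix f
    have "holmstedt_norm \<theta> r a f \<le> K * (L * nkhat \<theta> r a (K\<^sub>A f) + M * nkhat \<theta> r a (K\<^sub>A f))"
      by (rule order_trans[OF K(2)]) (intro mult_left_mono add_mono L(2) M(2) K\<^sub>A_quasiconcave, simp)
    also have "\<dots> \<le> (K * (L + M) + S) * nkhat \<theta> r a (K\<^sub>A f)"
      by (simp add: distrib_right mult.assoc)
    finally show "holmstedt_norm \<theta> r a f \<le> (K * (L + M) + S) * nkhat \<theta> r a (K\<^sub>A f)" .
    have "nkhat \<theta> r a (K\<^sub>A f) \<le> S * holmstedt_norm \<theta> r a f"
      by (rule order_trans[OF S(2)[OF K\<^sub>A_quasiconcave]]) (intro mult_left_mono parts_le_holmstedt_norm assms, simp)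
    also have "\<dots> \<le> (K * (L + M) + S) * holmstedt_norm \<theta> r a f" by (intro mult_right_mono) auto
    finally show "nkhat \<theta> r a (K\<^sub>A f) \<le> (K * (L + M) + S) * holmstedt_norm \<theta> r a f" .
  qed
qed

lemma w_0: "0 < t \<Longrightarrow> w 0 a t = a (\<rho> t)"
  using \<rho>_pos[of t] by (simp add: w_def)

text \<open>At \<theta> = 0 the weight has no decay left, so \<open>I\<close> and \<open>II\<close>
  survive as the two norms on the right. The term \<open>III\<close> is still absorbed, through
  \<open>khat\<close> and then \<open>II\<close>.\<close>

lemma interp_at_0:
  assumes "sv a" "0 < r"
  shows "interp X0 X1 0 r a \<cong>\<^sub>q
    interp_L A0 A1 \<theta>0 r (\<lambda>t. enn2real (T0 t) * a (\<rho> t)) q0 a0 \<inter>\<^sub>q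
    interp_LL A0 A1 \<theta>0 r (a \<circ> \<rho>) r0 b0 q0 a0"
proof -
  have II: "interp_L A0 A1 \<theta>0 r (\<lambda>t. enn2real (T0 t) * a (\<rho> t)) q0 a0 =
      finite_space A0 A1 (\<lambda>f. nII 0 r a (K\<^sub>A f))"
  proof -
    have "ennreal (enn2real (T0 t) * a (\<rho> t)) * P k t = ennreal (w 0 a t) * II k t" if "0 < t" for t k
    proof -
      have "ennreal (enn2real (T0 t) * a (\<rho> t)) = T0 t * ennreal (w 0 a t)"
        unfolding ennreal_mult'[OF enn2real_nonneg] T0_real[OF that] w_0[OF that] ..
      then show ?thesis by (simp only: II_def mult_ac)
    qed
    then have "hnorm r {0<..} (\<lambda>t. ennreal (enn2real (T0 t) * a (\<rho> t)) * P k t) = nII 0 r a k" for k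
      unfolding nII_def by (intro hnorm_cong) auto
    then show ?thesis
      unfolding interp_L_def Lnorm_weight_0 Lnorm_weight by (simp add: K\<^sub>A_def[abs_def] P_def)
  qed
  have I: "interp_LL A0 A1 \<theta>0 r (a \<circ> \<rho>) r0 b0 q0 a0 = finite_space A0 A1 (\<lambda>f. nI 0 r a (K\<^sub>A f))"
  proof -
    have "hnorm r {0<..} (\<lambda>t. ennreal ((a \<circ> \<rho>) t) * I k t) = nI 0 r a k" for k
      unfolding nI_def by (intro hnorm_cong) (simp add: w_0)
    then show ?thesis
      unfolding interp_LL_def Lnorm_weight_0 Lnorm_weight by (simp add: K\<^sub>A_def[abs_def] P_def I_def)
  qed
  obtain K where K: "K < top"
    "\<And>f. holmstedt_norm 0 r a f \<le> K * (hnorm r {0<..} (\<lambda>t. ennreal (w 0 a t) * (I (K\<^sub>A f) t + II (K\<^sub>A f) t)) + nIII 0 r a (K\<^sub>A f))"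
    "\<And>f. hnorm r {0<..} (\<lambda>t. ennreal (w 0 a t) * (I (K\<^sub>A f) t + II (K\<^sub>A f) t)) \<le> K * (nI 0 r a (K\<^sub>A f) + nII 0 r a (K\<^sub>A f))"
    using holmstedt_norm_le_parts[OF assms(1,2)] by blast
  obtain M where M: "M < top" "\<And>k. quasiconcave k \<Longrightarrow> nIII 0 r a k \<le> M * nkhat 0 r a k"
    using nIII_le_nkhat[OF assms(1,2) zero_less_one] by blast
  obtain S where S: "S < top" "\<And>k. quasiconcave k \<Longrightarrow> nkhat 0 r a k \<le> S * nII 0 r a k"
    using nkhat_le[OF assms(2)] by blast
  let ?M = "\<lambda>f. max (nII 0 r a (K\<^sub>A f)) (nI 0 r a (K\<^sub>A f))"
  show ?thesis
    unfolding II I finite_space_inter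
  proof (rule interp_X_eqI[where K = "K * (K * 2 + M * S) + 1", OF assms(1,2)])
    show "K * (K * 2 + M * S) + 1 < top" using K(1) M(1) S(1) by (simp add: ennreal_mult_less_top)
    fix f
    have "K * (nI 0 r a (K\<^sub>A f) + nII 0 r a (K\<^sub>A f)) \<le> K * (2 * ?M f)"
      unfolding mult_2 by (intro mult_left_mono add_mono) auto
    then have 1: "hnorm r {0<..} (\<lambda>t. ennreal (w 0 a t) * (I (K\<^sub>A f) t + II (K\<^sub>A f) t)) \<le> K * 2 * ?M f"
      using K(3)[of f] by (simp only: mult.assoc order_trans)
    have "M * nkhat 0 r a (K\<^sub>A f) \<le> M * (S * nII 0 r a (K\<^sub>A f))" by (intro mult_left_mono S(2) K\<^sub>A_quasiconcave) simp
    also have "\<dots> \<le> M * (S * ?M f)" by (intro mult_left_mono) auto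
    finally have 2: "nIII 0 r a (K\<^sub>A f) \<le> M * S * ?M f"
      using M(2)[OF K\<^sub>A_quasiconcave, of f] by (simp only: mult.assoc order_trans)
    have "holmstedt_norm 0 r a f \<le> K * (K * 2 * ?M f + M * S * ?M f)"
      by (rule order_trans[OF K(2)]) (intro mult_left_mono add_mono 1 2, simp)
    also have "\<dots> \<le> (K * (K * 2 + M * S) + 1) * ?M f"
      unfolding distrib_right[symmetric] mult.assoc[symmetric] by (intro mult_right_mono) auto
    finally show "holmstedt_norm 0 r a f \<le> (K * (K * 2 + M * S) + 1) * ?M f" .
    have "?M f \<le> 1 * holmstedt_norm 0 r a f" using parts_le_holmstedt_norm[OF assms(1)] by simp
    also have "\<dots> \<le> (K * (K * 2 + M * S) + 1) * holmstedt_norm 0 r a f" by (intro mult_right_mono) auto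
    finally show "?M f \<le> (K * (K * 2 + M * S) + 1) * holmstedt_norm 0 r a f" .
  qed
qed

text \<open>At \<theta> = 1 the roles change: \<open>I\<close> and \<open>II\<close> are absorbed by
  \<open>khat\<close>, while \<open>III\<close> survives. The norm of \<open>khat\<close> is the
  first space on the right, since \<open>\<rho>\<close> cancels against its reciprocal in the
  weight.\<close>

lemma interp_at_1:
  assumes "sv a" "0 < r"
  shows "interp X0 X1 1 r a \<cong>\<^sub>q
    interp A0 A1 1 r (\<lambda>t. \<chi>0 t powr (1 - 1) * \<chi>1 t powr 1 * a (\<rho> t)) \<inter>\<^sub>q
    interp_LR A0 A1 1 r (a \<circ> \<rho>) r1 b1 q1 a1"
proof -
  have khat: "interp A0 A1 1 r (\<lambda>t. \<chi>0 t powr (1 - 1) * \<chi>1 t powr 1 * a (\<rho> t)) =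
      finite_space A0 A1 (\<lambda>f. nkhat 1 r a (K\<^sub>A f))"
  proof -
    have "ennreal (\<chi>0 t powr (1 - 1) * \<chi>1 t powr 1 * a (\<rho> t)) * (ennreal (t powr - 1) * k t) =
        ennreal (w 1 a t) * khat k t" if t: "0 < t" for t k
    proof -
      have p: "0 < \<chi>0 t" "0 < \<chi>1 t" using sv_pos[OF sv_\<chi>0 t] sv_pos[OF sv_\<chi>1 t] by auto
      have "w 0 a t = w 1 a t * \<rho> t" using w_shift[OF t, of 1 a] by simp
      then have w: "a (\<rho> t) = w 1 a t * \<rho> t" using w_0[OF t] by simp
      have "\<chi>0 t powr (1 - 1) * \<chi>1 t powr 1 * a (\<rho> t) * t powr - 1 = w 1 a t * (\<rho> t * (\<chi>1 t * t powr -1))"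
        using p by (subst w) simp
      moreover have "ennreal (w 1 a t * (\<rho> t * (\<chi>1 t * t powr -1))) = ennreal (w 1 a t) * (ennreal (\<rho> t) * ennreal (\<chi>1 t * t powr -1))"
        using ennreal_mult'[OF less_imp_le[OF w_pos[OF assms(1) t]], of 1] ennreal_mult'[OF less_imp_le[OF \<rho>_pos[OF t]]]
        by (simp only:)
      ultimately have "ennreal (\<chi>0 t powr (1 - 1) * \<chi>1 t powr 1 * a (\<rho> t)) * ennreal (t powr - 1) =
          ennreal (w 1 a t) * (ennreal (\<rho> t) * ennreal (\<chi>1 t * t powr -1))"
        unfolding ennreal_mult''[OF powr_ge_zero, symmetric] by (simp only:)
      then show ?thesis unfolding khat_ktil[OF t] ktil_def by (simp only: mult.assoc[symmetric])
    qed
    then have "hnorm r {0<..} (\<lambda>t. ennreal (\<chi>0 t powr (1 - 1) * \<chi>1 t powr 1 * a (\<rho> t)) * (ennreal (t powr - 1) * k t)) = nkhat 1 r a k" for k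
      unfolding nkhat_def by (intro hnorm_cong) auto
    then show ?thesis unfolding interp_def Lnorm_weight K\<^sub>A_def[abs_def] by (simp only:)
  qed
  have III: "interp_LR A0 A1 1 r (a \<circ> \<rho>) r1 b1 q1 a1 = finite_space A0 A1 (\<lambda>f. nIII 1 r a (K\<^sub>A f))"
  proof -
    have "hnorm r {0<..} (\<lambda>t. ennreal ((a \<circ> \<rho>) t) * III k t) = nIII 1 r a k" for k
      unfolding nIII_def by (intro hnorm_cong) (simp add: w_0)
    then show ?thesis
      unfolding interp_LR_def Lnorm_weight_0 Lnorm_weight K\<^sub>A_def[abs_def] Q_def III_def by (simp only:)
  qed
  obtain K where K: "K < top"
    "\<And>f. holmstedt_norm 1 r a f \<le> K * (hnorm r {0<..} (\<lambda>t. ennreal (w 1 a t) * (I (K\<^sub>A f) t + II (K\<^sub>A f) t)) + nIII 1 r a (K\<^sub>A f))"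
    "\<And>f. hnorm r {0<..} (\<lambda>t. ennreal (w 1 a t) * (I (K\<^sub>A f) t + II (K\<^sub>A f) t)) \<le> K * (nI 1 r a (K\<^sub>A f) + nII 1 r a (K\<^sub>A f))"
    using holmstedt_norm_le_parts[OF assms(1,2)] by blast
  obtain L where L: "L < top"
    "\<And>k. quasiconcave k \<Longrightarrow> hnorm r {0<..} (\<lambda>t. ennreal (w 1 a t) * (I k t + II k t)) \<le> L * nkhat 1 r a k"
    unfolding nkhat_def using hnorm_I_II_le[OF assms(1,2) zero_less_one] by blast
  obtain S where S: "S < top" "\<And>k. quasiconcave k \<Longrightarrow> nkhat 1 r a k \<le> S * nII 1 r a k"
    using nkhat_le[OF assms(2)] by blast
  let ?M = "\<lambda>f. max (nkhat 1 r a (K\<^sub>A f)) (nIII 1 r a (K\<^sub>A f))"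
  let ?K = "K * (L + 1) + (S + 1)"
  show ?thesis
    unfolding khat III finite_space_inter
  proof (rule interp_X_eqI[where K = ?K, OF assms(1,2)])
    show "?K < top" using K(1) L(1) S(1) by (simp add: ennreal_mult_less_top)
    fix f
    have 1: "hnorm r {0<..} (\<lambda>t. ennreal (w 1 a t) * (I (K\<^sub>A f) t + II (K\<^sub>A f) t)) \<le> L * ?M f"
      by (rule order_trans[OF L(2)[OF K\<^sub>A_quasiconcave]]) (intro mult_left_mono, auto)
    have 2: "nIII 1 r a (K\<^sub>A f) \<le> 1 * ?M f" by simp
    have "holmstedt_norm 1 r a f \<le> K * (L * ?M f + 1 * ?M f)"
      by (rule order_trans[OF K(2)]) (intro mult_left_mono add_mono 1 2, simp)
    also have "\<dots> \<le> ?K * ?M f"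
      unfolding distrib_right[symmetric] mult.assoc[symmetric] by (intro mult_right_mono) auto
    finally show "holmstedt_norm 1 r a f \<le> ?K * ?M f" .
    have "nkhat 1 r a (K\<^sub>A f) \<le> S * holmstedt_norm 1 r a f"
      by (rule order_trans[OF S(2)[OF K\<^sub>A_quasiconcave]]) (intro mult_left_mono parts_le_holmstedt_norm assms, simp)
    also have "\<dots> \<le> (S + 1) * holmstedt_norm 1 r a f" by (intro mult_right_mono) auto
    finally have 3: "nkhat 1 r a (K\<^sub>A f) \<le> (S + 1) * holmstedt_norm 1 r a f" .
    have "nIII 1 r a (K\<^sub>A f) \<le> 1 * holmstedt_norm 1 r a f" using parts_le_holmstedt_norm[OF assms(1)] by simp
    also have "\<dots> \<le> (S + 1) * holmstedt_norm 1 r a f" by (intro mult_right_mono) auto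
    finally have "?M f \<le> (S + 1) * holmstedt_norm 1 r a f" using 3 by simp
    also have "\<dots> \<le> ?K * holmstedt_norm 1 r a f" by (intro mult_right_mono) auto
    finally show "?M f \<le> ?K * holmstedt_norm 1 r a f" .
  qed
qed

end

text \<open>Nothing is lost by \<open>enn2real\<close> in the defining equations: for t > 0 the tail
  of b0 and the sum defining \<chi>1 are finite, by \<open>T0_real\<close> and
  \<open>\<chi>1_real\<close>. The proof identifies the given functions with those of the
  locale.\<close>

theorem theorem34:
  fixes A\<^sub>0 A\<^sub>1 X\<^sub>0 X\<^sub>1 :: "'a::hausdorff_tvs qspace"
    and q\<^sub>0 q\<^sub>1 r\<^sub>0 r\<^sub>1 r :: ennreal
    and a\<^sub>0 a\<^sub>1 b\<^sub>0 b\<^sub>1 a \<chi>\<^sub>0 \<chi>\<^sub>1 \<rho> B\<^sub>0 :: "real \<Rightarrow> real"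
    and ash :: "real \<Rightarrow> real \<Rightarrow> real"
    and \<theta>\<^sub>0 :: real
  assumes "compatible_couple A\<^sub>0 A\<^sub>1" and "carr A\<^sub>0 \<inter> carr A\<^sub>1 \<noteq> {0}"
    and "0 < q\<^sub>1" and "0 < r\<^sub>1" and "a\<^sub>1 \<in> SV" and "b\<^sub>1 \<in> SV"
    and "Lnorm r\<^sub>1 {1<..} (weight 0 r\<^sub>1 b\<^sub>1) < top"
    and "Lnorm r\<^sub>1 {0<..<1} (\<lambda>s. weight 0 r\<^sub>1 b\<^sub>1 s * Lnorm q\<^sub>1 {0<..<s} (weight 0 q\<^sub>1 a\<^sub>1)) < top"
    and "\<And>t. \<chi>\<^sub>1 t = enn2real
           (Lnorm r\<^sub>1 {0<..<t} (\<lambda>s. weight 0 r\<^sub>1 b\<^sub>1 s * Lnorm q\<^sub>1 {0<..<s} (weight 0 q\<^sub>1 a\<^sub>1))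
            + Lnorm r\<^sub>1 {t<..} (weight 0 r\<^sub>1 b\<^sub>1) * Lnorm q\<^sub>1 {0<..<t} (weight 0 q\<^sub>1 a\<^sub>1))"
    and "0 < \<theta>\<^sub>0" and "\<theta>\<^sub>0 < 1"
    and "0 < r" and "0 < r\<^sub>0" and "0 < q\<^sub>0" and "a \<in> SV" and "a\<^sub>0 \<in> SV" and "b\<^sub>0 \<in> SV"
    and "Lnorm r\<^sub>0 {1<..} (weight 0 r\<^sub>0 b\<^sub>0) < top"
    and "\<And>t. \<chi>\<^sub>0 t = a\<^sub>0 t * enn2real (Lnorm r\<^sub>0 {t<..} (weight 0 r\<^sub>0 b\<^sub>0))"
    and "\<And>t. \<rho> t = t powr (1 - \<theta>\<^sub>0) * (\<chi>\<^sub>0 t / \<chi>\<^sub>1 t)"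
    and "\<And>\<theta> t. ash \<theta> t = \<chi>\<^sub>0 t powr (1 - \<theta>) * \<chi>\<^sub>1 t powr \<theta> * a (\<rho> t)"
    and "\<And>t. B\<^sub>0 t = enn2real (Lnorm r\<^sub>0 {t<..} (weight 0 r\<^sub>0 b\<^sub>0)) * a (\<rho> t)"
    and "X\<^sub>0 = interp_L A\<^sub>0 A\<^sub>1 \<theta>\<^sub>0 r\<^sub>0 b\<^sub>0 q\<^sub>0 a\<^sub>0"
    and "X\<^sub>1 = interp_L A\<^sub>0 A\<^sub>1 1 r\<^sub>1 b\<^sub>1 q\<^sub>1 a\<^sub>1"
  shows "(\<forall>\<theta>. 0 < \<theta> \<and> \<theta> < 1 \<longrightarrow>
            interp X\<^sub>0 X\<^sub>1 \<theta> r a \<cong>\<^sub>q interp A\<^sub>0 A\<^sub>1 ((1 - \<theta>) * \<theta>\<^sub>0 + \<theta>) r (ash \<theta>))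
       \<and> (Lnorm r {1<..} (weight 0 r a) < top \<longrightarrow>
            interp X\<^sub>0 X\<^sub>1 0 r a \<cong>\<^sub>q
              interp_L A\<^sub>0 A\<^sub>1 \<theta>\<^sub>0 r B\<^sub>0 q\<^sub>0 a\<^sub>0 \<inter>\<^sub>q interp_LL A\<^sub>0 A\<^sub>1 \<theta>\<^sub>0 r (a \<circ> \<rho>) r\<^sub>0 b\<^sub>0 q\<^sub>0 a\<^sub>0)
       \<and> (Lnorm r {0<..<1} (weight 0 r a) < top \<longrightarrow>
            interp X\<^sub>0 X\<^sub>1 1 r a \<cong>\<^sub>q
              interp A\<^sub>0 A\<^sub>1 1 r (ash 1) \<inter>\<^sub>q interp_LR A\<^sub>0 A\<^sub>1 1 r (a \<circ> \<rho>) r\<^sub>1 b\<^sub>1 q\<^sub>1 a\<^sub>1)"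
proof -
  interpret S: weighted_couple \<theta>\<^sub>0 q\<^sub>0 q\<^sub>1 r\<^sub>0 r\<^sub>1 a\<^sub>0 a\<^sub>1 b\<^sub>0 b\<^sub>1 A\<^sub>0 A\<^sub>1
    by unfold_locales
      (use assms(1,3-8,10-18) in \<open>simp_all add: SV_imp_sv Lnorm_weight_0 Lnorm_weight_0'\<close>)
  have \<chi>\<^sub>1: "\<chi>\<^sub>1 = S.\<chi>1"
    by (intro ext, subst assms(9))
      (simp add: S.\<chi>1_def S.X_def S.\<Phi>_def S.T1_def S.H1_def Lnorm_weight_0 Lnorm_weight_0')
  have \<chi>\<^sub>0: "\<chi>\<^sub>0 = S.\<chi>0"
    by (intro ext, subst assms(19)) (simp add: S.\<chi>0_def S.T0_def Lnorm_weight_0')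
  have \<rho>: "\<rho> = S.\<rho>"
    by (intro ext, subst assms(20)) (simp add: S.\<rho>_def S.\<phi>_def \<chi>\<^sub>0 \<chi>\<^sub>1)
  have ash: "ash \<theta> = (\<lambda>t. S.\<chi>0 t powr (1 - \<theta>) * S.\<chi>1 t powr \<theta> * a (S.\<rho> t))" for \<theta>
    by (intro ext, subst assms(21)) (simp only: \<chi>\<^sub>0 \<chi>\<^sub>1 \<rho>)
  have B\<^sub>0: "B\<^sub>0 = (\<lambda>t. enn2real (S.T0 t) * a (S.\<rho> t))"
    by (intro ext, subst assms(22)) (simp add: S.T0_def Lnorm_weight_0' \<rho>)
  have X: "X\<^sub>0 = S.X0" "X\<^sub>1 = S.X1"
    unfolding assms(23,24) S.X0_def S.X1_def by (rule refl)+
  have a: "sv a" and r: "0 < r" using assms(12,15) by (simp_all add: SV_imp_sv)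
  show ?thesis
    unfolding X ash B\<^sub>0 \<rho> using S.interp_between[OF a r] S.interp_at_0[OF a r] S.interp_at_1[OF a r] by blast
qed

end
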